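(* For all $d\in\mathbb{N}$, $\mathsf{WSF}\bigl(\overline{\mathfrak{F}_{\mathrm w}(\mathbb{Z}^d)}\bigr)=\mathsf{WSF}(\mathbb{Z}^d)$, that is, the two probability measures agree.
   Context: $\mathbb{N}$ is the set of positive integers; $\mathbb{Z}^d$ is the nearest-neighbour integer lattice graph. Wired spanning forest: for a finite connected graph $K$, $\mathsf{UST}(K)$ is the uniform measure on spanning trees of $K$. Let $G$ be a locally finite, infinite, connected graph. For a finite, connected subgraph $H$ of $G$, let $\widehat H$ be the finite graph obtained from $G$ by identifying all vertices not in $H$ to a single vertex, and let $\mathsf{WSF}(H):=\mathsf{UST}(\widehat H)$. An exhaustion of $G$ is a sequence $\langle G_n\rangle$ of finite connected subgraphs with $G_n\subset G_{n+1}$ and $\bigcup_n G_n=G$. For an exhaustion by induced subgraphs and any fixed finite subgraph $H$ of $G$, the weak limit of $\mathsf{WSF}(G_n)\cap H$ exists; varying $H$ gives a probability measure $\mathsf{WSF}(G)$ on subgraphs of $G$, the wired spanning forest of $G$. $\mathfrak{F}_{\mathrm w}(G)$ denotes a random sample with law $\mathsf{WSF}(G)$; its components are a.s. infinite. Induced-component graph: for a subgraph $H$ of $G$, $\overline H$ is the subgraph of $G$ with the same vertex set as $H$ in which an edge of $G$ is present iff both its endpoints lie in the same connected component of $H$. For a random subgraph $H$ of $G$ all of whose components are infinite, $\mathsf{WSF}(H)$ denotes the unconditional law of the random subgraph of $G$ obtained by first sampling $H$ and then, given $H$, sampling a wired spanning forest independently on each component of $H$. *)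

theory Defs
  imports "HOL-Probability.Probability"
begin

text \<open>Undirected multigraphs: \<open>ends e\<close> is the set of endpoints of the edge \<open>e\<close>, a singleton
  if \<open>e\<close> is a loop. Multigraphs are needed because identifying vertices of a simple graph may
  create parallel edges and loops.\<close>

record ('v, 'e) mgraph =
  verts :: "'v set"
  edges :: "'e set"
  ends :: "'e \<Rightarrow> 'v set"

definition finite_graph :: "('v, 'e) mgraph \<Rightarrow> bool" where
  "finite_graph G \<longleftrightarrow> finite (verts G) \<and> finite (edges G)"

definition adj :: "('v, 'e) mgraph \<Rightarrow> 'v rel" where
  "adj G = {(u, v). \<exists>e\<in>edges G. ends G e = {u, v}}"

definition connected_graph :: "('v, 'e) mgraph \<Rightarrow> bool" where
  "connected_graph G \<longleftrightarrow> verts G \<noteq> {} \<and> (\<forall>u\<in>verts G. \<forall>v\<in>verts G. (u, v) \<in> (adj G)\<^sup>*)"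

definition components :: "('v, 'e) mgraph \<Rightarrow> 'v set set" where
  "components G = (\<lambda>u. {v \<in> verts G. (u, v) \<in> (adj G)\<^sup>*}) ` verts G"

text \<open>A loop is a cycle of length 1, and a pair of parallel edges is a cycle of length 2.\<close>

definition is_cycle :: "('v, 'e) mgraph \<Rightarrow> 'v list \<Rightarrow> 'e list \<Rightarrow> bool" where
  "is_cycle G vs es \<longleftrightarrow> es \<noteq> [] \<and> length vs = length es \<and> distinct vs \<and> distinct es \<and>
     set es \<subseteq> edges G \<and>
     (\<forall>i<length es. ends G (es ! i) = {vs ! i, vs ! (Suc i mod length es)})"

definition is_tree :: "('v, 'e) mgraph \<Rightarrow> bool" where
  "is_tree G \<longleftrightarrow> connected_graph G \<and> \<not> (\<exists>vs es. is_cycle G vs es)"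

definition subgraph :: "('v, 'e) mgraph \<Rightarrow> ('v, 'e) mgraph \<Rightarrow> bool" where
  "subgraph H G \<longleftrightarrow> verts H \<subseteq> verts G \<and> edges H \<subseteq> edges G \<and> ends H = ends G \<and>
     (\<forall>e\<in>edges H. ends H e \<subseteq> verts H)"

definition induced_subgraph :: "('v, 'e) mgraph \<Rightarrow> 'v set \<Rightarrow> ('v, 'e) mgraph" where
  "induced_subgraph G W = G\<lparr>verts := W, edges := {e \<in> edges G. ends G e \<subseteq> W}\<rparr>"

text \<open>A spanning subgraph, i.e. one containing all vertices, is represented by its edge set;
  \<open>spanning_subgraph\<close> recovers the graph.\<close>

definition spanning_subgraph :: "('v, 'e) mgraph \<Rightarrow> 'e set \<Rightarrow> ('v, 'e) mgraph" where
  "spanning_subgraph G T = G\<lparr>edges := T\<rparr>"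

definition subgraph_space :: "('v, 'e) mgraph \<Rightarrow> 'e set measure" where
  "subgraph_space G =
     sigma (Pow (edges G)) ((\<lambda>e. {T \<in> Pow (edges G). e \<in> T}) ` edges G)"

definition spanning_trees :: "('v, 'e) mgraph \<Rightarrow> 'e set set" where
  "spanning_trees K = {T. T \<subseteq> edges K \<and> is_tree (spanning_subgraph K T)}"

definition UST :: "('v, 'e) mgraph \<Rightarrow> 'e set pmf" where
  "UST K = pmf_of_set (spanning_trees K)"

text \<open>\<open>wired G H\<close> is obtained from \<open>G\<close> by identifying all vertices outside \<open>H\<close> to the single vertex
  \<open>None\<close>. Edges of \<open>G\<close> with no endpoint in \<open>H\<close> would become loops at \<open>None\<close>; these are discarded,
  so that the result is a finite graph. All other edges keep their identity, so edges of \<open>G\<close>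
  joining a vertex of \<open>H\<close> to distinct vertices outside \<open>H\<close> become distinct parallel edges, and
  spanning trees of \<open>wired G H\<close> are sets of edges of \<open>G\<close>. Being the image of \<open>verts G\<close>, the vertex
  set does not contain \<open>None\<close> if \<open>H\<close> already contains all vertices of \<open>G\<close>.\<close>

definition wired :: "('v, 'e) mgraph \<Rightarrow> ('v, 'e) mgraph \<Rightarrow> ('v option, 'e) mgraph" where
  "wired G H =
     (let \<phi> = (\<lambda>v. if v \<in> verts H then Some v else None)
      in \<lparr>verts = \<phi> ` verts G, edges = {e \<in> edges G. ends G e \<inter> verts H \<noteq> {}},
          ends = (\<lambda>e. \<phi> ` ends G e)\<rparr>)"

definition WSF_finite :: "('v, 'e) mgraph \<Rightarrow> ('v, 'e) mgraph \<Rightarrow> 'e set pmf" where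
  "WSF_finite G H = UST (wired G H)"

definition exhaustion :: "('v, 'e) mgraph \<Rightarrow> (nat \<Rightarrow> ('v, 'e) mgraph) \<Rightarrow> bool" where
  "exhaustion G Gs \<longleftrightarrow>
     (\<forall>n. subgraph (Gs n) G \<and> finite_graph (Gs n) \<and> connected_graph (Gs n) \<and>
          subgraph (Gs n) (Gs (Suc n))) \<and>
     (\<Union>n. verts (Gs n)) = verts G \<and> (\<Union>n. edges (Gs n)) = edges G"

definition induced_exhaustion :: "('v, 'e) mgraph \<Rightarrow> (nat \<Rightarrow> ('v, 'e) mgraph) \<Rightarrow> bool" where
  "induced_exhaustion G Gs \<longleftrightarrow>
     exhaustion G Gs \<and> (\<forall>n. Gs n = induced_subgraph G (verts (Gs n)))"

text \<open>The wired spanning forest measure is the weak limit along exhaustions by induced subgraphs.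
  For a finite subgraph \<open>H\<close>, the laws of the intersections with \<open>H\<close> live on the finite set of
  subsets of \<open>edges H\<close>, where weak convergence is convergence of the probability of each point.
  On a finite connected graph, every exhaustion is eventually constant and the definition
  yields the uniform spanning tree.\<close>

definition is_WSF :: "('v, 'e) mgraph \<Rightarrow> 'e set measure \<Rightarrow> bool" where
  "is_WSF G M \<longleftrightarrow> prob_space M \<and> space M = Pow (edges G) \<and> sets M = sets (subgraph_space G) \<and>
     (\<forall>Gs H A. induced_exhaustion G Gs \<longrightarrow> subgraph H G \<longrightarrow> finite_graph H \<longrightarrow> A \<subseteq> edges H \<longrightarrow>
        (\<lambda>n. measure_pmf.prob (WSF_finite G (Gs n)) {T. T \<inter> edges H = A})
          \<longlonglongrightarrow> measure M {T \<in> space M. T \<inter> edges H = A})"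

definition WSF :: "('v, 'e) mgraph \<Rightarrow> 'e set measure" where
  "WSF G = (THE M. is_WSF G M)"

definition component_closure :: "('v, 'e) mgraph \<Rightarrow> ('v, 'e) mgraph \<Rightarrow> ('v, 'e) mgraph" where
  "component_closure G H = H\<lparr>edges := {e \<in> edges G. \<exists>C\<in>components H. ends G e \<subseteq> C}\<rparr>"

text \<open>The law of the union of independent wired spanning forests of the components of \<open>H\<close>, where
  \<open>H\<close> is a spanning subgraph of \<open>G\<close>; this is the conditional law given \<open>H\<close> for random \<open>H\<close>.\<close>

definition WSF_components :: "('v, 'e) mgraph \<Rightarrow> ('v, 'e) mgraph \<Rightarrow> 'e set measure" where
  "WSF_components G H =
     distr (\<Pi>\<^sub>M C\<in>components H. WSF (induced_subgraph H C)) (subgraph_space G)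
       (\<lambda>F. \<Union>C\<in>components H. F C)"

text \<open>The unconditional law when the random spanning subgraph \<open>H\<close> of \<open>G\<close> has law \<open>\<mu>\<close>.\<close>

definition WSF_random :: "('v, 'e) mgraph \<Rightarrow> 'e set measure \<Rightarrow> 'e set measure" where
  "WSF_random G \<mu> = \<mu> \<bind> (\<lambda>T. WSF_components G (spanning_subgraph G T))"

definition lattice_graph :: "(int ^ 'd::finite, (int ^ 'd) set) mgraph" where
  "lattice_graph =
     \<lparr>verts = UNIV, edges = {{x, y} | x y. (\<Sum>i\<in>UNIV. \<bar>x $ i - y $ i\<bar>) = 1}, ends = (\<lambda>e. e)\<rparr>"

end

(*
  For a partition of the vertices into connected blocks, let the graph obtained by wiring the
  complement of a finite set W inside every block carry its uniform spanning forest. A uniform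
  spanning tree of a large wired graph, conditioned on its edges outside a finite set and on the
  partition it induces inside, is a uniform spanning forest of the blocks without any wiring.
  Wiring decreases the uniform spanning forest stochastically (Rayleigh monotonicity and the
  theorem of Feder and Mihail), so passing to the limit shows that WSF(Z^d) stochastically
  dominates the resampled forest. Both forests have only infinite components and are invariant
  under translations, and Z^d is amenable, so both have expected degree 2 at the origin. Hence
  their edge marginals agree, and stochastic domination with equal marginals is equality.
*)

theory Submission
  imports Defs
begin

section \<open>Connectivity modulo identifications and bases of the graphic matroid\<close>

text \<open>Vertices are never merged. An identification is a relation \<open>R\<close> on the fixed
  vertex type and \<open>bases en R E\<close> are the maximal forests of \<open>E\<close> modulo
  \<open>R\<close>, so wired trees, blockwise wired forests and unwired forests differ only in
  \<open>R\<close>. Adding a pair to \<open>R\<close> is conditioning on one extra edge, which is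
  how negative association enters; it speaks of increasing functions only, so limits are taken for
  those first. Three finite sets are involved and their order matters: the set on which the tree is
  sampled grows first, then the window that is resampled, and the set \<open>W\<close> kept unwired
  inside the blocks last. For fixed \<open>W\<close> the blockwise average sees finitely many edges
  and connections, so the partition of the window can be replaced by that of the infinite forest.
  Degrees enter through inequalities. Among the edges touching a box, the wired spanning forest has
  at most one expected edge per vertex of the next box, the resampled forest at least one per vertex
  of the box. By domination all differences have the same sign, so the translates of one edge bound
  its difference by boundary over volume.\<close>

definition con :: "('e \<Rightarrow> 'v set) \<Rightarrow> 'v rel \<Rightarrow> 'e set \<Rightarrow> 'v rel" where
  "con en R T = (R \<union> R\<inverse> \<union> (\<Union>e\<in>T. en e \<times> en e))\<^sup>*"

text \<open>Every edge of \<open>E\<close> is spanned and every edge of \<open>T\<close> is a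
  bridge: these are the bases of the graphic matroid of \<open>E\<close> contracted by
  \<open>R\<close>. Only ends of edges have to be connected, so one notion covers spanning trees and
  maximal spanning forests.\<close>

definition bases :: "('e \<Rightarrow> 'v set) \<Rightarrow> 'v rel \<Rightarrow> 'e set \<Rightarrow> 'e set set" where
  "bases en R E = {T. T \<subseteq> E \<and> (\<forall>e\<in>E. en e \<times> en e \<subseteq> con en R T) \<and>
     (\<forall>f\<in>T. \<not> en f \<times> en f \<subseteq> con en R (T - {f}))}"

definition two_ended :: "('e \<Rightarrow> 'v set) \<Rightarrow> 'e set \<Rightarrow> bool" where
  "two_ended en E \<longleftrightarrow> (\<forall>e\<in>E. \<exists>u v. en e = {u, v})"

lemma two_ended_subset: "two_ended en E \<Longrightarrow> F \<subseteq> E \<Longrightarrow> two_ended en F"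
  by (auto simp: two_ended_def)

section \<open>Connectivity as a generated equivalence relation\<close>

lemma con_refl [simp, intro]: "(u, u) \<in> con en R T"
  by (simp add: con_def)

lemma con_sym: "(u, v) \<in> con en R T \<Longrightarrow> (v, u) \<in> con en R T"
proof -
  have "sym (con en R T)"
    unfolding con_def by (rule sym_rtrancl) (auto simp: sym_def)
  then show "(u, v) \<in> con en R T \<Longrightarrow> (v, u) \<in> con en R T"
    by (auto dest: symD)
qed

lemma con_trans: "(u, v) \<in> con en R T \<Longrightarrow> (v, w) \<in> con en R T \<Longrightarrow> (u, w) \<in> con en R T"
  unfolding con_def by (rule rtrancl_trans)

lemma con_rel: "(u, v) \<in> R \<Longrightarrow> (u, v) \<in> con en R T"
  unfolding con_def by (rule r_into_rtrancl) auto

lemma con_edge: "e \<in> T \<Longrightarrow> u \<in> en e \<Longrightarrow> v \<in> en e \<Longrightarrow> (u, v) \<in> con en R T"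
  unfolding con_def by (rule r_into_rtrancl) auto

lemma con_rels: "R \<subseteq> con en R T"
  using con_rel by fastforce

lemma con_edges: "e \<in> T \<Longrightarrow> en e \<times> en e \<subseteq> con en R T"
  using con_edge by fastforce

text \<open>Replaces induction along paths: a property to be carried along a connection is put into
  \<open>h\<close> and checked on the generators only. With \<open>h z\<close> stating that
  \<open>z\<close> is reachable in another relation, it yields inclusions between
  connectivities.\<close>

lemma con_invariant:
  assumes "(u, v) \<in> con en R T"
    and "\<And>x y. (x, y) \<in> R \<Longrightarrow> h x = h y"
    and "\<And>e x y. e \<in> T \<Longrightarrow> x \<in> en e \<Longrightarrow> y \<in> en e \<Longrightarrow> h x = h y"
  shows "h u = h v"
  using assms(1) unfolding con_def
proof (induction rule: rtrancl_induct)
  case (step y z)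
  from step.hyps(2) consider "(y, z) \<in> R" | "(z, y) \<in> R"
    | e where "e \<in> T" "y \<in> en e" "z \<in> en e" by blast
  then have "h y = h z"
    using assms(2)[of y z] assms(2)[of z y] assms(3)[of _ y z] by cases simp_all
  then show ?case
    using step.IH by simp
qed simp

lemma con_subsetI:
  assumes "R' \<subseteq> con en R T" and "\<And>e. e \<in> E \<Longrightarrow> en e \<times> en e \<subseteq> con en R T"
  shows "con en R' E \<subseteq> con en R T"
proof clarify
  fix u v assume "(u, v) \<in> con en R' E"
  then have "((u, u) \<in> con en R T) = ((u, v) \<in> con en R T)"
  proof (rule con_invariant[where h = "\<lambda>z. (u, z) \<in> con en R T"])
    fix x y assume "(x, y) \<in> R'"
    then have "(x, y) \<in> con en R T" using assms(1) by auto
    then show "((u, x) \<in> con en R T) = ((u, y) \<in> con en R T)"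
      using con_trans con_sym by metis
  next
    fix e x y assume "e \<in> E" "x \<in> en e" "y \<in> en e"
    then have "(x, y) \<in> con en R T" using assms(2)[of e] by auto
    then show "((u, x) \<in> con en R T) = ((u, y) \<in> con en R T)"
      using con_trans con_sym by metis
  qed
  then show "(u, v) \<in> con en R T" by simp
qed

lemma con_mono: "R \<subseteq> R' \<Longrightarrow> T \<subseteq> T' \<Longrightarrow> con en R T \<subseteq> con en R' T'"
  by (rule con_subsetI) (use con_rels[of R' en T'] con_edges[of _ T' en R'] in blast)+

lemma con_insert:
  assumes e: "en e = {a, b}"
  shows "(u, v) \<in> con en R (insert e T) \<longleftrightarrow>
    (u, v) \<in> con en R T \<or> ((u, a) \<in> con en R T \<and> (b, v) \<in> con en R T)
      \<or> ((u, b) \<in> con en R T \<and> (a, v) \<in> con en R T)" (is "?L \<longleftrightarrow> ?P v")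
proof
  assume ?L
  then have "?P u = ?P v"
  proof (rule con_invariant[where h = ?P])
    have *: "?P x = ?P y" if "(x, y) \<in> con en R T" for x y
      using that con_trans[where en = en and R = R and T = T]
        con_sym[where en = en and R = R and T = T] by meson
    show "?P x = ?P y" if "(x, y) \<in> R" for x y
      using * con_rel[OF that, of en T] by blast
    show "?P x = ?P y" if f: "f \<in> insert e T" "x \<in> en f" "y \<in> en f" for f x y
    proof (cases "f \<in> T")
      case True
      then show ?thesis using * con_edge[of f T x en y R] f by blast
    next
      case False
      then have "x \<in> {a, b}" "y \<in> {a, b}" using f e by auto
      moreover have "?P a = ?P b"
        using con_trans[where en = en and R = R and T = T]
          con_sym[where en = en and R = R and T = T] con_refl[of _ en R T] by meson
      ultimately show ?thesis by blast
    qed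
  qed
  then show "?P v" by simp
next
  assume P: "?P v"
  have m: "con en R T \<subseteq> con en R (insert e T)" by (rule con_mono) auto
  have ab: "(a, b) \<in> con en R (insert e T)" "(b, a) \<in> con en R (insert e T)"
    using e con_edge[of e "insert e T" _ en _ R] by auto
  show ?L
    using P m ab con_trans[where en = en and R = R and T = "insert e T"] by blast
qed

lemma ends_con_iff:
  "en e = {a, b} \<Longrightarrow> en e \<times> en e \<subseteq> con en R T \<longleftrightarrow> (a, b) \<in> con en R T"
  using con_sym[of a b en R T] by auto

section \<open>Bases: existence, dependence on the relation, loops\<close>

lemma bases_con_eq: "T \<in> bases en R E \<Longrightarrow> con en R T = con en R E"
  using con_rels[of R en T] by (intro equalityI con_mono con_subsetI) (auto simp: bases_def)

lemma bases_subset: "T \<in> bases en R E \<Longrightarrow> T \<subseteq> E"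
  by (auto simp: bases_def)

lemma bases_Pow: "bases en R E \<subseteq> Pow E"
  by (auto simp: bases_def)

lemma finite_bases [simp]: "finite E \<Longrightarrow> finite (bases en R E)"
  by (rule finite_subset[OF bases_Pow]) simp

lemma bases_finite_elem: "finite E \<Longrightarrow> T \<in> bases en R E \<Longrightarrow> finite T"
  by (meson bases_subset finite_subset)

text \<open>Redundant edges are discarded one at a time; removing an edge whose ends stay connected
  does not change what is spanned.\<close>

lemma bases_exists_subset:
  assumes "finite S" "S \<subseteq> E" "\<And>e. e \<in> E \<Longrightarrow> en e \<times> en e \<subseteq> con en R S"
  shows "\<exists>T\<in>bases en R E. T \<subseteq> S"
  using assms
proof (induction S rule: finite_psubset_induct)
  case (psubset S)
  show ?case
  proof (cases "\<forall>f\<in>S. \<not> en f \<times> en f \<subseteq> con en R (S - {f})")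
    case True
    then have "S \<in> bases en R E" using psubset.prems unfolding bases_def by blast
    then show ?thesis by blast
  next
    case False
    then obtain f where f: "f \<in> S" "en f \<times> en f \<subseteq> con en R (S - {f})" by auto
    have "con en R S \<subseteq> con en R (S - {f})"
    proof (rule con_subsetI[OF con_rels])
      show "en e \<times> en e \<subseteq> con en R (S - {f})" if "e \<in> S" for e
        using f that con_edges[of e "S - {f}" en R] by (cases "e = f") auto
    qed
    then have "\<exists>T\<in>bases en R E. T \<subseteq> S - {f}"
      using psubset.prems f by (intro psubset.IH) blast+
    then show ?thesis by blast
  qed
qed

lemma bases_nonempty: "finite E \<Longrightarrow> bases en R E \<noteq> {}"
  using bases_exists_subset[of E E en R] con_edges[of _ E en R] by blast

lemma bases_cong_con:
  assumes "\<And>T e. T \<subseteq> E \<Longrightarrow> e \<in> E \<Longrightarrow> en e \<times> en e \<subseteq> con en R T \<longleftrightarrow> en e \<times> en e \<subseteq> con en R' T"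
  shows "bases en R E = bases en R' E"
  unfolding bases_def
proof (rule Collect_cong, rule conj_cong[OF refl])
  fix T assume T: "T \<subseteq> E"
  show "((\<forall>e\<in>E. en e \<times> en e \<subseteq> con en R T) \<and> (\<forall>f\<in>T. \<not> en f \<times> en f \<subseteq> con en R (T - {f}))) =
    ((\<forall>e\<in>E. en e \<times> en e \<subseteq> con en R' T) \<and> (\<forall>f\<in>T. \<not> en f \<times> en f \<subseteq> con en R' (T - {f})))"
  proof (intro conj_cong ball_cong refl)
    show "en e \<times> en e \<subseteq> con en R T \<longleftrightarrow> en e \<times> en e \<subseteq> con en R' T" if "e \<in> E" for e
      by (rule assms) (use T that in auto)
    show "(\<not> en f \<times> en f \<subseteq> con en R (T - {f})) = (\<not> en f \<times> en f \<subseteq> con en R' (T - {f}))"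
      if "f \<in> T" for f
      by (subst assms) (use T that in auto)
  qed
qed

text \<open>Every edge of \<open>T\<close> lies in \<open>X\<close>, so a path can leave
  \<open>X\<close> only along identifications. Each excursion is a single pair of the equivalence
  generated by \<open>R\<close>, hence only the trace of this equivalence on \<open>X\<close>
  matters.\<close>

lemma con_restrict:
  assumes X: "\<And>e. e \<in> T \<Longrightarrow> en e \<subseteq> X" and u: "u \<in> X" and v: "v \<in> X"
  shows "(u, v) \<in> con en R T \<longleftrightarrow> (u, v) \<in> con en (con en R {} \<inter> X \<times> X) T"
proof
  let ?R' = "con en R {} \<inter> X \<times> X"
  assume "(u, v) \<in> con en R T"
  \<comment> \<open>\<open>h x\<close> says that \<open>x\<close> is identified with a vertex of
    \<open>X\<close> already reached; this also makes sense for the vertices outside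
    \<open>X\<close> that a path visits.\<close>
  define h where "h x = (\<exists>y\<in>X. (x, y) \<in> con en R {} \<and> (u, y) \<in> con en ?R' T)" for x
  have "h u = h v" using \<open>(u, v) \<in> con en R T\<close>
  proof (rule con_invariant)
    have *: "(x, z) \<in> con en R {} \<longleftrightarrow> (y, z) \<in> con en R {}" if "(x, y) \<in> R" for x y z
      using con_trans con_sym con_rel[OF that, of en "{}"] by meson
    show "h x = h y" if "(x, y) \<in> R" for x y
      using *[OF that] unfolding h_def by blast
    have **: "h y" if e: "e \<in> T" "x \<in> en e" "y \<in> en e" and "h x" for e x y
    proof -
      obtain z where z: "z \<in> X" "(x, z) \<in> con en R {}" "(u, z) \<in> con en ?R' T"
        using \<open>h x\<close> unfolding h_def by blast
      have xy: "x \<in> X" "y \<in> X" using X[OF e(1)] e by auto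
      have "(z, x) \<in> ?R'" using z xy con_sym by fast
      then have "(u, x) \<in> con en ?R' T" using z(3) con_rel con_trans by metis
      then have "(u, y) \<in> con en ?R' T" using con_edge[of e T x en y] con_trans e by metis
      then show ?thesis unfolding h_def using xy by blast
    qed
    show "h x = h y" if "e \<in> T" "x \<in> en e" "y \<in> en e" for e x y
      using ** that by blast
  qed
  then have "h v" using u unfolding h_def by blast
  then obtain y where y: "y \<in> X" "(v, y) \<in> con en R {}" "(u, y) \<in> con en ?R' T"
    unfolding h_def by blast
  have "(y, v) \<in> ?R'" using y v con_sym by fast
  then show "(u, v) \<in> con en ?R' T" using y(3) con_rel con_trans by metis
next
  have "con en (con en R {} \<inter> X \<times> X) T \<subseteq> con en R T"
    by (rule con_subsetI) (use con_mono[of R R "{}" T en] con_edges[of _ T en R] in blast)+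
  then show "(u, v) \<in> con en (con en R {} \<inter> X \<times> X) T \<Longrightarrow> (u, v) \<in> con en R T" by auto
qed

text \<open>Allows \<open>R\<close> to be exchanged for any relation with the same trace on the
  endpoints. This is how infinite wirings become finite relations and how wirings of different
  ambient vertex sets are compared.\<close>

lemma bases_restrict:
  assumes X: "\<And>e. e \<in> E \<Longrightarrow> en e \<subseteq> X"
    and eq: "con en R {} \<inter> X \<times> X = con en R' {} \<inter> X \<times> X"
  shows "bases en R E = bases en R' E"
proof (rule bases_cong_con)
  fix T e assume T: "T \<subseteq> E" "e \<in> E"
  have *: "(u, v) \<in> con en R T \<longleftrightarrow> (u, v) \<in> con en R' T" if "u \<in> X" "v \<in> X" for u v
    using con_restrict[of T en X u v R] con_restrict[of T en X u v R'] that X T eq by auto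
  show "en e \<times> en e \<subseteq> con en R T \<longleftrightarrow> en e \<times> en e \<subseteq> con en R' T"
    using X[OF T(2)] * by blast
qed

lemma bases_cong_rel: "con en R {} = con en R' {} \<Longrightarrow> bases en R E = bases en R' E"
  by (rule bases_restrict[where X = UNIV]) auto

text \<open>An edge whose ends are already identified is a loop: spanned by anything and contained
  in no basis. Two graphs with different wired exteriors are brought to a common edge set in this
  way.\<close>

lemma bases_remove_loops:
  assumes "F \<subseteq> E" "\<And>e. e \<in> E - F \<Longrightarrow> en e \<times> en e \<subseteq> con en R {}"
  shows "bases en R E = bases en R F"
proof -
  have loop: "en e \<times> en e \<subseteq> con en R T" if "e \<in> E - F" for e T
    using assms(2)[OF that] con_mono[of R R "{}" T en] by blast
  show ?thesis
    using assms(1) loop unfolding bases_def by blast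
qed

lemma spanning_card_imp_bases:
  assumes "finite S" "S \<subseteq> E" "\<And>e. e \<in> E \<Longrightarrow> en e \<times> en e \<subseteq> con en R S"
    and "\<And>T. T \<in> bases en R E \<Longrightarrow> card T = card S"
  shows "S \<in> bases en R E"
proof -
  obtain T where "T \<in> bases en R E" "T \<subseteq> S"
    using bases_exists_subset[OF assms(1-3)] by blast
  then show ?thesis using card_subset_eq[of S T] assms by simp
qed

section \<open>Projections along cycles and negative correlation\<close>

lemma sum_product_swap:
  fixes a b :: "_ \<Rightarrow> _ \<Rightarrow> 'a::semiring_0"
  shows "(\<Sum>g\<in>A. (\<Sum>i\<in>I. a i g) * (\<Sum>j\<in>J. b j g)) = (\<Sum>i\<in>I. \<Sum>j\<in>J. \<Sum>g\<in>A. a i g * b j g)"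
proof -
  have "(\<Sum>g\<in>A. (\<Sum>i\<in>I. a i g) * (\<Sum>j\<in>J. b j g)) = (\<Sum>i\<in>I. \<Sum>g\<in>A. \<Sum>j\<in>J. a i g * b j g)"
    unfolding sum_product by (rule sum.swap)
  also have "\<dots> = (\<Sum>i\<in>I. \<Sum>j\<in>J. \<Sum>g\<in>A. a i g * b j g)"
    by (rule sum.cong[OF refl], rule sum.swap)
  finally show ?thesis .
qed

section \<open>Coefficients along fundamental cycles and basis exchange\<close>

locale oriented_graph =
  fixes en :: "'e \<Rightarrow> 'v set" and s t :: "'e \<Rightarrow> 'v" and R :: "'v rel" and E :: "'e set"
  assumes finite_E: "finite E" and ends: "e \<in> E \<Longrightarrow> en e = {s e, t e}"
begin

definition cut :: "'e set \<Rightarrow> 'e \<Rightarrow> 'v \<Rightarrow> real" where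
  "cut T f v = (if (t f, v) \<in> con en R (T - {f}) then 1 else 0)"

text \<open>The coefficient of \<open>f\<close> in the expansion of \<open>e\<close> over the basis \<open>T\<close>, modulo cycles.\<close>

definition coef :: "'e set \<Rightarrow> 'e \<Rightarrow> 'e \<Rightarrow> real" where
  "coef T e f = (if f \<in> T then cut T f (t e) - cut T f (s e) else 0)"

lemma span_iff: "e \<in> E \<Longrightarrow> en e \<times> en e \<subseteq> con en R T \<longleftrightarrow> (s e, t e) \<in> con en R T"
  using ends_con_iff[of en e "s e" "t e" R T] ends[of e] by simp

lemma con_insert_edge:
  "e \<in> E \<Longrightarrow> (u, v) \<in> con en R (insert e T) \<longleftrightarrow>
    (u, v) \<in> con en R T \<or> ((u, s e) \<in> con en R T \<and> (t e, v) \<in> con en R T)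
      \<or> ((u, t e) \<in> con en R T \<and> (s e, v) \<in> con en R T)"
  using con_insert[of en e "s e" "t e" u v R T] ends[of e] by simp

lemma basis_bridge:
  assumes "T \<in> bases en R E" "f \<in> T"
  shows "(s f, t f) \<notin> con en R (T - {f})"
  using assms span_iff[of f "T - {f}"] unfolding bases_def by blast

lemma basis_spans:
  assumes "T \<in> bases en R E" "e \<in> E"
  shows "(s e, t e) \<in> con en R T"
  using assms span_iff[of e T] unfolding bases_def by blast

lemma cut_cong: "(u, v) \<in> con en R (T - {f}) \<Longrightarrow> cut T f u = cut T f v"
  unfolding cut_def using con_trans con_sym by metis

lemma coef_self:
  assumes "T \<in> bases en R E" "f \<in> T"
  shows "coef T f f = 1"
  using basis_bridge[OF assms] con_sym[of "t f" "s f" en R "T - {f}"] assms(2)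
  by (auto simp: coef_def cut_def)

lemma coef_other:
  assumes "T \<in> bases en R E" "e \<in> T" "e \<noteq> f"
  shows "coef T e f = 0"
proof -
  have "e \<in> E" using assms bases_subset by blast
  then have "(s e, t e) \<in> con en R (T - {f})"
    using con_edge[of e "T - {f}" "s e" en "t e" R] ends assms by auto
  then show ?thesis using cut_cong unfolding coef_def by simp
qed

lemma coef_not_mem: "f \<notin> T \<Longrightarrow> coef T e f = 0"
  by (simp add: coef_def)

text \<open>Subtracting from \<phi> its jumps across the fundamental cuts of \<open>T\<close> leaves
  a function that is constant along each edge of \<open>T\<close>. It is then constant on the
  classes spanned by \<open>T\<close>, and both ends of \<open>e\<close> lie in one of them.\<close>

lemma coef_expansion:
  assumes T: "T \<in> bases en R E" and e: "e \<in> E"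
    and \<phi>: "\<And>x y. (x, y) \<in> R \<Longrightarrow> \<phi> x = \<phi> y"
  shows "\<phi> (t e) - \<phi> (s e) = (\<Sum>f\<in>T. coef T e f * (\<phi> (t f) - \<phi> (s f)))"
proof -
  have fin: "finite T" using bases_finite_elem[OF finite_E T] .
  define \<psi> where "\<psi> v = \<phi> v - (\<Sum>f\<in>T. cut T f v * (\<phi> (t f) - \<phi> (s f)))" for v
  have "\<psi> (s e) = \<psi> (t e)" using basis_spans[OF T e]
  proof (rule con_invariant)
    fix x y assume xy: "(x, y) \<in> R"
    then have "cut T f x = cut T f y" for f by (intro cut_cong con_rel)
    then show "\<psi> x = \<psi> y" unfolding \<psi>_def using \<phi>[OF xy] by simp
  next
    have *: "\<psi> (t g) = \<psi> (s g)" if g: "g \<in> T" for g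
    proof -
      have "\<psi> (t g) - \<psi> (s g) = \<phi> (t g) - \<phi> (s g) - (\<Sum>f\<in>T. coef T g f * (\<phi> (t f) - \<phi> (s f)))"
        unfolding \<psi>_def coef_def by (simp add: left_diff_distrib sum_subtractf)
      also have "(\<Sum>f\<in>T. coef T g f * (\<phi> (t f) - \<phi> (s f))) = (\<Sum>f\<in>{g}. coef T g f * (\<phi> (t f) - \<phi> (s f)))"
        using fin g coef_other[OF T g] by (intro sum.mono_neutral_right) auto
      finally show ?thesis using coef_self[OF T g] by simp
    qed
    fix g x y assume g: "g \<in> T" "x \<in> en g" "y \<in> en g"
    then have "en g = {s g, t g}" using ends bases_subset[OF T] by blast
    then show "\<psi> x = \<psi> y" using *[OF g(1)] g by auto
  qed
  then have "\<phi> (t e) - \<phi> (s e) = (\<Sum>f\<in>T. (cut T f (t e) - cut T f (s e)) * (\<phi> (t f) - \<phi> (s f)))"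
    unfolding \<psi>_def by (simp add: left_diff_distrib sum_subtractf)
  then show ?thesis by (simp add: coef_def)
qed

text \<open>The cut of \<open>g\<close> in \<open>T'\<close> is itself a potential that respects
  \<open>R\<close>, and its increment along an edge is the coefficient of \<open>g\<close>;
  expanding this potential over \<open>T\<close> gives the composition rule.\<close>

lemma coef_comp:
  assumes T: "T \<in> bases en R E" and e: "e \<in> E"
  shows "(\<Sum>f\<in>T. coef T e f * coef T' f g) = coef T' e g"
proof (cases "g \<in> T'")
  case True
  have "cut T' g x = cut T' g y" if "(x, y) \<in> R" for x y
    using that by (intro cut_cong con_rel)
  from coef_expansion[OF T e, of "cut T' g", OF this] show ?thesis
    using True by (simp add: coef_def)
qed (simp add: coef_def)

lemma coef_comp':
  assumes "T \<in> bases en R E" "e \<in> E"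
  shows "(\<Sum>f\<in>E. coef T e f * coef T' f g) = coef T' e g"
proof -
  have "(\<Sum>f\<in>E. coef T e f * coef T' f g) = (\<Sum>f\<in>T. coef T e f * coef T' f g)"
    using bases_subset[OF assms(1)] finite_E by (intro sum.mono_neutral_right) (auto simp: coef_def)
  then show ?thesis using coef_comp[OF assms] by simp
qed

lemma sum_coef_diag: "T \<in> bases en R E \<Longrightarrow> (\<Sum>e\<in>E. coef T e e) = card T"
proof -
  assume T: "T \<in> bases en R E"
  have "(\<Sum>e\<in>E. coef T e e) = (\<Sum>e\<in>T. coef T e e)"
    using bases_subset[OF T] finite_E by (intro sum.mono_neutral_right) (auto simp: coef_def)
  then show ?thesis using coef_self[OF T] by simp
qed

text \<open>Both sides are the trace of a product of two projections with the same kernel.\<close>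

lemma bases_card_eq:
  assumes T: "T \<in> bases en R E" and T': "T' \<in> bases en R E"
  shows "card T = card T'"
proof -
  have "real (card T') = (\<Sum>e\<in>E. \<Sum>f\<in>E. coef T e f * coef T' f e)"
    using coef_comp'[OF T] sum_coef_diag[OF T'] by simp
  also have "\<dots> = (\<Sum>f\<in>E. \<Sum>e\<in>E. coef T' f e * coef T e f)"
    by (subst sum.swap) (simp add: mult.commute)
  also have "\<dots> = card T"
    using coef_comp'[OF T'] sum_coef_diag[OF T] by simp
  finally show ?thesis by simp
qed

text \<open>A nonzero coefficient means that \<open>f\<close> lies on the path of \<open>T\<close>
  between the ends of \<open>e\<close>, so the two edges can be exchanged. Being 1 or -1, the
  coefficient is its own inverse, which is why solving the expansion for \<open>f\<close> returns
  the same number.\<close>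

lemma coef_swap:
  assumes T: "T \<in> bases en R E" and e: "e \<in> E" and nz: "coef T e f \<noteq> 0" and ef: "e \<noteq> f"
  shows "insert e (T - {f}) \<in> bases en R E" "f \<in> T" "e \<notin> T"
    "coef (insert e (T - {f})) f e = coef T e f"
proof -
  show f: "f \<in> T" using nz by (auto simp: coef_def split: if_splits)
  show eT: "e \<notin> T" using coef_other[OF T] nz ef by blast
  have fE: "f \<in> E" using f bases_subset[OF T] by blast
  define T0 where "T0 = T - {f}"
  note tr = con_trans[where en = en and R = R and T = T0] and sy = con_sym[where en = en and R = R and T = T0]
  have T_eq: "T = insert f T0" using f by (auto simp: T0_def)
  have f_br: "(s f, t f) \<notin> con en R T0" using basis_bridge[OF T f] by (simp add: T0_def)
  \<comment> \<open>After removal of \<open>f\<close>, exactly one end of \<open>e\<close> is on the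
    side of \<open>t f\<close>.\<close>
  have nz': "((t f, t e) \<in> con en R T0) \<noteq> ((t f, s e) \<in> con en R T0)"
    using nz f by (auto simp: coef_def cut_def T0_def split: if_splits)
  have e_br: "(s e, t e) \<notin> con en R T0" using nz' tr sy by blast
  have "(s e, t e) \<in> con en R (insert f T0)" using basis_spans[OF T e] T_eq by simp
  then have cases: "((s e, s f) \<in> con en R T0 \<and> (t f, t e) \<in> con en R T0)
      \<or> ((s e, t f) \<in> con en R T0 \<and> (s f, t e) \<in> con en R T0)"
    using e_br con_insert_edge[OF fE] by blast
  let ?T' = "insert e T0"
  have T0E: "T0 \<subseteq> E" using bases_subset[OF T] by (auto simp: T0_def)
  have e_notin: "e \<notin> T0" using eT by (simp add: T0_def)
  have f_span: "(s f, t f) \<in> con en R ?T'"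
    using cases con_insert_edge[OF e] sy by blast
  have "con en R T \<subseteq> con en R ?T'"
  proof (rule con_subsetI[OF con_rels])
    show "en g \<times> en g \<subseteq> con en R ?T'" if "g \<in> T" for g
    proof (cases "g = f")
      case True
      then show ?thesis using f_span span_iff[OF fE, of ?T'] by simp
    next
      case False
      then have "g \<in> ?T'" using that by (simp add: T0_def)
      then show ?thesis by (rule con_edges)
    qed
  qed
  then have span: "\<forall>g\<in>E. en g \<times> en g \<subseteq> con en R ?T'"
    using T unfolding bases_def by blast
  have indep: "(s g, t g) \<notin> con en R (?T' - {g})" if g: "g \<in> ?T'" for g
  proof (cases "g = e")
    case True
    then show ?thesis using e_br e_notin by simp
  next
    case False
    then have g0: "g \<in> T0" using g by simp
    have gE: "g \<in> E" using g0 T0E by blast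
    let ?T1 = "T0 - {g}"
    have "(s g, t g) \<notin> con en R (T - {g})"
      using basis_bridge[OF T] g0 by (simp add: T0_def)
    moreover have "con en R ?T1 \<subseteq> con en R (T - {g})" by (rule con_mono) (auto simp: T0_def)
    ultimately have g_br: "(s g, t g) \<notin> con en R ?T1" by blast
    have sg: "(s g, t g) \<in> con en R T0"
      using con_edge[OF g0, of "s g" en "t g" R] ends[OF gE] by simp
    have m: "con en R ?T1 \<subseteq> con en R T0" by (rule con_mono) auto
    have eq: "?T' - {g} = insert e ?T1" using False by auto
    show ?thesis
    proof
      assume "(s g, t g) \<in> con en R (?T' - {g})"
      then have "((s g, s e) \<in> con en R T0 \<and> (t e, t g) \<in> con en R T0)
         \<or> ((s g, t e) \<in> con en R T0 \<and> (s e, t g) \<in> con en R T0)"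
        unfolding eq con_insert_edge[OF e] using g_br m by blast
      then show False using e_br sg tr sy by blast
    qed
  qed
  have "\<not> en g \<times> en g \<subseteq> con en R (?T' - {g})" if g: "g \<in> ?T'" for g
    using indep[OF g] span_iff[of g "?T' - {g}"] g e T0E by blast
  then have "?T' \<in> bases en R E"
    using span e T0E unfolding bases_def by blast
  then show "insert e (T - {f}) \<in> bases en R E" by (simp add: T0_def)
  have T'e: "?T' - {e} = T0" using e_notin by auto
  have c1: "coef ?T' f e = (if (t e, t f) \<in> con en R T0 then 1 else 0) - (if (t e, s f) \<in> con en R T0 then 1 else 0)"
    unfolding coef_def cut_def T'e by simp
  have c2: "coef T e f = (if (t f, t e) \<in> con en R T0 then 1 else 0) - (if (t f, s e) \<in> con en R T0 then 1 else 0)"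
    using f unfolding coef_def cut_def T0_def by simp
  have tf_te: "(t f, t e) \<in> con en R T0 \<longleftrightarrow> (t e, t f) \<in> con en R T0" using sy by blast
  \<comment> \<open>\<open>e\<close> reconnects the two sides in one of two orientations, and the
    orientation decides both memberships at once.\<close>
  have "(t e, s f) \<in> con en R T0 \<longleftrightarrow> (t f, s e) \<in> con en R T0"
    using cases f_br e_br tr sy by meson
  then have "coef ?T' f e = coef T e f"
    unfolding c1 c2 tf_te by presburger
  then show "coef (insert e (T - {f})) f e = coef T e f" by (simp add: T0_def)
qed

end

section \<open>The averaged projection and negative correlation in all minors\<close>

definition minor_family :: "'e set set \<Rightarrow> 'e set \<Rightarrow> 'e set \<Rightarrow> 'e set set" where
  "minor_family B I Z = {T \<in> B. I \<subseteq> T \<and> T \<inter> Z = {}}"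

context oriented_graph
begin

abbreviation "Bs I Z \<equiv> minor_family (bases en R E) I Z"

lemma Bs_basis: "T \<in> Bs I Z \<Longrightarrow> T \<in> bases en R E"
  by (simp add: minor_family_def)

lemma finite_Bs: "finite (Bs I Z)"
  using finite_bases[OF finite_E, of en R] by (simp add: minor_family_def)

text \<open>Exchanging \<open>f\<close> for \<open>e\<close> is a bijection between the bases that
  contribute to the two sides, and it stays in the minor because \<open>e\<close> and
  \<open>f\<close> are free. So the sum of the oblique projections is symmetric: up to a factor it
  is the orthogonal projection, Kirchhoff's transfer current matrix.\<close>

lemma sum_coef_sym:
  assumes e: "e \<in> E - I - Z" and f: "f \<in> E - I - Z"
  shows "(\<Sum>T\<in>Bs I Z. coef T e f) = (\<Sum>T\<in>Bs I Z. coef T f e)"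
proof (cases "e = f")
  case False
  have *: "insert e (T - {f}) \<in> {T \<in> Bs I Z. coef T f e \<noteq> 0} \<and>
      insert f (insert e (T - {f}) - {e}) = T \<and> coef (insert e (T - {f})) f e = coef T e f"
    if T: "T \<in> {T \<in> Bs I Z. coef T e f \<noteq> 0}" and e: "e \<in> E - I - Z" and f: "f \<in> E - I - Z"
      and "e \<noteq> f" for T e f
  proof -
    have B: "T \<in> bases en R E" and nz: "coef T e f \<noteq> 0" and IZ: "I \<subseteq> T" "T \<inter> Z = {}"
      using T by (auto simp: minor_family_def)
    have eE: "e \<in> E" using e by blast
    note sw = coef_swap[OF B eE nz \<open>e \<noteq> f\<close>]
    show ?thesis using sw IZ e f nz \<open>e \<noteq> f\<close> by (auto simp: minor_family_def)
  qed
  have "(\<Sum>T\<in>Bs I Z. coef T e f) = (\<Sum>T\<in>{T \<in> Bs I Z. coef T e f \<noteq> 0}. coef T e f)"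
    using finite_Bs by (intro sum.mono_neutral_right) auto
  also have "\<dots> = (\<Sum>T\<in>{T \<in> Bs I Z. coef T f e \<noteq> 0}. coef T f e)"
    by (rule sum.reindex_bij_witness[where i = "\<lambda>T. insert f (T - {e})" and j = "\<lambda>T. insert e (T - {f})"])
      (use *[OF _ e f False] *[OF _ f e False[symmetric]] in auto)
  also have "\<dots> = (\<Sum>T\<in>Bs I Z. coef T f e)"
    using finite_Bs by (intro sum.mono_neutral_left) auto
  finally show ?thesis .
qed simp

text \<open>Inside a minor the composition rule may be summed over free edges only: an edge of
  \<open>I\<close> is a basis edge other than \<open>g\<close> and has coefficient 0 at
  \<open>g\<close>, and edges of \<open>Z0\<close> do not occur in \<open>T\<close>.\<close>

lemma coef_comp_minor:
  assumes T: "T \<in> Bs I Z" and T': "T' \<in> Bs I Z'" and e: "e \<in> E" and g: "g \<in> E - I - Z"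
    and "Z0 \<subseteq> Z"
  shows "(\<Sum>f\<in>E - I - Z0. coef T e f * coef T' f g) = coef T' e g"
proof -
  have "(\<Sum>f\<in>E - I - Z0. coef T e f * coef T' f g) = (\<Sum>f\<in>E. coef T e f * coef T' f g)"
  proof (rule sum.mono_neutral_left[OF finite_E], blast, rule ballI)
    fix f assume "f \<in> E - (E - I - Z0)"
    then consider "f \<in> I" | "f \<in> Z0" by blast
    then show "coef T e f * coef T' f g = 0"
    proof cases
      case 1
      then have "coef T' f g = 0"
        using T' g by (intro coef_other) (auto simp: minor_family_def)
      then show ?thesis by simp
    next
      case 2
      then have "f \<notin> T" using T \<open>Z0 \<subseteq> Z\<close> by (auto simp: minor_family_def)
      then show ?thesis by (simp add: coef_not_mem)
    qed
  qed
  also have "\<dots> = coef T' e g" by (rule coef_comp'[OF Bs_basis[OF T] e])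
  finally show ?thesis .
qed

lemma coef_diag: "T \<in> bases en R E \<Longrightarrow> coef T e e = (if e \<in> T then 1 else 0)"
  by (simp add: coef_self coef_not_mem)

text \<open>Deleting \<open>f\<close> increases the energy of the unit flow through \<open>e\<close>, and that energy is the
  probability of \<open>e\<close> (Rayleigh monotonicity).\<close>

lemma neg_corr_aux:
  assumes e: "e \<in> E - I - Z" and f: "f \<in> E - I - Z" and "e \<noteq> f"
  shows "card (Bs (insert e I) Z) * card (Bs I (insert f Z))
    \<le> card (Bs (insert e I) (insert f Z)) * card (Bs I Z)"
proof -
  let ?E = "E - I - Z" and ?B = "Bs I Z" and ?B' = "Bs I (insert f Z)"
  \<comment> \<open>Up to the factor \<open>card ?B\<close>, \<open>q\<close> is the current flow of
    a unit current sent between the ends of \<open>e\<close>, and \<open>q'\<close> plays this role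
    after deletion of \<open>f\<close>. By symmetry and composition the squared norm of
    \<open>q\<close> is \<open>card ?B * q e\<close>, so energy and probability of \<open>e\<close>
    coincide after normalisation.\<close>
  define q q' where "q g = (\<Sum>T\<in>?B. coef T e g)" and "q' g = (\<Sum>T\<in>?B'. coef T e g)" for g
  have eE: "e \<in> E" using e by blast
  have BB: "T \<in> ?B' \<Longrightarrow> T \<in> ?B" for T by (auto simp: minor_family_def)
  have q_sym: "(\<Sum>T\<in>?B. coef T g e) = q g" if "g \<in> ?E" for g
    unfolding q_def using sum_coef_sym[OF that e] by simp
  have q'_sym: "(\<Sum>T\<in>?B'. coef T g e) = q' g" if "g \<in> ?E - {f}" for g
    unfolding q'_def using sum_coef_sym[of g I "insert f Z" e] that e \<open>e \<noteq> f\<close> by auto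
  have q'_f: "q' f = 0" unfolding q'_def by (auto simp: minor_family_def intro!: sum.neutral coef_not_mem)
  have count: "(\<Sum>T\<in>Bs I' Z'. coef T e e) = card (Bs (insert e I') Z')" for I' Z'
  proof -
    have "(\<Sum>T\<in>Bs I' Z'. coef T e e) = (\<Sum>T\<in>Bs I' Z'. if e \<in> T then 1 else 0)"
      by (intro sum.cong refl) (simp add: coef_diag[OF Bs_basis])
    also have "\<dots> = card {T \<in> Bs I' Z'. e \<in> T}"
      using finite_Bs by (simp add: sum.If_cases Int_def)
    also have "{T \<in> Bs I' Z'. e \<in> T} = Bs (insert e I') Z'" by (auto simp: minor_family_def)
    finally show ?thesis .
  qed
  have qe: "q e = card (Bs (insert e I) Z)" and q'e: "q' e = card (Bs (insert e I) (insert f Z))"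
    unfolding q_def q'_def by (rule count)+
  have qq: "(\<Sum>g\<in>?E. q g * q g) = card ?B * q e"
  proof -
    have "(\<Sum>g\<in>?E. q g * q g) = (\<Sum>g\<in>?E. (\<Sum>T\<in>?B. coef T e g) * (\<Sum>T'\<in>?B. coef T' g e))"
      by (intro sum.cong refl) (simp add: q_sym, simp add: q_def)
    also have "\<dots> = (\<Sum>T\<in>?B. \<Sum>T'\<in>?B. \<Sum>g\<in>?E. coef T e g * coef T' g e)"
      by (rule sum_product_swap)
    also have "\<dots> = (\<Sum>T\<in>?B. \<Sum>T'\<in>?B. coef T' e e)"
      by (intro sum.cong refl coef_comp_minor[where Z = Z and Z' = Z]) (use e in auto)
    finally show ?thesis by (simp add: q_def)
  qed
  have q'q: "(\<Sum>g\<in>?E. q' g * q g) = card ?B' * q e"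
  proof -
    have "(\<Sum>g\<in>?E. q' g * q g) = (\<Sum>g\<in>?E. (\<Sum>T\<in>?B'. coef T e g) * (\<Sum>T'\<in>?B. coef T' g e))"
      by (intro sum.cong refl) (simp add: q_sym, simp add: q'_def)
    also have "\<dots> = (\<Sum>T\<in>?B'. \<Sum>T'\<in>?B. \<Sum>g\<in>?E. coef T e g * coef T' g e)"
      by (rule sum_product_swap)
    also have "\<dots> = (\<Sum>T\<in>?B'. \<Sum>T'\<in>?B. coef T' e e)"
      by (intro sum.cong refl coef_comp_minor[where Z = Z and Z' = Z]) (use e BB in auto)
    finally show ?thesis by (simp add: q_def)
  qed
  have q'q': "(\<Sum>g\<in>?E. q' g * q' g) = card ?B' * q' e"
  proof -
    have "(\<Sum>g\<in>?E. q' g * q' g) = (\<Sum>g\<in>?E - {f}. q' g * q' g)"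
      using finite_E q'_f by (intro sum.mono_neutral_right) auto
    also have "\<dots> = (\<Sum>g\<in>E - I - insert f Z. (\<Sum>T\<in>?B'. coef T e g) * (\<Sum>T'\<in>?B'. coef T' g e))"
      by (rule sum.cong) (auto simp: q'_sym, simp add: q'_def)
    also have "\<dots> = (\<Sum>T\<in>?B'. \<Sum>T'\<in>?B'. \<Sum>g\<in>E - I - insert f Z. coef T e g * coef T' g e)"
      by (rule sum_product_swap)
    also have "\<dots> = (\<Sum>T\<in>?B'. \<Sum>T'\<in>?B'. coef T' e e)"
      by (intro sum.cong refl coef_comp_minor[where Z = "insert f Z" and Z' = "insert f Z"])
        (use e \<open>e \<noteq> f\<close> in auto)
    finally show ?thesis by (simp add: q'_def)
  qed
  \<comment> \<open>Thomson's principle: the inner product of the two flows is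
    \<open>card ?B' * q e\<close>, so Cauchy-Schwarz compares their energies and hence the two
    probabilities of \<open>e\<close>.\<close>
  have cs: "(\<Sum>g\<in>?E. q' g * q g)\<^sup>2 \<le> (\<Sum>g\<in>?E. (q' g)\<^sup>2) * (\<Sum>g\<in>?E. (q g)\<^sup>2)"
    by (rule Cauchy_Schwarz_ineq_sum)
  define n n' where "n = real (card ?B)" and "n' = real (card ?B')"
  have ineq: "(n' * q e)\<^sup>2 \<le> (n' * q' e) * (n * q e)"
    using cs unfolding q'q using qq q'q' by (simp add: power2_eq_square n_def n'_def)
  have nn: "0 \<le> n" "0 \<le> n'" "0 \<le> q e" "0 \<le> q' e" by (auto simp: n_def n'_def qe q'e)
  have "q e * n' \<le> q' e * n"
  proof (cases "n' * q e = 0")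
    case False
    then have "0 < n' * q e" using nn by (simp add: less_le)
    moreover have "(q e * n') * (n' * q e) \<le> (q' e * n) * (n' * q e)"
      using ineq by (simp add: power2_eq_square algebra_simps)
    ultimately show ?thesis by (meson mult_le_cancel_right_pos)
  qed (use nn in \<open>auto\<close>)
  then have "real (card (Bs (insert e I) Z) * card ?B') \<le> real (card (Bs (insert e I) (insert f Z)) * card ?B)"
    by (simp add: qe q'e n_def n'_def)
  then show ?thesis by (simp only: of_nat_le_iff)
qed

text \<open>Splitting all four counts by \<open>e\<close> and \<open>f\<close> turns
  "\<open>e\<close> is at least as likely without \<open>f\<close>" into a two-by-two determinant
  inequality. This form is symmetric in the two edges and remains meaningful when a conditioning
  event is empty.\<close>

lemma neg_corr:
  assumes e: "e \<in> E - I - Z" and f: "f \<in> E - I - Z" and "e \<noteq> f"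
  shows "card (Bs (insert e (insert f I)) Z) * card (Bs I (insert e (insert f Z)))
    \<le> card (Bs (insert e I) (insert f Z)) * card (Bs (insert f I) (insert e Z))"
proof -
  have split: "card (Bs I' Z') = card (Bs (insert x I') Z') + card (Bs I' (insert x Z'))" for x I' Z'
  proof -
    have "Bs I' Z' = Bs (insert x I') Z' \<union> Bs I' (insert x Z')" by (auto simp: minor_family_def)
    moreover have "Bs (insert x I') Z' \<inter> Bs I' (insert x Z') = {}" by (auto simp: minor_family_def)
    ultimately show ?thesis using finite_Bs by (metis card_Un_disjoint)
  qed
  have c: "insert e (insert f I) = insert f (insert e I)" by auto
  have c2: "Bs I (insert f (insert e Z)) = Bs I (insert e (insert f Z))" by (simp only: insert_commute)
  show ?thesis
    using neg_corr_aux[OF assms] split[of I Z e] split[of "insert e I" Z f]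
      split[of I "insert f Z" e] split[of I "insert e Z" f]
    unfolding c c2 by (simp add: algebra_simps)
qed

end

section \<open>The theorem of Feder and Mihail\<close>

text \<open>Negative correlation is demanded in every minor because the induction below conditions
  on more and more elements; the common size \<open>r\<close> is what makes covariances sum to
  0.\<close>

locale balanced_family =
  fixes B :: "'e set set" and E :: "'e set" and r :: nat
  assumes finite_E: "finite E" and B_sub: "T \<in> B \<Longrightarrow> T \<subseteq> E" and card_B: "T \<in> B \<Longrightarrow> card T = r"
    and neg_corr: "\<lbrakk>e \<in> E - I - Z; f \<in> E - I - Z; e \<noteq> f\<rbrakk> \<Longrightarrow>
      card (minor_family B (insert e (insert f I)) Z) * card (minor_family B I (insert e (insert f Z)))
      \<le> card (minor_family B (insert e I) (insert f Z)) * card (minor_family B (insert f I) (insert e Z))"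
begin

abbreviation "Bm \<equiv> minor_family B"

lemma finite_Bm [simp]: "finite (Bm I Z)"
proof (rule finite_subset)
  show "Bm I Z \<subseteq> Pow E" using B_sub by (auto simp: minor_family_def)
qed (simp add: finite_E)

lemma sum_split:
  fixes h :: "'e set \<Rightarrow> real"
  shows "(\<Sum>T\<in>Bm I Z. h T) = (\<Sum>T\<in>Bm (insert x I) Z. h T) + (\<Sum>T\<in>Bm I (insert x Z). h T)"
proof -
  have "Bm I Z = Bm (insert x I) Z \<union> Bm I (insert x Z)" by (auto simp: minor_family_def)
  moreover have "Bm (insert x I) Z \<inter> Bm I (insert x Z) = {}" by (auto simp: minor_family_def)
  ultimately show ?thesis
    using sum.union_disjoint[OF finite_Bm finite_Bm, of "insert x I" Z I "insert x Z" h] by simp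
qed

lemma card_split: "real (card (Bm I Z)) = real (card (Bm (insert x I) Z)) + real (card (Bm I (insert x Z)))"
  using sum_split[of "\<lambda>_. 1"] by simp

text \<open>All members of \<open>Bm I Z\<close> have the same number of elements outside
  \<open>I\<close>, so the covariances of \<open>h\<close> with the indicators of the free elements
  add up to 0. They cannot all be negative, and elements of probability 0 contribute
  nothing.\<close>

lemma exists_nonneg_corr:
  fixes h :: "'e set \<Rightarrow> real"
  assumes "I \<inter> Z = {}" "I \<subseteq> E" and ne: "\<exists>T\<in>Bm I Z. \<not> T \<subseteq> I"
  shows "\<exists>e\<in>E - I - Z. 0 < card (Bm (insert e I) Z) \<and>
    card (Bm (insert e I) Z) * sum h (Bm I Z) \<le> card (Bm I Z) * (\<Sum>T\<in>Bm (insert e I) Z. h T)"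
proof (rule ccontr)
  let ?E = "E - I - Z"
  define a A where "a e = real (card (Bm (insert e I) Z))" and "A e = (\<Sum>T\<in>Bm (insert e I) Z. h T)" for e
  define N S where "N = real (card (Bm I Z))" and "S = sum h (Bm I Z)"
  assume neg: "\<not> ?thesis"
  have *: "N * A e < a e * S" if "e \<in> ?E" "0 < a e" for e
  proof -
    have "0 < card (Bm (insert e I) Z)" using that(2) by (simp add: a_def)
    show ?thesis
    proof (rule ccontr)
      assume "\<not> N * A e < a e * S"
      then have "a e * S \<le> N * A e" by simp
      with \<open>0 < card (Bm (insert e I) Z)\<close> that(1) have "\<exists>e\<in>E - I - Z. 0 < card (Bm (insert e I) Z) \<and>
          card (Bm (insert e I) Z) * sum h (Bm I Z) \<le> card (Bm I Z) * (\<Sum>T\<in>Bm (insert e I) Z. h T)"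
        unfolding a_def A_def N_def S_def by (intro bexI[of _ e] conjI)
      with neg show False by contradiction
    qed
  qed
  have zero: "N * A e = a e * S" if "a e = 0" for e
    using that finite_Bm[of "insert e I" Z] unfolding a_def A_def by simp
  obtain T0 where T0: "T0 \<in> Bm I Z" "\<not> T0 \<subseteq> I" using ne by blast
  then obtain e0 where e0: "e0 \<in> T0" "e0 \<notin> I" by blast
  have T0E: "T0 \<subseteq> E" using T0(1) B_sub by (auto simp: minor_family_def)
  have e0': "e0 \<in> ?E" "T0 \<in> Bm (insert e0 I) Z" using e0 T0 T0E by (auto simp: minor_family_def)
  then have "Bm (insert e0 I) Z \<noteq> {}" by blast
  then have pos: "0 < a e0" unfolding a_def by (simp add: card_gt_0_iff)
  have le: "N * A e \<le> a e * S" if "e \<in> ?E" for e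
  proof (cases "a e = 0")
    case False
    then have "0 < a e" by (simp add: a_def card_gt_0_iff)
    then show ?thesis using *[OF that] by (simp add: less_imp_le)
  qed (simp add: zero)
  have "(\<Sum>e\<in>?E. N * A e) < (\<Sum>e\<in>?E. a e * S)"
    using finite_E le *[OF e0'(1) pos] e0' by (intro sum_strict_mono_ex1) auto
  \<comment> \<open>Double counting: each member contains exactly \<open>r - card I\<close> free
    elements.\<close>
  moreover have cnt: "(\<Sum>e\<in>?E. \<Sum>T\<in>Bm (insert e I) Z. g T) = (real r - card I) * sum g (Bm I Z)" for g :: "_ \<Rightarrow> real"
  proof -
    have "(\<Sum>e\<in>?E. \<Sum>T\<in>Bm (insert e I) Z. g T) = (\<Sum>e\<in>?E. \<Sum>T\<in>Bm I Z. if e \<in> T then g T else 0)"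
    proof (rule sum.cong[OF refl])
      fix e
      have "Bm (insert e I) Z = Bm I Z \<inter> {T. e \<in> T}" by (auto simp: minor_family_def)
      then show "(\<Sum>T\<in>Bm (insert e I) Z. g T) = (\<Sum>T\<in>Bm I Z. if e \<in> T then g T else 0)"
        by (simp add: sum.If_cases)
    qed
    also have "\<dots> = (\<Sum>T\<in>Bm I Z. \<Sum>e\<in>?E. if e \<in> T then g T else 0)" by (rule sum.swap)
    also have "\<dots> = (\<Sum>T\<in>Bm I Z. (real r - card I) * g T)"
    proof (rule sum.cong[OF refl])
      fix T assume T: "T \<in> Bm I Z"
      have TE: "T \<subseteq> E" "T \<in> B" "I \<subseteq> T" "T \<inter> Z = {}" using T B_sub by (auto simp: minor_family_def)
      have "?E \<inter> T = T - I" using TE by auto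
      moreover have "real (card (T - I)) = real r - card I"
      proof -
        have "finite T" "finite I" using TE finite_E by (auto intro: finite_subset)
        then show ?thesis
          using card_Diff_subset[of I T] card_mono[of T I] TE(3) card_B[OF TE(2)] by simp
      qed
      ultimately show "(\<Sum>e\<in>?E. if e \<in> T then g T else 0) = (real r - card I) * g T"
        using finite_E by (simp add: sum.If_cases Int_def)
    qed
    finally show ?thesis by (simp add: sum_distrib_left)
  qed
  have "(\<Sum>e\<in>?E. N * A e) = N * ((real r - card I) * S)"
    unfolding sum_distrib_left[symmetric] using cnt[of h] by (simp add: A_def S_def)
  moreover have "(\<Sum>e\<in>?E. a e * S) = (real r - card I) * N * S"
    using cnt[of "\<lambda>_. 1"] unfolding a_def N_def by (simp add: sum_distrib_right[symmetric])
  ultimately show False by (simp add: algebra_simps)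
qed

text \<open>Letters \<open>a\<close> and \<open>b\<close> count sets with and without
  \<open>e\<close>, index 1 and 0 mean with and without \<open>f\<close>, capitals are sums of
  \<open>h\<close>. Given \<open>f\<close>, the mean of \<open>h\<close> is a mixture of \<alpha>
  and \<beta> with \<beta> \<le> \<alpha>. Without \<open>f\<close> the two conditional means are no
  smaller by \<open>iii\<close> and \<open>iv\<close>, and \<open>ii\<close> puts more weight on the
  larger one.\<close>

lemma feder_mihail_algebra:
  fixes a0 a1 b0 b1 A0 A1 B0 B1 :: real
  assumes pos: "0 < a1" "0 \<le> a0" "0 \<le> b0" "0 \<le> b1"
    and z: "a0 = 0 \<Longrightarrow> A0 = 0" "b0 = 0 \<Longrightarrow> B0 = 0" "b1 = 0 \<Longrightarrow> B1 = 0"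
    and i: "a1 * B1 \<le> b1 * A1" and ii: "a1 * b0 \<le> a0 * b1"
    and iii: "A1 * a0 \<le> A0 * a1" and iv: "B1 * b0 \<le> B0 * b1"
  shows "(A1 + B1) * (a0 + b0) \<le> (A0 + B0) * (a1 + b1)"
proof (cases "b1 = 0")
  case True
  then have "a1 * b0 \<le> 0" using ii by simp
  then have "b0 = 0" using pos by (simp add: mult_le_0_iff)
  then show ?thesis using True z iii by simp
next
  case False
  then have b1: "0 < b1" using pos by simp
  define \<alpha> \<beta> where "\<alpha> = A1 / a1" and "\<beta> = B1 / b1"
  have A1: "A1 = \<alpha> * a1" and B1: "B1 = \<beta> * b1" using pos b1 by (auto simp: \<alpha>_def \<beta>_def)
  have "\<beta> * (a1 * b1) \<le> \<alpha> * (a1 * b1)" using i by (simp add: A1 B1 algebra_simps)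
  then have ab: "\<beta> \<le> \<alpha>" using pos b1 by (meson mult_le_cancel_right_pos mult_pos_pos)
  have "(\<alpha> * a0) * a1 \<le> A0 * a1" using iii by (simp add: A1 algebra_simps)
  then have A0: "\<alpha> * a0 \<le> A0" using pos by (meson mult_le_cancel_right_pos)
  have "(\<beta> * b0) * b1 \<le> B0 * b1" using iv by (simp add: B1 algebra_simps)
  then have B0: "\<beta> * b0 \<le> B0" using b1 by (meson mult_le_cancel_right_pos)
  have "0 \<le> (\<alpha> - \<beta>) * (a0 * b1 - a1 * b0)" using ab ii by simp
  then have "(A1 + B1) * (a0 + b0) \<le> (\<alpha> * a0 + \<beta> * b0) * (a1 + b1)"
    unfolding A1 B1 by (simp add: algebra_simps)
  also have "\<dots> \<le> (A0 + B0) * (a1 + b1)"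
    using A0 B0 pos b1 by (intro mult_right_mono) auto
  finally show ?thesis .
qed

text \<open>Induction on the number of free elements. Both sides are split by an element
  \<open>e\<close> that is nonnegatively correlated with \<open>h\<close> among the sets containing
  \<open>f\<close>; the two branches are compared by induction and their weights by negative
  correlation.\<close>

lemma feder_mihail:
  fixes h :: "'e set \<Rightarrow> real"
  assumes h: "\<And>X Y. X \<subseteq> Y \<Longrightarrow> h X \<le> h Y" and hf: "\<And>X. h (insert f X) = h X"
    and "f \<in> E - I - Z" "I \<inter> Z = {}" "I \<subseteq> E"
  shows "sum h (Bm (insert f I) Z) * real (card (Bm I (insert f Z)))
    \<le> sum h (Bm I (insert f Z)) * real (card (Bm (insert f I) Z))"
  using assms(3-)
proof (induction "card (E - I - Z)" arbitrary: I Z rule: less_induct)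
  case less
  let ?I1 = "insert f I" and ?Z0 = "insert f Z"
  consider "Bm ?I1 Z = {} \<or> Bm I ?Z0 = {}" | (deg) "Bm ?I1 Z \<noteq> {}" "Bm I ?Z0 \<noteq> {}" "\<forall>T\<in>Bm ?I1 Z. T \<subseteq> ?I1"
    | (main) "\<exists>T\<in>Bm ?I1 Z. \<not> T \<subseteq> ?I1" by blast
  then show ?case
  proof cases
    case 1
    then show ?thesis by auto
  next
    \<comment> \<open>The only set containing \<open>f\<close> is \<open>insert f I\<close>, so
      there is nothing to split by. Since \<open>h\<close> does not see \<open>f\<close>, its value
      there is \<open>h I\<close>, a lower bound for \<open>h\<close> on all sets of the other
      family.\<close>
    case deg
    have "Bm ?I1 Z \<subseteq> {?I1}" using deg(3) by (auto simp: minor_family_def)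
    then have one: "Bm ?I1 Z = {?I1}" using deg(1) by blast
    have "h I \<le> h T" if "T \<in> Bm I ?Z0" for T using that h by (auto simp: minor_family_def)
    then have "real (card (Bm I ?Z0)) * h I \<le> sum h (Bm I ?Z0)"
      by (rule sum_bounded_below)
    then show ?thesis unfolding one by (simp add: hf mult.commute)
  next
    case main
    have "?I1 \<inter> Z = {}" "?I1 \<subseteq> E" using less.prems by auto
    from exists_nonneg_corr[OF this main, of h] obtain e where e: "e \<in> E - ?I1 - Z"
      and pos: "0 < card (Bm (insert e ?I1) Z)"
      and corr: "real (card (Bm (insert e ?I1) Z)) * sum h (Bm ?I1 Z) \<le> real (card (Bm ?I1 Z)) * sum h (Bm (insert e ?I1) Z)"
      by blast
    have ef: "e \<noteq> f" "e \<in> E - I - Z" using e by auto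
    have c: "insert e ?I1 = insert f (insert e I)" "insert e ?Z0 = insert f (insert e Z)" by auto
    have lt: "card (E - insert e I - Z) < card (E - I - Z)" "card (E - I - insert e Z) < card (E - I - Z)"
      by (rule psubset_card_mono; use finite_E ef in blast)+
    have IH1: "sum h (Bm (insert f (insert e I)) Z) * real (card (Bm (insert e I) ?Z0))
        \<le> sum h (Bm (insert e I) ?Z0) * real (card (Bm (insert f (insert e I)) Z))"
      by (rule less.hyps[OF lt(1)]) (use less.prems e in auto)
    have IH2: "sum h (Bm ?I1 (insert e Z)) * real (card (Bm I (insert f (insert e Z))))
        \<le> sum h (Bm I (insert f (insert e Z))) * real (card (Bm ?I1 (insert e Z)))"
      by (rule less.hyps[OF lt(2)]) (use less.prems e in auto)
    have nc: "card (Bm (insert e ?I1) Z) * card (Bm I (insert e ?Z0))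
        \<le> card (Bm (insert e I) ?Z0) * card (Bm ?I1 (insert e Z))"
      by (rule neg_corr) (use less.prems ef in auto)
    define a1 b1 a0 b0 where "a1 = real (card (Bm (insert e ?I1) Z))" and "b1 = real (card (Bm ?I1 (insert e Z)))"
      and "a0 = real (card (Bm (insert e I) ?Z0))" and "b0 = real (card (Bm I (insert e ?Z0)))"
    define A1 B1 A0 B0 where "A1 = sum h (Bm (insert e ?I1) Z)" and "B1 = sum h (Bm ?I1 (insert e Z))"
      and "A0 = sum h (Bm (insert e I) ?Z0)" and "B0 = sum h (Bm I (insert e ?Z0))"
    note defs = a1_def b1_def a0_def b0_def A1_def B1_def A0_def B0_def
    have s: "sum h (Bm ?I1 Z) = A1 + B1" "real (card (Bm ?I1 Z)) = a1 + b1"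
      "sum h (Bm I ?Z0) = A0 + B0" "real (card (Bm I ?Z0)) = a0 + b0"
      unfolding defs by (rule sum_split, rule card_split, rule sum_split, rule card_split)
    have "(A1 + B1) * (a0 + b0) \<le> (A0 + B0) * (a1 + b1)"
    proof (rule feder_mihail_algebra)
      show "0 < a1" using pos by (simp add: a1_def)
      show "a1 * B1 \<le> b1 * A1"
        using corr unfolding s a1_def[symmetric] A1_def[symmetric] by (simp add: algebra_simps)
      show "a1 * b0 \<le> a0 * b1" using nc unfolding defs by (simp flip: of_nat_mult)
      show "A1 * a0 \<le> A0 * a1" using IH1 unfolding defs c .
      show "B1 * b0 \<le> B0 * b1" using IH2 unfolding defs c .
    qed (auto simp: defs)
    then show ?thesis unfolding s .
  qed
qed

end

lemma (in oriented_graph) balanced_bases: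
  "\<exists>r. balanced_family (bases en R E) E r"
proof -
  obtain T0 where T0: "T0 \<in> bases en R E" using bases_nonempty[OF finite_E] by blast
  have "balanced_family (bases en R E) E (card T0)"
  proof
    show "finite E" by (rule finite_E)
    show "T \<subseteq> E" if "T \<in> bases en R E" for T using that by (rule bases_subset)
    show "card T = card T0" if "T \<in> bases en R E" for T using that T0 by (rule bases_card_eq)
  qed (rule neg_corr)
  then show ?thesis ..
qed

section \<open>Monotonicity under identification of vertices\<close>

definition uavg :: "'a set \<Rightarrow> ('a \<Rightarrow> real) \<Rightarrow> real" where
  "uavg B h = sum h B / card B"

lemma two_ended_orientation:
  assumes "two_ended en E"
  obtains s t where "\<And>e. e \<in> E \<Longrightarrow> en e = {s e, t e}"
  using assms unfolding two_ended_def by metis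

lemma bases_card_eq:
  assumes "finite E" "two_ended en E" "T \<in> bases en R E" "T' \<in> bases en R E"
  shows "card T = card T'"
proof -
  obtain s t where "\<And>e. e \<in> E \<Longrightarrow> en e = {s e, t e}"
    using two_ended_orientation[OF assms(2)] by metis
  then interpret oriented_graph en s t R E by unfold_locales (use assms in auto)
  show ?thesis by (rule bases_card_eq) (use assms in auto)
qed

text \<open>If \<open>T\<close> joins \<open>u\<close> to \<open>v\<close>, identifying the two
  closes a cycle and makes an edge of it redundant. Hence a basis modulo the identification cannot
  connect \<open>u\<close> and \<open>v\<close> before the identification.\<close>

lemma con_imp_minimal:
  assumes "finite T" "two_ended en T" "(u, v) \<in> con en R T" "(u, v) \<notin> con en R {}"
  shows "\<exists>f\<in>T. en f \<times> en f \<subseteq> con en (insert (u, v) R) (T - {f})"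
  using assms
proof (induction T rule: finite_psubset_induct)
  case (psubset T)
  have "T \<noteq> {}" using psubset.prems by auto
  then obtain f where f: "f \<in> T" by blast
  show ?case
  proof (cases "(u, v) \<in> con en R (T - {f})")
    case True
    then have "\<exists>g\<in>T - {f}. en g \<times> en g \<subseteq> con en (insert (u, v) R) (T - {f} - {g})"
      using psubset.prems f two_ended_subset[of en T "T - {f}"] by (intro psubset.IH) auto
    then obtain g where g: "g \<in> T" "en g \<times> en g \<subseteq> con en (insert (u, v) R) (T - {f} - {g})" by blast
    have "con en (insert (u, v) R) (T - {f} - {g}) \<subseteq> con en (insert (u, v) R) (T - {g})"
      by (rule con_mono) auto
    then show ?thesis using g by blast
  next
    case False
    obtain a b where ab: "en f = {a, b}" using psubset.prems(1) f unfolding two_ended_def by blast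
    let ?C = "con en (insert (u, v) R) (T - {f})"
    have "(u, v) \<in> con en R (insert f (T - {f}))" using psubset.prems(2) f by (simp add: insert_absorb)
    then have *: "((u, a) \<in> con en R (T - {f}) \<and> (b, v) \<in> con en R (T - {f}))
      \<or> ((u, b) \<in> con en R (T - {f}) \<and> (a, v) \<in> con en R (T - {f}))"
      using False con_insert[of en f a b u v R "T - {f}", OF ab] by blast
    have m: "con en R (T - {f}) \<subseteq> ?C" by (rule con_mono) auto
    have uv: "(u, v) \<in> ?C" by (rule con_rel) simp
    have "(a, b) \<in> ?C"
      using * m uv con_trans[of _ _ en "insert (u, v) R" "T - {f}"] con_sym[of _ _ en "insert (u, v) R" "T - {f}"]
      by blast
    then show ?thesis using f ends_con_iff[of en f a b "insert (u, v) R" "T - {f}", OF ab] by blast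
  qed
qed

text \<open>The identification of \<open>u\<close> and \<open>v\<close> amounts to adding an edge \<open>None\<close> between them and conditioning
  on it being present.\<close>

lemma uavg_bases_insert:
  fixes en :: "'e \<Rightarrow> 'v set" and h :: "'e set \<Rightarrow> real"
  assumes fin: "finite E" and two: "two_ended en E" and uv: "(u, v) \<in> con en R E"
    and h: "\<And>X Y. X \<subseteq> Y \<Longrightarrow> h X \<le> h Y"
  shows "uavg (bases en (insert (u, v) R) E) h \<le> uavg (bases en R E) h"
proof (cases "(u, v) \<in> con en R {}")
  \<comment> \<open>If \<open>u\<close> and \<open>v\<close> are identified already, the extra edge
    would be a loop and could not be conditioned to be present.\<close>
  case True
  have "con en (insert (u, v) R) {} = con en R {}"
  proof
    show "con en (insert (u, v) R) {} \<subseteq> con en R {}"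
      by (rule con_subsetI) (use True con_rels[of R en "{}"] in auto)
    show "con en R {} \<subseteq> con en (insert (u, v) R) {}" by (rule con_mono) auto
  qed
  then have "bases en (insert (u, v) R) E = bases en R E" by (rule bases_cong_rel)
  then show ?thesis by simp
next
  case False
  obtain s t where st: "\<And>e. e \<in> E \<Longrightarrow> en e = {s e, t e}"
    using two_ended_orientation[OF two] by metis
  define en' where "en' = case_option {u, v} en"
  define E' where "E' = insert None (Some ` E)"
  have en'_simps [simp]: "en' None = {u, v}" "en' (Some e) = en e" for e by (auto simp: en'_def)
  interpret oriented_graph en' "case_option u s" "case_option v t" R E'
    by unfold_locales (use fin st in \<open>auto simp: E'_def\<close>)
  obtain r where "balanced_family (bases en' R E') E' r" using balanced_bases by blast
  then interpret balanced_family "bases en' R E'" E' r .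
  let ?R' = "insert (u, v) R"
  have c0: "con en' R (Some ` T) = con en R T" for R T
    by (simp add: con_def)
  have c1: "con en' R (insert None (Some ` T)) = con en ?R' T" for T
  proof -
    have "con en' R (insert None (Some ` T)) = con en' ?R' (Some ` T)"
    proof
      have uv': "(u, v) \<in> con en' ?R' (Some ` T)" by (rule con_rel) simp
      show "con en' R (insert None (Some ` T)) \<subseteq> con en' ?R' (Some ` T)"
      proof (rule con_subsetI)
        show "R \<subseteq> con en' ?R' (Some ` T)" using con_rels[of ?R' en' "Some ` T"] by blast
        show "en' e \<times> en' e \<subseteq> con en' ?R' (Some ` T)" if "e \<in> insert None (Some ` T)" for e
        proof (cases "e = None")
          case True
          then show ?thesis using uv' con_sym[OF uv'] by auto
        next
          case False
          then have "e \<in> Some ` T" using that by blast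
          then show ?thesis by (rule con_edges)
        qed
      qed
      show "con en' ?R' (Some ` T) \<subseteq> con en' R (insert None (Some ` T))"
      proof (rule con_subsetI)
        show "?R' \<subseteq> con en' R (insert None (Some ` T))"
          using con_rels[of R en' "insert None (Some ` T)"]
            con_edge[of None "insert None (Some ` T)" u en' v R] by auto
        show "en' e \<times> en' e \<subseteq> con en' R (insert None (Some ` T))" if "e \<in> Some ` T" for e
          using that by (intro con_edges) auto
      qed
    qed
    then show ?thesis by (simp add: c0)
  qed
  have d0: "Some ` T - {Some f} = Some ` (T - {f})" for T :: "'e set" and f by auto
  have d1: "insert None (Some ` T) - {Some f} = insert None (Some ` (T - {f}))" for T :: "'e set" and f by auto
  \<comment> \<open>\<open>E\<close> connects \<open>u\<close> and \<open>v\<close>, so every basis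
    of \<open>E\<close> spans \<open>None\<close> as well; the bases that avoid \<open>None\<close>
    are therefore exactly the bases modulo \<open>R\<close>.\<close>
  have B0: "minor_family (bases en' R E') {} {None} = (`) Some ` bases en R E"
  proof -
    have iff: "Some ` T \<in> bases en' R E' \<longleftrightarrow> T \<in> bases en R E" for T
    proof -
      have "(u, v) \<in> con en R T" if "T \<in> bases en R E"
        using bases_con_eq[OF that] uv by simp
      moreover have "{u, v} \<times> {u, v} \<subseteq> con en R T \<longleftrightarrow> (u, v) \<in> con en R T"
        using con_sym[of u v en R T] by auto
      ultimately show ?thesis
        unfolding bases_def E'_def by (simp add: ball_simps c0 d0 image_subset_iff) blast
    qed
    show ?thesis
    proof (rule set_eqI)
      fix T' :: "'e option set"
      have "T' = Some ` (Some -` T')" if "None \<notin> T'"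
        using that by (auto simp: image_iff) (metis not_None_eq)
      moreover have "None \<notin> Some ` T" for T :: "'e set" by auto
      ultimately have "None \<notin> T' \<longleftrightarrow> (\<exists>T. T' = Some ` T)" by metis
      then show "T' \<in> minor_family (bases en' R E') {} {None} \<longleftrightarrow> T' \<in> (`) Some ` bases en R E"
        using iff unfolding minor_family_def by auto
    qed
  qed
  \<comment> \<open>In the presence of \<open>None\<close>, connectivity is connectivity modulo the
    identification. That \<open>None\<close> itself is a bridge is the content of
    \<open>con_imp_minimal\<close>.\<close>
  have B1: "minor_family (bases en' R E') {None} {} = (\<lambda>T. insert None (Some ` T)) ` bases en ?R' E"
  proof -
    have iff: "insert None (Some ` T) \<in> bases en' R E' \<longleftrightarrow> T \<in> bases en ?R' E" for T
    proof -
      have "\<not> {u, v} \<times> {u, v} \<subseteq> con en R T" if T: "T \<in> bases en ?R' E"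
      proof
        assume "{u, v} \<times> {u, v} \<subseteq> con en R T"
        then have "(u, v) \<in> con en R T" by simp
        then have "\<exists>f\<in>T. en f \<times> en f \<subseteq> con en ?R' (T - {f})"
          using bases_finite_elem[OF fin T] two_ended_subset[OF two bases_subset[OF T]] False
          by (intro con_imp_minimal)
        then show False using T by (auto simp: bases_def)
      qed
      moreover have "{u, v} \<times> {u, v} \<subseteq> con en ?R' T"
        using con_rel[of u v ?R' en T] con_sym[of u v en ?R' T] by auto
      ultimately show ?thesis
        unfolding bases_def E'_def by (simp add: ball_simps c0 c1 d1 image_subset_iff) blast
    qed
    show ?thesis
    proof (rule set_eqI)
      fix T' :: "'e option set"
      have "T' = insert None (Some ` (Some -` T'))" if "None \<in> T'"
        using that by (auto simp: image_iff)
      then have ex: "\<exists>T. T' = insert None (Some ` T)" if "None \<in> T'"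
        using that by blast
      show "T' \<in> minor_family (bases en' R E') {None} {} \<longleftrightarrow>
          T' \<in> (\<lambda>T. insert None (Some ` T)) ` bases en ?R' E" (is "?L \<longleftrightarrow> ?R")
      proof
        assume L: ?L
        then obtain T where "T' = insert None (Some ` T)" using ex by (auto simp: minor_family_def)
        with L iff[of T] show ?R unfolding minor_family_def by blast
      next
        assume ?R
        then obtain T where "T' = insert None (Some ` T)" "T \<in> bases en ?R' E" by blast
        with iff[of T] show ?L unfolding minor_family_def by simp
      qed
    qed
  qed
  \<comment> \<open>The comparison theorem needs a function that ignores the conditioned element,
    hence the pullback along \<open>Some\<close>.\<close>
  define h' where "h' T = h (Some -` T)" for T
  have "sum h' (minor_family (bases en' R E') {None} {}) * real (card (minor_family (bases en' R E') {} {None}))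
    \<le> sum h' (minor_family (bases en' R E') {} {None}) * real (card (minor_family (bases en' R E') {None} {}))"
  proof (rule feder_mihail)
    show "h' X \<le> h' Y" if "X \<subseteq> Y" for X Y using that unfolding h'_def by (intro h) auto
    show "h' (insert None X) = h' X" for X
    proof -
      have "Some -` insert None X = Some -` X" by auto
      then show ?thesis by (simp add: h'_def)
    qed
  qed (auto simp: E'_def)
  moreover have i0: "inj_on ((`) Some) (bases en R E)" by (auto intro!: inj_onI)
  moreover have i1: "inj_on (\<lambda>T. insert None (Some ` T)) (bases en ?R' E)"
  proof (rule inj_onI)
    fix S T :: "'e set" assume "insert None (Some ` S) = insert None (Some ` T)"
    then have "Some -` insert None (Some ` S) = Some -` insert None (Some ` T)" by simp
    moreover have "Some -` insert None (Some ` S) = S" for S :: "'e set" by auto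
    ultimately show "S = T" by simp
  qed
  moreover have "h' (Some ` T) = h T" for T
  proof -
    have "Some -` Some ` T = T" by auto
    then show ?thesis by (simp add: h'_def)
  qed
  moreover have "h' (insert None (Some ` T)) = h T" for T
  proof -
    have "Some -` insert None (Some ` T) = T" by auto
    then show ?thesis by (simp add: h'_def)
  qed
  ultimately have "sum h (bases en ?R' E) * card (bases en R E) \<le> sum h (bases en R E) * card (bases en ?R' E)"
    unfolding B0 B1 by (simp add: sum.reindex card_image)
  moreover have "0 < card (bases en R E)" "0 < card (bases en ?R' E)"
    using bases_nonempty[OF fin, of en] finite_bases[OF fin, of en] by (simp_all add: card_gt_0_iff)
  ultimately show ?thesis unfolding uavg_def by (simp add: field_simps)
qed

lemma uavg_bases_finite_union:
  assumes "finite D" and fin: "finite E" and two: "two_ended en E" and "D \<subseteq> con en R E"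
    and h: "\<And>X Y. X \<subseteq> Y \<Longrightarrow> h X \<le> h Y"
  shows "uavg (bases en (R \<union> D) E) h \<le> uavg (bases en R E) h"
  using assms(1,4)
proof (induction D rule: finite_induct)
  case (insert p D)
  obtain u v where p: "p = (u, v)" by (cases p)
  have "con en R E \<subseteq> con en (R \<union> D) E" by (rule con_mono) auto
  then have "(u, v) \<in> con en (R \<union> D) E" using insert.prems p by auto
  then have "uavg (bases en (insert (u, v) (R \<union> D)) E) h \<le> uavg (bases en (R \<union> D) E) h"
    using fin two h by (intro uavg_bases_insert)
  also have "\<dots> \<le> uavg (bases en R E) h" using insert by simp
  finally show ?case by (simp add: p)
qed simp

text \<open>Identifications are added one pair at a time, so finitely many must suffice: only those
  between endpoints of the finite set \<open>E\<close> matter, and \<open>D\<close> collects them.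
  The inclusion of \<open>R'\<close> in \<open>con en R E\<close> says that only connected vertices
  are glued, as each single step requires.\<close>

lemma uavg_bases_mono:
  assumes fin: "finite E" and two: "two_ended en E" and R: "R \<subseteq> R'" "R' \<subseteq> con en R E"
    and h: "\<And>X Y. X \<subseteq> Y \<Longrightarrow> h X \<le> h Y"
  shows "uavg (bases en R' E) h \<le> uavg (bases en R E) h"
proof -
  define X where "X = (\<Union>e\<in>E. en e)"
  have "finite X" unfolding X_def using fin two by (auto simp: two_ended_def)
  define D where "D = con en R' {} \<inter> X \<times> X"
  have "finite D" unfolding D_def using \<open>finite X\<close> by simp
  have R'E: "con en R' {} \<subseteq> con en R E"
    by (rule con_subsetI) (use R in auto)
  have "bases en R' E = bases en (R \<union> D) E"
  proof (rule bases_restrict)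
    show "en e \<subseteq> X" if "e \<in> E" for e using that by (auto simp: X_def)
    have "con en (R \<union> D) {} \<subseteq> con en R' {}"
      by (rule con_subsetI) (use R con_rels[of R' en "{}"] in \<open>auto simp: D_def\<close>)
    then show "con en R' {} \<inter> X \<times> X = con en (R \<union> D) {} \<inter> X \<times> X"
      using con_rels[of "R \<union> D" en "{}"] unfolding D_def by blast
  qed
  moreover have "uavg (bases en (R \<union> D) E) h \<le> uavg (bases en R E) h"
    using \<open>finite D\<close> fin two R'E h by (intro uavg_bases_finite_union) (auto simp: D_def)
  ultimately show ?thesis by simp
qed

section \<open>Spanning trees of wired graphs\<close>

lemma adj_rtrancl:
  assumes "two_ended (ends K) (edges K)"
  shows "(adj K)\<^sup>* = con (ends K) {} (edges K)"
proof -
  have "({} \<union> {}\<inverse> \<union> (\<Union>e\<in>edges K. ends K e \<times> ends K e))\<^sup>* = (adj K)\<^sup>*"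
  proof (rule rtrancl_subset)
    show "adj K \<subseteq> {} \<union> {}\<inverse> \<union> (\<Union>e\<in>edges K. ends K e \<times> ends K e)"
      unfolding adj_def by fastforce
    show "{} \<union> {}\<inverse> \<union> (\<Union>e\<in>edges K. ends K e \<times> ends K e) \<subseteq> (adj K)\<^sup>*"
    proof clarsimp
      fix x y e assume e: "e \<in> edges K" "x \<in> ends K e" "y \<in> ends K e"
      obtain u v where "ends K e = {u, v}" using assms e unfolding two_ended_def by blast
      then have "x = y \<or> ends K e = {x, y}" using e by auto
      then show "(x, y) \<in> (adj K)\<^sup>*" using e unfolding adj_def by auto
    qed
  qed
  then show ?thesis by (simp add: con_def)
qed

lemma con_distinct_path:
  assumes "(x, y) \<in> con en {} T" "two_ended en T"
  shows "\<exists>vs es. length vs = Suc (length es) \<and> distinct vs \<and> vs ! 0 = x \<and> vs ! length es = y \<and>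
    (\<forall>i<length es. es ! i \<in> T \<and> en (es ! i) = {vs ! i, vs ! Suc i})"
  using assms(1) unfolding con_def
proof (induction rule: rtrancl_induct)
  case base
  show ?case by (rule exI[of _ "[x]"], rule exI[of _ "[]"]) simp
next
  case (step y z)
  obtain vs es where p: "length vs = Suc (length es)" "distinct vs" "vs ! 0 = x" "vs ! length es = y"
    "\<And>i. i < length es \<Longrightarrow> es ! i \<in> T \<and> en (es ! i) = {vs ! i, vs ! Suc i}"
    using step.IH by blast
  obtain f where f: "f \<in> T" "y \<in> en f" "z \<in> en f" using step.hyps(2) by auto
  show ?case
  proof (cases "z \<in> set vs")
    \<comment> \<open>The path would return to an old vertex, so it is cut off there instead of
      extended.\<close>
    case True
    then obtain k where k: "k < length vs" "vs ! k = z" by (auto simp: in_set_conv_nth)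
    show ?thesis
      by (rule exI[of _ "take (Suc k) vs"], rule exI[of _ "take k es"]) (use p k in auto)
  next
    case False
    have "y \<in> set vs" using p by (metis lessI nth_mem)
    then have "y \<noteq> z" using False by blast
    then have "en f = {y, z}" using f assms(2) unfolding two_ended_def by fastforce
    show ?thesis
    proof (rule exI[of _ "vs @ [z]"], rule exI[of _ "es @ [f]"], intro conjI allI impI)
      fix i assume "i < length (es @ [f])"
      then consider "i < length es" | "i = length es" by fastforce
      then show "(es @ [f]) ! i \<in> T" "en ((es @ [f]) ! i) = {(vs @ [z]) ! i, (vs @ [z]) ! Suc i}"
        using p f \<open>en f = {y, z}\<close> by (cases; simp add: nth_append)+
    qed (use p False in \<open>auto simp: nth_append\<close>)
  qed
qed

text \<open>An edge that is not a bridge closes a simple path to a cycle, a loop being the case of a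
  path without edges. Conversely, the last edge of a cycle is bypassed by the others.\<close>

lemma acyclic_iff_bridges:
  assumes two: "two_ended (ends K) (edges K)"
  shows "(\<nexists>vs es. is_cycle K vs es) \<longleftrightarrow>
    (\<forall>e\<in>edges K. \<not> ends K e \<times> ends K e \<subseteq> con (ends K) {} (edges K - {e}))"
proof (intro iffI ballI notI)
  fix e assume nc: "\<nexists>vs es. is_cycle K vs es" and e: "e \<in> edges K"
    and c: "ends K e \<times> ends K e \<subseteq> con (ends K) {} (edges K - {e})"
  obtain a b where ab: "ends K e = {a, b}" using two e unfolding two_ended_def by blast
  have "(b, a) \<in> con (ends K) {} (edges K - {e})" using c ab by blast
  moreover have "two_ended (ends K) (edges K - {e})" using two by (rule two_ended_subset) auto
  ultimately obtain vs es where p: "length vs = Suc (length es)" "distinct vs" "vs ! 0 = b"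
    "vs ! length es = a"
    "\<And>i. i < length es \<Longrightarrow> es ! i \<in> edges K - {e} \<and> ends K (es ! i) = {vs ! i, vs ! Suc i}"
    using con_distinct_path[of b a "ends K" "edges K - {e}"] by blast
  have ne: "es ! i \<noteq> es ! j" if "i < j" "j < length es" for i j
  proof
    assume "es ! i = es ! j"
    then have "{vs ! i, vs ! Suc i} = {vs ! j, vs ! Suc j}" using p(5)[of i] p(5)[of j] that by simp
    then have "vs ! i = vs ! j \<or> vs ! i = vs ! Suc j" by (auto simp: doubleton_eq_iff)
    then show False using that p(1,2) by (auto simp: nth_eq_iff_index_eq)
  qed
  have "distinct es" unfolding distinct_conv_nth using ne by (metis nat_neq_iff)
  moreover have "e \<notin> set es" "set es \<subseteq> edges K" using p(5) by (auto simp: in_set_conv_nth)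
  ultimately have "is_cycle K vs (es @ [e])"
    unfolding is_cycle_def
  proof (intro conjI allI impI)
    fix i assume i: "i < length (es @ [e])"
    show "ends K ((es @ [e]) ! i) = {vs ! i, vs ! (Suc i mod length (es @ [e]))}"
    proof (cases "i < length es")
      case True
      then have "Suc i mod length (es @ [e]) = Suc i" by (intro mod_less) simp
      then show ?thesis using p(5)[OF True] True by (simp only: nth_append if_True)
    next
      case False
      then have "i = length es" using i by simp
      then show ?thesis using p ab by (simp add: insert_commute)
    qed
  qed (use p e in auto)
  then show False using nc by blast
next
  assume br: "\<forall>e\<in>edges K. \<not> ends K e \<times> ends K e \<subseteq> con (ends K) {} (edges K - {e})"
  assume "\<exists>vs es. is_cycle K vs es"
  then obtain vs es where cyc: "is_cycle K vs es" by blast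
  define n where "n = length es - 1"
  have len: "length es = Suc n" "length vs = Suc n" using cyc by (auto simp: is_cycle_def n_def)
  let ?e = "es ! n"
  have e: "?e \<in> edges K" using cyc len by (auto simp: is_cycle_def)
  have ends_e: "ends K ?e = {vs ! n, vs ! 0}" using cyc len by (auto simp: is_cycle_def)
  have "(vs ! 0, vs ! i) \<in> con (ends K) {} (edges K - {?e})" if "i \<le> n" for i
    using that
  proof (induction i)
    case (Suc i)
    have "es ! i \<noteq> ?e" using cyc len Suc.prems by (auto simp: is_cycle_def nth_eq_iff_index_eq)
    moreover have "es ! i \<in> edges K" using cyc len Suc.prems by (auto simp: is_cycle_def)
    moreover have "ends K (es ! i) = {vs ! i, vs ! Suc i}"
      using cyc len Suc.prems by (auto simp: is_cycle_def)
    ultimately have "(vs ! i, vs ! Suc i) \<in> con (ends K) {} (edges K - {?e})"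
      by (intro con_edge[of "es ! i"]) auto
    then show ?case using Suc con_trans by (metis Suc_leD)
  qed simp
  from this[of n] have "(vs ! n, vs ! 0) \<in> con (ends K) {} (edges K - {?e})" using con_sym by fastforce
  then have "ends K ?e \<times> ends K ?e \<subseteq> con (ends K) {} (edges K - {?e})"
    using ends_con_iff[of "ends K" ?e "vs ! n" "vs ! 0" "{}" "edges K - {?e}", OF ends_e] by simp
  then show False using br e by blast
qed

text \<open>The identification performed by the wired graph on \<open>W\<close>; it may range over all of the type
  because only identifications between endpoints of edges matter.\<close>

definition wire :: "'v set \<Rightarrow> 'v rel" where
  "wire W = (- W) \<times> (- W)"

definition touching :: "('e \<Rightarrow> 'v set) \<Rightarrow> 'v set \<Rightarrow> 'e set \<Rightarrow> 'e set" where
  "touching en W T = {e \<in> T. en e \<inter> W \<noteq> {}}"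

lemma touching_subset: "touching en W T \<subseteq> T"
  by (auto simp: touching_def)

text \<open>The fibres of \<phi> are the classes of \<open>R\<close>, so the quotient graph and the
  original graph with relation \<open>R\<close> have the same connectivity. This ties the
  \<open>option\<close> vertices of \<open>wired\<close> to the encoding by relations.\<close>

lemma con_image:
  assumes \<phi>: "\<And>x y. \<phi> x = \<phi> y \<longleftrightarrow> x = y \<or> (x, y) \<in> R"
  shows "(\<phi> u, \<phi> v) \<in> con (\<lambda>e. \<phi> ` en e) {} T \<longleftrightarrow> (u, v) \<in> con en R T"
proof
  assume "(u, v) \<in> con en R T"
  then have "((\<phi> u, \<phi> u) \<in> con (\<lambda>e. \<phi> ` en e) {} T) = ((\<phi> u, \<phi> v) \<in> con (\<lambda>e. \<phi> ` en e) {} T)"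
  proof (rule con_invariant[where h = "\<lambda>x. (\<phi> u, \<phi> x) \<in> con (\<lambda>e. \<phi> ` en e) {} T"])
    show "((\<phi> u, \<phi> x) \<in> con (\<lambda>e. \<phi> ` en e) {} T) = ((\<phi> u, \<phi> y) \<in> con (\<lambda>e. \<phi> ` en e) {} T)"
      if "(x, y) \<in> R" for x y using that \<phi>[of x y] by simp
    show "((\<phi> u, \<phi> x) \<in> con (\<lambda>e. \<phi> ` en e) {} T) = ((\<phi> u, \<phi> y) \<in> con (\<lambda>e. \<phi> ` en e) {} T)"
      if "e \<in> T" "x \<in> en e" "y \<in> en e" for e x y
    proof -
      have "(\<phi> x, \<phi> y) \<in> con (\<lambda>e. \<phi> ` en e) {} T" using that by (intro con_edge[of e]) auto
      then show ?thesis using con_trans con_sym by metis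
    qed
  qed
  then show "(\<phi> u, \<phi> v) \<in> con (\<lambda>e. \<phi> ` en e) {} T" by simp
next
  define h where "h x = (\<exists>u'. \<phi> u' = x \<and> (u, u') \<in> con en R T)" for x
  have fiber: "(u, a) \<in> con en R T" if "h (\<phi> a)" for a
  proof -
    from that[unfolded h_def] obtain u' where "\<phi> u' = \<phi> a \<and> (u, u') \<in> con en R T" ..
    then have u': "\<phi> u' = \<phi> a" "(u, u') \<in> con en R T" by simp_all
    then have "u' = a \<or> (u', a) \<in> R" using \<phi> by simp
    then have "(u', a) \<in> con en R T" using con_rel[of u' a R en T] by auto
    with u'(2) show ?thesis by (rule con_trans)
  qed
  assume "(\<phi> u, \<phi> v) \<in> con (\<lambda>e. \<phi> ` en e) {} T"
  then have "h (\<phi> u) = h (\<phi> v)"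
  proof (rule con_invariant)
    have *: "h (\<phi> b)" if "h (\<phi> a)" "e \<in> T" "a \<in> en e" "b \<in> en e" for e a b
    proof -
      have "(u, b) \<in> con en R T"
        using fiber[OF that(1)] con_edge[of e T a en b R, OF that(2-4)] by (rule con_trans)
      then show ?thesis unfolding h_def by (intro exI[of _ b]) simp
    qed
    show "h x = h y" if "e \<in> T" "x \<in> \<phi> ` en e" "y \<in> \<phi> ` en e" for e x y
      using that * by (elim imageE) (simp only:, blast)
  qed simp
  moreover have "h (\<phi> u)" unfolding h_def by (intro exI[of _ u]) simp
  ultimately have "h (\<phi> v)" by simp
  then show "(u, v) \<in> con en R T" by (rule fiber)
qed

locale locally_finite_graph =
  fixes G :: "('v, 'e) mgraph"
  assumes connected: "connected_graph G"
    and edge_ends: "e \<in> edges G \<Longrightarrow> ends G e \<subseteq> verts G"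
    and two_ended: "two_ended (ends G) (edges G)"
    and locally_finite: "finite {e \<in> edges G. v \<in> ends G e}"
begin

abbreviation "en \<equiv> ends G"

lemma verts_con: "u \<in> verts G \<Longrightarrow> v \<in> verts G \<Longrightarrow> (u, v) \<in> con en {} (edges G)"
  using connected adj_rtrancl[OF two_ended] by (auto simp: connected_graph_def)

lemma finite_touching: "finite W \<Longrightarrow> finite (touching en W (edges G))"
proof -
  assume "finite W"
  have "touching en W (edges G) = (\<Union>v\<in>W. {e \<in> edges G. v \<in> en e})" by (auto simp: touching_def)
  then show ?thesis using \<open>finite W\<close> locally_finite by simp
qed

text \<open>An edge that does not touch \<open>W\<close> runs inside the wired exterior, so the
  wiring replaces it and the connectedness of \<open>G\<close> survives.\<close>

lemma touching_wire_con:
  assumes "u \<in> verts G" "v \<in> verts G"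
  shows "(u, v) \<in> con en (wire W) (touching en W (edges G))"
proof -
  have "con en {} (edges G) \<subseteq> con en (wire W) (touching en W (edges G))"
  proof (rule con_subsetI)
    fix e assume e: "e \<in> edges G"
    show "en e \<times> en e \<subseteq> con en (wire W) (touching en W (edges G))"
    proof (cases "e \<in> touching en W (edges G)")
      case True
      then show ?thesis by (rule con_edges)
    next
      case False
      then have "en e \<times> en e \<subseteq> wire W" using e by (auto simp: touching_def wire_def)
      then show ?thesis using con_rels[of "wire W" en] by blast
    qed
  qed simp
  then show ?thesis using verts_con[OF assms] by blast
qed

lemma spanning_trees_wired:
  "spanning_trees (wired G H) = bases en (wire (verts H)) (touching en (verts H) (edges G))"
proof (rule set_eqI)
  fix T
  define W where "W = verts H"
  define \<phi> where "\<phi> = (\<lambda>v. if v \<in> W then Some v else None)"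
  define E where "E = touching en W (edges G)"
  have w: "wired G H = \<lparr>verts = \<phi> ` verts G, edges = E, ends = (\<lambda>e. \<phi> ` en e)\<rparr>"
    by (simp add: wired_def \<phi>_def W_def E_def touching_def Let_def)
  have \<phi>: "\<phi> x = \<phi> y \<longleftrightarrow> x = y \<or> (x, y) \<in> wire W" for x y
    by (auto simp: \<phi>_def wire_def)
  let ?en = "\<lambda>e. \<phi> ` en e"
  have EG: "E \<subseteq> edges G" by (simp add: E_def touching_subset)
  have two': "two_ended ?en E"
    unfolding two_ended_def
  proof
    fix e assume "e \<in> E"
    then obtain u v where "en e = {u, v}" using two_ended EG unfolding two_ended_def by blast
    then show "\<exists>x y. ?en e = {x, y}" by auto
  qed
  have sq: "?en e \<times> ?en e \<subseteq> con ?en {} S \<longleftrightarrow> en e \<times> en e \<subseteq> con en (wire W) S" for e S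
  proof -
    have "?en e \<times> ?en e \<subseteq> con ?en {} S \<longleftrightarrow> (\<forall>x\<in>en e. \<forall>y\<in>en e. (\<phi> x, \<phi> y) \<in> con ?en {} S)" by blast
    also have "\<dots> \<longleftrightarrow> (\<forall>x\<in>en e. \<forall>y\<in>en e. (x, y) \<in> con en (wire W) S)"
      by (simp add: con_image[of \<phi>, OF \<phi>])
    finally show ?thesis by blast
  qed
  have tree: "is_tree (spanning_subgraph (wired G H) T) \<longleftrightarrow>
      (\<forall>u\<in>verts G. \<forall>v\<in>verts G. (u, v) \<in> con en (wire W) T) \<and>
      (\<forall>f\<in>T. \<not> en f \<times> en f \<subseteq> con en (wire W) (T - {f}))" if T: "T \<subseteq> E"
  proof -
    let ?K = "spanning_subgraph (wired G H) T"
    have K: "edges ?K = T" "ends ?K = ?en" "verts ?K = \<phi> ` verts G"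
      by (simp_all add: spanning_subgraph_def w)
    have two: "two_ended (ends ?K) (edges ?K)" unfolding K by (rule two_ended_subset[OF two' T])
    have "verts G \<noteq> {}" using connected by (simp add: connected_graph_def)
    then show ?thesis
      unfolding is_tree_def connected_graph_def adj_rtrancl[OF two] acyclic_iff_bridges[OF two] K
      by (simp add: con_image[of \<phi>, OF \<phi>] sq)
  qed
  \<comment> \<open>A spanning tree connects all vertices, a basis only the ends of edges; the two
    demands agree because the wired graph is connected.\<close>
  have "(\<forall>u\<in>verts G. \<forall>v\<in>verts G. (u, v) \<in> con en (wire W) T) \<longleftrightarrow>
      (\<forall>e\<in>E. en e \<times> en e \<subseteq> con en (wire W) T)" if T: "T \<subseteq> E"
  proof
    assume "\<forall>u\<in>verts G. \<forall>v\<in>verts G. (u, v) \<in> con en (wire W) T"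
    then show "\<forall>e\<in>E. en e \<times> en e \<subseteq> con en (wire W) T" using edge_ends EG by blast
  next
    assume *: "\<forall>e\<in>E. en e \<times> en e \<subseteq> con en (wire W) T"
    have "con en (wire W) E \<subseteq> con en (wire W) T"
      by (rule con_subsetI[OF con_rels]) (use * in blast)
    then show "\<forall>u\<in>verts G. \<forall>v\<in>verts G. (u, v) \<in> con en (wire W) T"
      using touching_wire_con[of _ _ W] unfolding E_def by blast
  qed
  then have "T \<in> spanning_trees (wired G H) \<longleftrightarrow> T \<in> bases en (wire W) E"
    using tree unfolding spanning_trees_def bases_def by (auto simp: w)
  then show "T \<in> spanning_trees (wired G H) \<longleftrightarrow>
      T \<in> bases en (wire (verts H)) (touching en (verts H) (edges G))"
    unfolding W_def E_def .
qed

end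

section \<open>Measures on subgraphs\<close>

lemma space_subgraph_space [simp]: "space (subgraph_space G) = Pow (edges G)"
  unfolding subgraph_space_def by (rule space_measure_of) auto

lemma sets_subgraph_space:
  "sets (subgraph_space G) = sigma_sets (Pow (edges G)) ((\<lambda>e. {T \<in> Pow (edges G). e \<in> T}) ` edges G)"
  unfolding subgraph_space_def by (rule sets_measure_of) auto

lemma edge_event_sets: "{T \<in> Pow (edges G). e \<in> T} \<in> sets (subgraph_space G)"
proof (cases "e \<in> edges G")
  case True
  then show ?thesis unfolding sets_subgraph_space by (intro sigma_sets.Basic) auto
next
  case False
  then have "{T \<in> Pow (edges G). e \<in> T} = {}" by auto
  then show ?thesis by (metis sets.empty_sets)
qed

lemma superset_event_sets:
  assumes "finite S"
  shows "{T \<in> Pow (edges G). S \<subseteq> T} \<in> sets (subgraph_space G)"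
proof -
  have "{T \<in> space (subgraph_space G). \<forall>e\<in>S. e \<in> T} \<in> sets (subgraph_space G)"
    using assms edge_event_sets[of G] by (intro sets.sets_Collect_finite_All) (auto simp: Pow_def)
  moreover have "{T \<in> space (subgraph_space G). \<forall>e\<in>S. e \<in> T} = {T \<in> Pow (edges G). S \<subseteq> T}" by auto
  ultimately show ?thesis by simp
qed

lemma cylinder_event_sets:
  assumes "finite S"
  shows "{T \<in> Pow (edges G). T \<inter> S = A} \<in> sets (subgraph_space G)"
proof (cases "A \<subseteq> S")
  case True
  let ?M = "subgraph_space G"
  have "{T \<in> space ?M. e \<in> T \<longleftrightarrow> e \<in> A} \<in> sets ?M" for e
  proof (cases "e \<in> A")
    case True
    then show ?thesis using edge_event_sets[of G e] by (simp add: Pow_def)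
  next
    case False
    have "{T \<in> space ?M. \<not> e \<in> T} \<in> sets ?M"
      using edge_event_sets[of G e] by (intro sets.sets_Collect_neg) (simp add: Pow_def)
    then show ?thesis using False by simp
  qed
  then have "{T \<in> space ?M. \<forall>e\<in>S. e \<in> T \<longleftrightarrow> e \<in> A} \<in> sets ?M"
    using assms by (intro sets.sets_Collect_finite_All) auto
  moreover have "{T \<in> space ?M. \<forall>e\<in>S. e \<in> T \<longleftrightarrow> e \<in> A} = {T \<in> Pow (edges G). T \<inter> S = A}"
    using True by auto
  ultimately show ?thesis by simp
next
  case False
  then have "{T \<in> Pow (edges G). T \<inter> S = A} = {}" by auto
  then show ?thesis by (metis sets.empty_sets)
qed

lemma measurable_subgraph_spaceI:
  assumes "\<And>x. x \<in> space M \<Longrightarrow> f x \<subseteq> edges G"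
    and "\<And>e. e \<in> edges G \<Longrightarrow> {x \<in> space M. e \<in> f x} \<in> sets M"
  shows "f \<in> measurable M (subgraph_space G)"
  unfolding subgraph_space_def
proof (rule measurable_measure_of)
  fix y assume "y \<in> (\<lambda>e. {T \<in> Pow (edges G). e \<in> T}) ` edges G"
  then obtain e where e: "e \<in> edges G" and y: "y = {T \<in> Pow (edges G). e \<in> T}" by auto
  have "f -` y \<inter> space M = {x \<in> space M. e \<in> f x}" using assms(1) by (auto simp: y)
  then show "f -` y \<inter> space M \<in> sets M" using assms(2)[OF e] by simp
qed (use assms(1) in auto)

definition superset_events :: "('v, 'e) mgraph \<Rightarrow> 'e set set set" where
  "superset_events G = {{T \<in> Pow (edges G). S \<subseteq> T} | S. finite S \<and> S \<subseteq> edges G}"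

lemma superset_eventsI: "finite S \<Longrightarrow> S \<subseteq> edges G \<Longrightarrow> {T \<in> Pow (edges G). S \<subseteq> T} \<in> superset_events G"
  by (auto simp: superset_events_def)

lemma Int_stable_superset_events: "Int_stable (superset_events G)"
proof (rule Int_stableI)
  fix a b assume "a \<in> superset_events G" "b \<in> superset_events G"
  then obtain S S' where S: "finite S" "S \<subseteq> edges G" "finite S'" "S' \<subseteq> edges G"
    and ab: "a = {T \<in> Pow (edges G). S \<subseteq> T}" "b = {T \<in> Pow (edges G). S' \<subseteq> T}"
    unfolding superset_events_def by blast
  have "a \<inter> b = {T \<in> Pow (edges G). S \<union> S' \<subseteq> T}" unfolding ab by auto
  then show "a \<inter> b \<in> superset_events G" using S superset_eventsI[of "S \<union> S'" G] by simp
qed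

lemma superset_events_Pow: "superset_events G \<subseteq> Pow (Pow (edges G))"
  by (auto simp: superset_events_def)

lemma sets_subgraph_space_superset:
  "sets (subgraph_space G) = sigma_sets (Pow (edges G)) (superset_events G)"
proof
  have "(\<lambda>e. {T \<in> Pow (edges G). e \<in> T}) ` edges G \<subseteq> superset_events G"
  proof clarify
    fix e assume "e \<in> edges G"
    then show "{T \<in> Pow (edges G). e \<in> T} \<in> superset_events G"
      using superset_eventsI[of "{e}" G] by simp
  qed
  then show "sets (subgraph_space G) \<subseteq> sigma_sets (Pow (edges G)) (superset_events G)"
    unfolding sets_subgraph_space by (rule sigma_sets_mono')
  have "superset_events G \<subseteq> sets (subgraph_space G)"
    unfolding superset_events_def using superset_event_sets by blast
  then show "sigma_sets (Pow (edges G)) (superset_events G) \<subseteq> sets (subgraph_space G)"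
    using sets.sigma_sets_subset[of "superset_events G" "subgraph_space G"] by simp
qed

text \<open>The events \<open>S \<subseteq> T\<close> with finite \<open>S\<close> form a generator
  closed under intersections. Laws are compared through these inclusion probabilities throughout,
  because they are probabilities of increasing events.\<close>

lemma subgraph_measure_eqI:
  assumes "prob_space M" "prob_space N"
    and sets: "sets M = sets (subgraph_space G)" "sets N = sets (subgraph_space G)"
    and eq: "\<And>S. finite S \<Longrightarrow> S \<subseteq> edges G \<Longrightarrow>
      measure M {T \<in> Pow (edges G). S \<subseteq> T} = measure N {T \<in> Pow (edges G). S \<subseteq> T}"
  shows "M = N"
proof -
  interpret M: prob_space M by fact
  interpret N: prob_space N by fact
  show ?thesis
  proof (rule measure_eqI_generator_eq[OF Int_stable_superset_events superset_events_Pow])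
    show "emeasure M X = emeasure N X" if "X \<in> superset_events G" for X
      using that eq by (auto simp: superset_events_def M.emeasure_eq_measure N.emeasure_eq_measure)
    show "sets M = sigma_sets (Pow (edges G)) (superset_events G)"
      "sets N = sigma_sets (Pow (edges G)) (superset_events G)"
      using sets by (simp_all add: sets_subgraph_space_superset)
    show "range (\<lambda>_. Pow (edges G)) \<subseteq> superset_events G"
      using superset_eventsI[of "{}" G] by (auto simp: Pow_def)
  qed auto
qed

section \<open>Laws on infinite graphs as limits of finite laws\<close>

lemma sum_pmf_Pow:
  assumes "finite S" "set_pmf p \<subseteq> Pow S"
  shows "measure (measure_pmf p) X = (\<Sum>A\<in>Pow S \<inter> X. pmf p A)"
proof -
  have "measure (measure_pmf p) X = measure (measure_pmf p) (X \<inter> set_pmf p)"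
    by (simp add: measure_Int_set_pmf)
  also have "\<dots> = measure (measure_pmf p) (Pow S \<inter> X \<inter> set_pmf p)"
    using assms(2) by (intro arg_cong[where f = "measure (measure_pmf p)"]) auto
  also have "\<dots> = measure (measure_pmf p) (Pow S \<inter> X)"
    by (simp add: measure_Int_set_pmf)
  finally show ?thesis using assms(1) by (simp add: measure_measure_pmf_finite)
qed

text \<open>Kolmogorov extension: the limiting weights on each finite \<open>S\<close> form a
  probability because only finitely many subsets of \<open>S\<close> share the mass, and they are
  consistent because each approximating law is.\<close>

lemma limit_measure_exists:
  fixes ps :: "nat \<Rightarrow> 'e set pmf" and G :: "('v, 'e) mgraph"
  assumes conv: "\<And>S A. finite S \<Longrightarrow> S \<subseteq> edges G \<Longrightarrow> A \<subseteq> S \<Longrightarrow>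
    convergent (\<lambda>n. measure_pmf.prob (ps n) {T. T \<inter> S = A})"
  shows "\<exists>M. prob_space M \<and> sets M = sets (subgraph_space G) \<and>
    (\<forall>S A. finite S \<longrightarrow> S \<subseteq> edges G \<longrightarrow> A \<subseteq> S \<longrightarrow>
      (\<lambda>n. measure_pmf.prob (ps n) {T. T \<inter> S = A}) \<longlonglongrightarrow> measure M {T \<in> Pow (edges G). T \<inter> S = A})"
proof -
  define E where "E = edges G"
  define q where "q n S = map_pmf (\<lambda>T. T \<inter> S) (ps n)" for n S
  have pmf_q: "measure_pmf.prob (ps n) {T. T \<inter> S = A} = pmf (q n S) A" for n S A
    unfolding q_def pmf_map by (rule arg_cong[where f = "measure_pmf.prob (ps n)"]) auto
  have set_q: "set_pmf (q n S) \<subseteq> Pow S" for n S by (auto simp: q_def)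
  define w where "w S A = (if A \<subseteq> S then lim (\<lambda>n. pmf (q n S) A) else 0)" for S A
  have lim_w: "(\<lambda>n. pmf (q n S) A) \<longlonglongrightarrow> w S A" if "finite S" "S \<subseteq> E" for S A
  proof (cases "A \<subseteq> S")
    case True
    then show ?thesis using conv[of S A] that unfolding pmf_q E_def w_def
      by (simp add: convergent_LIMSEQ_iff)
  next
    case False
    then have "pmf (q n S) A = 0" for n using set_q[of n S] by (auto simp: pmf_eq_0_set_pmf)
    then show ?thesis using False by (simp add: w_def)
  qed
  have w_nonneg: "0 \<le> w S A" if "finite S" "S \<subseteq> E" for S A
    using lim_w[OF that] by (rule LIMSEQ_le_const) (auto simp: pmf_nonneg)
  have w_sum: "(\<Sum>A\<in>Pow S. w S A) = 1" if S: "finite S" "S \<subseteq> E" for S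
  proof -
    have "(\<lambda>n. \<Sum>A\<in>Pow S. pmf (q n S) A) \<longlonglongrightarrow> (\<Sum>A\<in>Pow S. w S A)"
      by (intro tendsto_sum lim_w S)
    moreover have "(\<Sum>A\<in>Pow S. pmf (q n S) A) = 1" for n
      using S set_q by (intro sum_pmf_eq_1) auto
    ultimately have "(\<lambda>n::nat. 1::real) \<longlonglongrightarrow> (\<Sum>A\<in>Pow S. w S A)" by simp
    then show ?thesis by (rule LIMSEQ_unique) simp
  qed
  have "\<exists>Q. \<forall>A. pmf Q A = w S A" if S: "finite S" "S \<subseteq> E" for S
  proof -
    have "(\<integral>\<^sup>+A. ennreal (w S A) \<partial>count_space UNIV) = (\<Sum>A\<in>Pow S. ennreal (w S A))"
      by (rule nn_integral_count_space') (use S in \<open>auto simp: w_def\<close>)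
    also have "\<dots> = 1" using w_nonneg[OF S] w_sum[OF S] by (simp add: sum_ennreal)
    finally show ?thesis using pmf_embed_pmf[of "w S"] w_nonneg[OF S] by blast
  qed
  then obtain Q where Q: "\<And>S A. finite S \<Longrightarrow> S \<subseteq> E \<Longrightarrow> pmf (Q S) A = w S A" by metis
  have set_Q: "set_pmf (Q S) \<subseteq> Pow S" if "finite S" "S \<subseteq> E" for S
    using Q[OF that] by (auto simp: set_pmf_iff w_def split: if_splits)
  have lim_Q: "(\<lambda>n. measure_pmf.prob (q n S) X) \<longlonglongrightarrow> measure_pmf.prob (Q S) X"
    if S: "finite S" "S \<subseteq> E" for S X
    unfolding sum_pmf_Pow[OF S(1) set_q] sum_pmf_Pow[OF S(1) set_Q[OF S]]
    by (intro tendsto_sum) (simp add: Q[OF S] lim_w[OF S])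
  have Q_restrict: "map_pmf (\<lambda>A. A \<inter> J) (Q S) = Q J" if J: "J \<subseteq> S" and S: "finite S" "S \<subseteq> E" for J S
  proof (rule pmf_eqI)
    fix A
    have J': "finite J" "J \<subseteq> E" using J S finite_subset by auto
    have "(\<lambda>n. measure_pmf.prob (q n S) ((\<lambda>A. A \<inter> J) -` {A})) \<longlonglongrightarrow> pmf (map_pmf (\<lambda>A. A \<inter> J) (Q S)) A"
      unfolding pmf_map by (rule lim_Q[OF S])
    moreover have "measure_pmf.prob (q n S) ((\<lambda>A. A \<inter> J) -` {A}) = pmf (q n J) A" for n
    proof -
      have "T \<inter> S \<inter> J = T \<inter> J" for T using J by auto
      then show ?thesis unfolding pmf_map[symmetric] by (simp add: q_def map_pmf_comp)
    qed
    ultimately have "(\<lambda>n. pmf (q n J) A) \<longlonglongrightarrow> pmf (map_pmf (\<lambda>A. A \<inter> J) (Q S)) A" by simp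
    then show "pmf (map_pmf (\<lambda>A. A \<inter> J) (Q S)) A = pmf (Q J) A"
      using LIMSEQ_unique lim_w[OF J'] Q[OF J'] by metis
  qed
  \<comment> \<open>Edge sets are coded as 0-1 functions with values in the reals, a Polish space as
    the extension theorem requires; the final measure decodes them by
    \<open>\<omega> e = 1\<close>.\<close>
  define ind where "ind J A = (\<lambda>e\<in>J. indicator A e :: real)" for J A :: "'e set"
  define P where "P J = distr (measure_pmf (Q J)) (PiM J (\<lambda>_. borel)) (ind J)" for J
  have ind_meas: "ind J \<in> measurable (measure_pmf p) (PiM J (\<lambda>_. borel))" for J p
    by (simp add: ind_def space_PiM measurable_def PiE_def extensional_def)
  interpret polish_projective E P
  proof (rule polish_projective.intro, rule projective_family.intro)
    fix J H assume JH: "J \<subseteq> H" "finite H" "H \<subseteq> E"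
    have r: "(\<lambda>f. restrict f J) \<in> measurable (PiM H (\<lambda>_. borel)) (PiM J (\<lambda>_. borel::real measure))"
      using JH by (intro measurable_restrict_subset)
    have "distr (P H) (PiM J (\<lambda>_. borel)) (\<lambda>f. restrict f J) =
        distr (measure_pmf (Q H)) (PiM J (\<lambda>_. borel)) ((\<lambda>f. restrict f J) \<circ> ind H)"
      unfolding P_def by (rule distr_distr[OF r ind_meas])
    also have "(\<lambda>f. restrict f J) \<circ> ind H = ind J \<circ> (\<lambda>A. A \<inter> J)"
      using JH by (auto simp: ind_def fun_eq_iff indicator_def)
    also have "distr (measure_pmf (Q H)) (PiM J (\<lambda>_. borel)) (ind J \<circ> (\<lambda>A. A \<inter> J)) =
        distr (distr (measure_pmf (Q H)) (count_space UNIV) (\<lambda>A. A \<inter> J)) (PiM J (\<lambda>_. borel)) (ind J)"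
      using ind_meas[of J "return_pmf {}"]
      by (intro distr_distr[symmetric]) (auto simp: measurable_def ind_def space_PiM PiE_def extensional_def)
    also have "distr (measure_pmf (Q H)) (count_space UNIV) (\<lambda>A. A \<inter> J) = measure_pmf (Q J)"
      using Q_restrict[OF JH] by (simp flip: map_pmf_rep_eq)
    finally show "P J = distr (P H) (PiM J (\<lambda>_. borel)) (\<lambda>f. restrict f J)"
      unfolding P_def[of J] by (rule sym)
  next
    fix J :: "'e set" assume "finite J" "J \<subseteq> E"
    show "prob_space (P J)"
      unfolding P_def by (rule measure_pmf.prob_space_distr[OF ind_meas])
  qed
  define M where "M = distr lim (subgraph_space G) (\<lambda>\<omega>. {e \<in> E. \<omega> e = 1})"
  have meas: "(\<lambda>\<omega>. {e \<in> E. \<omega> e = 1}) \<in> measurable lim (subgraph_space G)"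
  proof (rule measurable_subgraph_spaceI)
    fix e assume "e \<in> edges G"
    then have e: "e \<in> E" by (simp add: E_def)
    then have "{\<omega> \<in> space (PiM E (\<lambda>_. borel)). \<omega> e = (1::real)} \<in> sets (PiM E (\<lambda>_. borel))"
      by (intro sets_Collect_single') auto
    then show "{x \<in> space lim. e \<in> {e \<in> E. x e = 1}} \<in> sets lim"
      using e by simp
  qed (auto simp: E_def)
  have "prob_space M" unfolding M_def by (rule P.prob_space_distr[OF meas])
  moreover have "sets M = sets (subgraph_space G)" by (simp add: M_def)
  moreover have "(\<lambda>n. measure_pmf.prob (ps n) {T. T \<inter> S = A}) \<longlonglongrightarrow> measure M {T \<in> Pow (edges G). T \<inter> S = A}"
    if S: "finite S" "S \<subseteq> edges G" and A: "A \<subseteq> S" for S A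
  proof -
    have SE: "S \<subseteq> E" using S by (simp add: E_def)
    let ?X = "{\<omega> \<in> space (PiM S (\<lambda>_. borel::real measure)). \<forall>e\<in>S. \<omega> e = 1 \<longleftrightarrow> e \<in> A}"
    have X: "?X \<in> sets (PiM S (\<lambda>_. borel))"
    proof (rule sets.sets_Collect_finite_All[OF _ S(1)])
      fix e assume e: "e \<in> S"
      have "{x \<in> space borel. (x::real) = 1 \<longleftrightarrow> e \<in> A} \<in> sets borel" by (cases "e \<in> A") auto
      then show "{\<omega> \<in> space (PiM S (\<lambda>_. borel)). ((\<omega> e::real) = 1) = (e \<in> A)} \<in> sets (PiM S (\<lambda>_. borel))"
        using e by (intro sets_Collect_single')
    qed
    have "measure M {T \<in> Pow (edges G). T \<inter> S = A} =
        measure lim ((\<lambda>\<omega>. {e \<in> E. \<omega> e = 1}) -` {T \<in> Pow (edges G). T \<inter> S = A} \<inter> space lim)"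
      unfolding M_def using cylinder_event_sets[OF S(1)] by (intro measure_distr[OF meas])
    also have "(\<lambda>\<omega>. {e \<in> E. \<omega> e = 1}) -` {T \<in> Pow (edges G). T \<inter> S = A} \<inter> space lim = emb E S ?X"
      using SE A unfolding space_lim E_def[symmetric] by (auto simp: prod_emb_def space_PiM PiE_def)
    also have "measure lim (emb E S ?X) = measure (P S) ?X"
      by (rule measure_lim_emb[OF SE S(1) X])
    also have "\<dots> = measure_pmf.prob (Q S) (ind S -` ?X \<inter> space (measure_pmf (Q S)))"
      unfolding P_def by (rule measure_distr[OF ind_meas X])
    also have "ind S -` ?X \<inter> space (measure_pmf (Q S)) = (\<lambda>B. B \<inter> S) -` {A}"
      using A by (auto simp: ind_def space_PiM indicator_def split: if_splits)
    also have "measure_pmf.prob (Q S) ((\<lambda>B. B \<inter> S) -` {A}) = w S A"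
      unfolding pmf_map[symmetric] Q_restrict[OF order_refl S(1) SE] by (rule Q[OF S(1) SE])
    finally show ?thesis using lim_w[OF S(1) SE, of A] by (simp add: pmf_q)
  qed
  ultimately show ?thesis by blast
qed

section \<open>Existence and uniqueness of the wired spanning forest\<close>

lemma uavg_diff: "uavg B (\<lambda>T. f T - g T) = uavg B f - uavg B g"
  by (simp add: uavg_def sum_subtractf diff_divide_distrib)

lemma uavg_sum: "uavg B (\<lambda>T. \<Sum>a\<in>A. f a T) = (\<Sum>a\<in>A. uavg B (f a))"
  unfolding uavg_def by (subst sum.swap) (simp add: sum_divide_distrib)

lemma uavg_cmult: "uavg B (\<lambda>T. c * f T) = c * uavg B f"
  by (simp add: uavg_def sum_distrib_left[symmetric])

lemma uavg_le:
  assumes "finite B" "B \<noteq> {}" "\<And>T. T \<in> B \<Longrightarrow> f T \<le> c"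
  shows "uavg B f \<le> c"
proof -
  have "sum f B \<le> real (card B) * c" using assms(3) by (rule sum_bounded_above)
  moreover have "0 < card B" using assms by (simp add: card_gt_0_iff)
  ultimately show ?thesis by (simp add: uavg_def field_simps)
qed

lemma uavg_ge:
  assumes "finite B" "B \<noteq> {}" "\<And>T. T \<in> B \<Longrightarrow> c \<le> f T"
  shows "c \<le> uavg B f"
proof -
  have "real (card B) * c \<le> sum f B" using assms(3) by (rule sum_bounded_below)
  moreover have "0 < card B" using assms by (simp add: card_gt_0_iff)
  ultimately show ?thesis by (simp add: uavg_def field_simps)
qed

lemma prob_pmf_of_set_uavg:
  assumes "finite B" "B \<noteq> {}"
  shows "measure_pmf.prob (pmf_of_set B) {T. P T} = uavg B (\<lambda>T. of_bool (P T))"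
  using assms by (simp add: measure_pmf_of_set uavg_def of_bool_def sum.If_cases Int_def)

text \<open>The condition asks only that finite sets are captured eventually, so that it passes to
  the traces \<open>W n \<inter> C\<close> on components and to images under automorphisms.\<close>

definition exhausts :: "(nat \<Rightarrow> 'v set) \<Rightarrow> 'v set \<Rightarrow> bool" where
  "exhausts W V \<longleftrightarrow> (\<forall>n. finite (W n) \<and> W n \<subseteq> V) \<and>
     (\<forall>K. finite K \<longrightarrow> K \<subseteq> V \<longrightarrow> (\<forall>\<^sub>F n in sequentially. K \<subseteq> W n))"

lemma exhaustsI:
  assumes "\<And>n. finite (W n)" "\<And>n. W n \<subseteq> V" "incseq W" "V \<subseteq> (\<Union>n. W n)"
  shows "exhausts W V"
  unfolding exhausts_def
proof (intro conjI allI impI)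
  fix K assume "finite K" "K \<subseteq> V"
  then show "\<forall>\<^sub>F n in sequentially. K \<subseteq> W n"
  proof (induction K rule: finite_induct)
    case (insert x K)
    then obtain m where "x \<in> W m" using assms(4) by blast
    then have "\<forall>\<^sub>F n in sequentially. x \<in> W n"
      using assms(3) by (intro eventually_sequentiallyI[of m]) (auto simp: incseq_def)
    moreover have "\<forall>\<^sub>F n in sequentially. K \<subseteq> W n" using insert by simp
    ultimately show ?case by eventually_elim simp
  qed simp
qed (use assms in auto)

lemma con_wire_empty: "(u, v) \<in> con en (wire W) {} \<longleftrightarrow> u = v \<or> (u \<notin> W \<and> v \<notin> W)"
proof
  assume "(u, v) \<in> con en (wire W) {}"
  then have "(if u \<in> W then Some u else None) = (if v \<in> W then Some v else None)"
    by (rule con_invariant) (auto simp: wire_def)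
  then show "u = v \<or> (u \<notin> W \<and> v \<notin> W)" by (auto split: if_splits)
next
  assume "u = v \<or> (u \<notin> W \<and> v \<notin> W)"
  then show "(u, v) \<in> con en (wire W) {}" by (auto simp: wire_def intro: con_rel)
qed

lemma mono_of_bool: "(\<And>X Y. X \<subseteq> Y \<Longrightarrow> P X \<Longrightarrow> P Y) \<Longrightarrow> mono (\<lambda>T. of_bool (P T) :: real)"
  by (rule monoI) (simp add: of_bool_def)

section \<open>Monotone convergence of wired spanning trees\<close>

context locally_finite_graph
begin

definition ust :: "'v set \<Rightarrow> ('e set \<Rightarrow> real) \<Rightarrow> real" where
  "ust W h = uavg (bases en (wire W) (touching en W (edges G))) h"

lemma bases_finite_touching: "finite W \<Longrightarrow> finite (bases en R (touching en W (edges G)))"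
  by (intro finite_bases finite_touching)

lemma bases_nonempty_touching: "finite W \<Longrightarrow> bases en R (touching en W (edges G)) \<noteq> {}"
  by (intro bases_nonempty finite_touching)

lemma prob_WSF_finite:
  assumes "finite (verts H)"
  shows "measure_pmf.prob (WSF_finite G H) {T. P T} = ust (verts H) (\<lambda>T. of_bool (P T))"
  unfolding WSF_finite_def UST_def spanning_trees_wired ust_def
  by (intro prob_pmf_of_set_uavg bases_finite_touching bases_nonempty_touching assms)

text \<open>A smaller \<open>W\<close> means more wiring. Edges that touch \<open>W'\<close> but
  miss \<open>W\<close> are loops for the larger wiring, so both trees are bases of the same edge
  set and only the relations have to be compared.\<close>

lemma ust_mono:
  assumes fin: "finite W'" and W: "W \<subseteq> W'" and h: "mono h"
  shows "ust W h \<le> ust W' h"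
proof -
  let ?E = "touching en W (edges G)" and ?E' = "touching en W' (edges G)"
  \<comment> \<open>Off \<open>verts G\<close> the relation \<open>wire W\<close> may glue points
    that no edge connects. Its restriction to \<open>verts G\<close> has the same effect on edges
    and is admissible for \<open>uavg_bases_mono\<close>.\<close>
  let ?R = "wire W' \<union> wire W \<inter> verts G \<times> verts G"
  have E': "?E' \<subseteq> edges G" by (rule touching_subset)
  have "bases en (wire W) ?E' = bases en (wire W) ?E"
  proof (rule bases_remove_loops)
    show "?E \<subseteq> ?E'" using W by (auto simp: touching_def)
    fix e assume "e \<in> ?E' - ?E"
    then have "en e \<times> en e \<subseteq> wire W" by (auto simp: touching_def wire_def)
    then show "en e \<times> en e \<subseteq> con en (wire W) {}" using con_rels[of "wire W" en "{}"] by blast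
  qed
  moreover have "bases en (wire W) ?E' = bases en ?R ?E'"
  proof (rule bases_restrict)
    show "en e \<subseteq> verts G" if "e \<in> ?E'" for e using that E' edge_ends by blast
    have "con en ?R {} \<subseteq> con en (wire W) {}"
      by (rule con_mono) (use W in \<open>auto simp: wire_def\<close>)
    moreover have "(u, v) \<in> con en ?R {}" if "(u, v) \<in> con en (wire W) {}" "u \<in> verts G" "v \<in> verts G" for u v
    proof -
      have "u = v \<or> (u, v) \<in> ?R" using that unfolding con_wire_empty by (auto simp: wire_def)
      then show ?thesis using con_rel[of u v ?R en "{}"] by auto
    qed
    ultimately show "con en (wire W) {} \<inter> verts G \<times> verts G = con en ?R {} \<inter> verts G \<times> verts G"
      by blast
  qed
  moreover have "uavg (bases en ?R ?E') h \<le> uavg (bases en (wire W') ?E') h"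
  proof (rule uavg_bases_mono)
    show "finite ?E'" using fin by (rule finite_touching)
    show "two_ended en ?E'" using two_ended E' by (rule two_ended_subset)
    show "?R \<subseteq> con en (wire W') ?E'"
      using touching_wire_con[of _ _ W'] con_rels[of "wire W'" en ?E'] by blast
    show "h X \<le> h Y" if "X \<subseteq> Y" for X Y using h that by (rule monoD)
  qed auto
  ultimately show ?thesis by (simp add: ust_def)
qed

text \<open>For bounded increasing \<open>h\<close> this is the common limit along all exhausting
  sequences; it is a supremum because less wiring increases the average.\<close>

definition wsf_val :: "('e set \<Rightarrow> real) \<Rightarrow> real" where
  "wsf_val h = (SUP W\<in>{W. finite W \<and> W \<subseteq> verts G}. ust W h)"

text \<open>A finite \<open>K\<close> that nearly attains the supremum is eventually contained in
  \<open>W n\<close>, and monotonicity does the rest. The limit is thereby independent of the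
  sequence.\<close>

lemma ust_tendsto_wsf_val:
  assumes ex: "exhausts W (verts G)" and h: "mono h" and bd: "\<And>T. h T \<le> c"
  shows "(\<lambda>n. ust (W n) h) \<longlonglongrightarrow> wsf_val h"
proof (rule order_tendstoI)
  let ?F = "{W. finite W \<and> W \<subseteq> verts G}"
  have bdd: "bdd_above ((\<lambda>W. ust W h) ` ?F)"
    unfolding ust_def using bd bases_finite_touching bases_nonempty_touching
    by (auto intro!: bdd_aboveI2[of _ _ c] uavg_le)
  have up: "ust (W n) h \<le> wsf_val h" for n
    unfolding wsf_val_def using ex by (intro cSUP_upper[OF _ bdd]) (auto simp: exhausts_def)
  show "\<forall>\<^sub>F n in sequentially. ust (W n) h < a" if "wsf_val h < a" for a
    using up that by (intro always_eventually allI) (rule le_less_trans)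
  show "\<forall>\<^sub>F n in sequentially. a < ust (W n) h" if "a < wsf_val h" for a
  proof -
    have "{} \<in> ?F" by simp
    then have "?F \<noteq> {}" by blast
    from that have "\<exists>K\<in>?F. a < ust K h"
      unfolding wsf_val_def less_cSUP_iff[OF \<open>?F \<noteq> {}\<close> bdd] .
    then obtain K where K: "K \<in> ?F" "a < ust K h" by (elim bexE)
    then have "\<forall>\<^sub>F n in sequentially. K \<subseteq> W n" using ex by (auto simp: exhausts_def)
    then show ?thesis
    proof eventually_elim
      case (elim n)
      have "ust K h \<le> ust (W n) h"
        using elim ex h by (intro ust_mono) (auto simp: exhausts_def)
      then show ?case using K by simp
    qed
  qed
qed

text \<open>A cylinder event is the difference of two increasing events.\<close>

lemma ust_cylinder_tendsto:
  assumes ex: "exhausts W (verts G)" and A: "A \<subseteq> S"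
  shows "(\<lambda>n. ust (W n) (\<lambda>T. of_bool (T \<inter> S = A))) \<longlonglongrightarrow>
    wsf_val (\<lambda>T. of_bool (A \<subseteq> T)) - wsf_val (\<lambda>T. of_bool (A \<subseteq> T \<and> T \<inter> S \<noteq> A))"
proof -
  have eq: "(\<lambda>T. of_bool (T \<inter> S = A) :: real) = (\<lambda>T. of_bool (A \<subseteq> T) - of_bool (A \<subseteq> T \<and> T \<inter> S \<noteq> A))"
    using A by (auto simp: fun_eq_iff)
  have "mono (\<lambda>T. of_bool (A \<subseteq> T) :: real)" "mono (\<lambda>T. of_bool (A \<subseteq> T \<and> T \<inter> S \<noteq> A) :: real)"
    using A by (auto intro!: mono_of_bool)
  then have "(\<lambda>n. ust (W n) (\<lambda>T. of_bool (A \<subseteq> T))) \<longlonglongrightarrow> wsf_val (\<lambda>T. of_bool (A \<subseteq> T))"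
    "(\<lambda>n. ust (W n) (\<lambda>T. of_bool (A \<subseteq> T \<and> T \<inter> S \<noteq> A))) \<longlonglongrightarrow> wsf_val (\<lambda>T. of_bool (A \<subseteq> T \<and> T \<inter> S \<noteq> A))"
    by (auto intro!: ust_tendsto_wsf_val[OF ex, where c = 1])
  then show ?thesis
    unfolding eq ust_def uavg_diff by (rule tendsto_diff[unfolded ust_def])
qed

lemma induced_exhaustion_exhausts:
  assumes "induced_exhaustion G Gs"
  shows "exhausts (\<lambda>n. verts (Gs n)) (verts G)"
proof (rule exhaustsI)
  show "incseq (\<lambda>n. verts (Gs n))"
    using assms by (intro incseq_SucI) (simp add: induced_exhaustion_def exhaustion_def subgraph_def)
qed (use assms in \<open>auto simp: induced_exhaustion_def exhaustion_def subgraph_def finite_graph_def\<close>)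

section \<open>Balls and the existence of exhaustions\<close>

fun graph_ball :: "'v \<Rightarrow> nat \<Rightarrow> 'v set" where
  "graph_ball o' 0 = {o'}"
| "graph_ball o' (Suc n) = graph_ball o' n \<union> (\<Union>e\<in>touching en (graph_ball o' n) (edges G). en e)"

lemma finite_ends: "e \<in> edges G \<Longrightarrow> finite (en e)"
  using two_ended unfolding two_ended_def by fastforce

lemma finite_graph_ball: "finite (graph_ball o' n)"
proof (induction n)
  case (Suc n)
  have "finite (\<Union>e\<in>touching en (graph_ball o' n) (edges G). en e)"
    using finite_touching[OF Suc] finite_ends touching_subset[of en _ "edges G"] by blast
  then show ?case using Suc by simp
qed simp

lemma graph_ball_verts: "o' \<in> verts G \<Longrightarrow> graph_ball o' n \<subseteq> verts G"
proof (induction n)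
  case (Suc n)
  then show ?case using edge_ends touching_subset[of en _ "edges G"] by fastforce
qed simp

lemma graph_ball_connected:
  "v \<in> graph_ball o' n \<Longrightarrow> (o', v) \<in> con en {} {e \<in> edges G. en e \<subseteq> graph_ball o' n}"
proof (induction n arbitrary: v)
  case (Suc n)
  let ?E = "\<lambda>n. {e \<in> edges G. en e \<subseteq> graph_ball o' n}"
  have mono: "con en {} (?E n) \<subseteq> con en {} (?E (Suc n))" by (rule con_mono) auto
  show ?case
  proof (cases "v \<in> graph_ball o' n")
    case True
    then show ?thesis using Suc.IH mono by blast
  next
    case False
    then obtain e where e: "e \<in> touching en (graph_ball o' n) (edges G)" "v \<in> en e"
      using Suc.prems by auto
    then obtain u where u: "u \<in> en e" "u \<in> graph_ball o' n" by (auto simp: touching_def)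
    have "e \<in> ?E (Suc n)" using e by (auto simp: touching_def)
    then have "(u, v) \<in> con en {} (?E (Suc n))" using u(1) e(2) by (rule con_edge)
    moreover have "(o', u) \<in> con en {} (?E (Suc n))" using Suc.IH[OF u(2)] mono by blast
    ultimately show ?thesis by (rule con_trans[rotated])
  qed
qed simp

lemma graph_ball_exhausts:
  assumes "o' \<in> verts G"
  shows "exhausts (graph_ball o') (verts G)"
proof (rule exhaustsI)
  show inc: "incseq (graph_ball o')" by (intro incseq_SucI) simp
  show "verts G \<subseteq> (\<Union>n. graph_ball o' n)"
  proof
    fix v assume "v \<in> verts G"
    with assms have "(o', v) \<in> con en {} (edges G)" by (rule verts_con)
    then have "(o' \<in> (\<Union>n. graph_ball o' n)) = (v \<in> (\<Union>n. graph_ball o' n))"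
    proof (rule con_invariant)
      have *: "y \<in> (\<Union>n. graph_ball o' n)"
        if e: "e \<in> edges G" "x \<in> en e" "y \<in> en e" and x: "x \<in> (\<Union>n. graph_ball o' n)" for e x y
      proof -
        from x obtain n where "x \<in> graph_ball o' n" by blast
        then have "y \<in> graph_ball o' (Suc n)" using e by (auto simp: touching_def)
        then show ?thesis by blast
      qed
      show "(x \<in> (\<Union>n. graph_ball o' n)) = (y \<in> (\<Union>n. graph_ball o' n))"
        if "e \<in> edges G" "x \<in> en e" "y \<in> en e" for e x y
        using *[OF that] *[OF that(1,3,2)] by blast
    qed simp
    moreover have "o' \<in> graph_ball o' 0" by simp
    ultimately show "v \<in> (\<Union>n. graph_ball o' n)" by blast
  qed
qed (use assms finite_graph_ball graph_ball_verts in auto)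

text \<open>Without an induced exhaustion the limit condition in \<open>is_WSF\<close> would be
  vacuous and could not single out a measure. Balls are connected, finite by local finiteness, and
  cover the graph.\<close>

lemma induced_exhaustion_exists: "\<exists>Gs. induced_exhaustion G Gs"
proof -
  obtain o' where o': "o' \<in> verts G" using connected by (auto simp: connected_graph_def)
  let ?B = "graph_ball o'"
  define Gs where "Gs n = induced_subgraph G (?B n)" for n
  have Gs: "verts (Gs n) = ?B n" "edges (Gs n) = {e \<in> edges G. en e \<subseteq> ?B n}" "ends (Gs n) = en" for n
    by (simp_all add: Gs_def induced_subgraph_def)
  have fin: "finite {e \<in> edges G. en e \<subseteq> ?B n}" for n
  proof (rule finite_subset)
    show "{e \<in> edges G. en e \<subseteq> ?B n} \<subseteq> touching en (?B n) (edges G)"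
      using two_ended by (fastforce simp: touching_def two_ended_def)
  qed (intro finite_touching finite_graph_ball)
  have "connected_graph (Gs n)" for n
  proof -
    have two: "two_ended (ends (Gs n)) (edges (Gs n))"
      unfolding Gs by (rule two_ended_subset[OF two_ended]) auto
    have "o' \<in> ?B n" by (induction n) auto
    moreover have "(u, v) \<in> con en {} {e \<in> edges G. en e \<subseteq> ?B n}" if "u \<in> ?B n" "v \<in> ?B n" for u v
      by (rule con_trans[OF con_sym[OF graph_ball_connected[OF that(1)]] graph_ball_connected[OF that(2)]])
    ultimately show ?thesis
      unfolding connected_graph_def adj_rtrancl[OF two] Gs by auto
  qed
  moreover have "(\<Union>n. ?B n) = verts G"
    using graph_ball_exhausts[OF o'] unfolding exhausts_def
  proof (intro equalityI subsetI)
    fix v assume ex: "(\<forall>n. finite (?B n) \<and> ?B n \<subseteq> verts G) \<and> (\<forall>K. finite K \<longrightarrow> K \<subseteq> verts G \<longrightarrow> (\<forall>\<^sub>F n in sequentially. K \<subseteq> ?B n))"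
      and "v \<in> verts G"
    then have "\<forall>\<^sub>F n in sequentially. {v} \<subseteq> ?B n" by blast
    then show "v \<in> (\<Union>n. ?B n)" by (auto simp: eventually_sequentially)
  qed auto
  moreover have "(\<Union>n. {e \<in> edges G. en e \<subseteq> ?B n}) = edges G"
  proof (intro equalityI subsetI)
    fix e assume e: "e \<in> edges G"
    then have "\<forall>\<^sub>F n in sequentially. en e \<subseteq> ?B n"
      using graph_ball_exhausts[OF o'] finite_ends edge_ends by (auto simp: exhausts_def)
    then show "e \<in> (\<Union>n. {e \<in> edges G. en e \<subseteq> ?B n})" using e by (auto simp: eventually_sequentially)
  qed auto
  moreover have "?B n \<subseteq> ?B (Suc n)" for n by simp
  ultimately have "exhaustion G Gs"
    unfolding exhaustion_def subgraph_def finite_graph_def Gs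
    using fin finite_graph_ball graph_ball_verts[OF o'] by (auto simp del: graph_ball.simps; blast)
  moreover have "Gs n = induced_subgraph G (verts (Gs n))" for n by (simp add: Gs_def induced_subgraph_def)
  ultimately show ?thesis unfolding induced_exhaustion_def by blast
qed

section \<open>The limit law and convergence of local averages\<close>

lemma is_WSF_unique:
  assumes "is_WSF G M" "is_WSF G N"
  shows "M = N"
proof (rule subgraph_measure_eqI)
  obtain Gs where Gs: "induced_exhaustion G Gs" using induced_exhaustion_exists by blast
  fix S assume S: "finite S" "S \<subseteq> edges G"
  define H where "H = G\<lparr>verts := \<Union>e\<in>S. en e, edges := S\<rparr>"
  have H: "subgraph H G" "finite_graph H" "edges H = S"
    using S edge_ends finite_ends by (auto simp: H_def subgraph_def finite_graph_def)
  have ev: "{T \<in> Pow (edges G). S \<subseteq> T} = {T \<in> Pow (edges G). T \<inter> S = S}" by auto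
  have "(\<lambda>n. measure_pmf.prob (WSF_finite G (Gs n)) {T. T \<inter> S = S}) \<longlonglongrightarrow> measure M' {T \<in> Pow (edges G). S \<subseteq> T}"
    if "is_WSF G M'" for M'
    using that Gs H unfolding is_WSF_def ev by auto
  from this[OF assms(1)] this[OF assms(2)]
  show "measure M {T \<in> Pow (edges G). S \<subseteq> T} = measure N {T \<in> Pow (edges G). S \<subseteq> T}"
    by (rule LIMSEQ_unique)
qed (use assms in \<open>auto simp: is_WSF_def\<close>)

text \<open>One exhaustion produces the measure; all others give the same limits, since each limit
  is the same difference of two values of \<open>wsf_val\<close>.\<close>

lemma is_WSF_WSF: "is_WSF G (WSF G)"
proof -
  obtain Gs where Gs: "induced_exhaustion G Gs" using induced_exhaustion_exists by blast
  have lim: "(\<lambda>n. measure_pmf.prob (WSF_finite G (Gs n)) {T. T \<inter> S = A}) \<longlonglongrightarrow>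
      wsf_val (\<lambda>T. of_bool (A \<subseteq> T)) - wsf_val (\<lambda>T. of_bool (A \<subseteq> T \<and> T \<inter> S \<noteq> A))"
    if Gs: "induced_exhaustion G Gs" and A: "A \<subseteq> S" for Gs S A
  proof -
    have ex: "exhausts (\<lambda>n. verts (Gs n)) (verts G)" by (rule induced_exhaustion_exhausts[OF Gs])
    then have "finite (verts (Gs n))" for n by (auto simp: exhausts_def)
    then show ?thesis using ust_cylinder_tendsto[OF ex A] by (simp add: prob_WSF_finite)
  qed
  have "convergent (\<lambda>n. measure_pmf.prob (WSF_finite G (Gs n)) {T. T \<inter> S = A})" if "A \<subseteq> S" for S A
    using lim[OF Gs that] by (rule convergentI)
  from limit_measure_exists[of G "\<lambda>n. WSF_finite G (Gs n)", OF this]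
  obtain M where M: "prob_space M" "sets M = sets (subgraph_space G)"
    "\<And>S A. finite S \<Longrightarrow> S \<subseteq> edges G \<Longrightarrow> A \<subseteq> S \<Longrightarrow>
      (\<lambda>n. measure_pmf.prob (WSF_finite G (Gs n)) {T. T \<inter> S = A}) \<longlonglongrightarrow> measure M {T \<in> Pow (edges G). T \<inter> S = A}"
    by blast
  have sp: "space M = Pow (edges G)" using sets_eq_imp_space_eq[OF M(2)] by simp
  have "is_WSF G M"
    unfolding is_WSF_def
  proof (intro conjI allI impI)
    fix Gs' H A assume *: "induced_exhaustion G Gs'" "subgraph H G" "finite_graph H" "A \<subseteq> edges H"
    have "finite (edges H)" "edges H \<subseteq> edges G" using * by (auto simp: finite_graph_def subgraph_def)
    then have "measure M {T \<in> Pow (edges G). T \<inter> edges H = A} =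
        wsf_val (\<lambda>T. of_bool (A \<subseteq> T)) - wsf_val (\<lambda>T. of_bool (A \<subseteq> T \<and> T \<inter> edges H \<noteq> A))"
      by (intro LIMSEQ_unique[OF M(3) lim[OF Gs]] *(4))
    then show "(\<lambda>n. measure_pmf.prob (WSF_finite G (Gs' n)) {T. T \<inter> edges H = A}) \<longlonglongrightarrow>
        measure M {T \<in> space M. T \<inter> edges H = A}"
      using lim[OF *(1,4)] by (simp add: sp)
  qed (use M sp in auto)
  then show ?thesis unfolding WSF_def
    by (rule theI) (rule is_WSF_unique[OF _ \<open>is_WSF G M\<close>])
qed

lemma prob_space_WSF: "prob_space (WSF G)"
  and space_WSF [simp]: "space (WSF G) = Pow (edges G)"
  and sets_WSF [simp]: "sets (WSF G) = sets (subgraph_space G)"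
  using is_WSF_WSF by (auto simp: is_WSF_def)

text \<open>Frees the limit from the connected induced subgraphs of the definition, which traces on
  components and translated balls need not be.\<close>

lemma measure_WSF_cylinder:
  assumes "exhausts W (verts G)" "finite S" "S \<subseteq> edges G" "A \<subseteq> S"
  shows "(\<lambda>n. ust (W n) (\<lambda>T. of_bool (T \<inter> S = A))) \<longlonglongrightarrow> measure (WSF G) {T \<in> Pow (edges G). T \<inter> S = A}"
proof -
  obtain Gs where Gs: "induced_exhaustion G Gs" using induced_exhaustion_exists by blast
  define H where "H = G\<lparr>verts := \<Union>e\<in>S. en e, edges := S\<rparr>"
  have H: "subgraph H G" "finite_graph H" "edges H = S"
    using assms edge_ends finite_ends by (auto simp: H_def subgraph_def finite_graph_def)
  have l1: "(\<lambda>n. measure_pmf.prob (WSF_finite G (Gs n)) {T. T \<inter> S = A}) \<longlonglongrightarrow>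
      measure (WSF G) {T \<in> Pow (edges G). T \<inter> S = A}"
    using is_WSF_WSF Gs H assms(4) unfolding is_WSF_def by auto
  have ex: "exhausts (\<lambda>n. verts (Gs n)) (verts G)" by (rule induced_exhaustion_exhausts[OF Gs])
  then have "finite (verts (Gs n))" for n by (auto simp: exhausts_def)
  then have l2: "(\<lambda>n. measure_pmf.prob (WSF_finite G (Gs n)) {T. T \<inter> S = A}) \<longlonglongrightarrow>
      wsf_val (\<lambda>T. of_bool (A \<subseteq> T)) - wsf_val (\<lambda>T. of_bool (A \<subseteq> T \<and> T \<inter> S \<noteq> A))"
    using ust_cylinder_tendsto[OF ex assms(4)] by (simp add: prob_WSF_finite)
  note LIMSEQ_unique[OF l1 l2]
  then show ?thesis using ust_cylinder_tendsto[OF assms(1,4)] by simp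
qed

text \<open>A function of finitely many edges is a finite combination of indicators of cylinders, so
  the restriction to increasing functions disappears here.\<close>

lemma integral_WSF_local:
  assumes "exhausts W (verts G)" and S: "finite S" "S \<subseteq> edges G"
  shows "(\<lambda>n. ust (W n) (\<lambda>T. h (T \<inter> S))) \<longlonglongrightarrow> (\<integral>T. h (T \<inter> S) \<partial>WSF G)"
proof -
  interpret prob_space "WSF G" by (rule prob_space_WSF)
  have dec: "h (T \<inter> S) = (\<Sum>A\<in>Pow S. h A * of_bool (T \<inter> S = A))" for T
  proof -
    have "(\<Sum>A\<in>Pow S. h A * of_bool (T \<inter> S = A)) = (\<Sum>A\<in>Pow S. if A = T \<inter> S then h A else 0)"
      by (intro sum.cong) auto
    then show ?thesis using S by (simp add: sum.delta)
  qed
  have "(\<lambda>n. \<Sum>A\<in>Pow S. h A * ust (W n) (\<lambda>T. of_bool (T \<inter> S = A))) \<longlonglongrightarrow>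
      (\<Sum>A\<in>Pow S. h A * measure (WSF G) {T \<in> Pow (edges G). T \<inter> S = A})"
    by (intro tendsto_sum tendsto_mult tendsto_const measure_WSF_cylinder assms) auto
  moreover have "ust (W n) (\<lambda>T. h (T \<inter> S)) = (\<Sum>A\<in>Pow S. h A * ust (W n) (\<lambda>T. of_bool (T \<inter> S = A)))" for n
    unfolding ust_def by (subst dec) (simp only: uavg_sum uavg_cmult)
  moreover have "(\<integral>T. h (T \<inter> S) \<partial>WSF G) = (\<Sum>A\<in>Pow S. h A * measure (WSF G) {T \<in> Pow (edges G). T \<inter> S = A})"
  proof -
    define C where "C A = {T \<in> Pow (edges G). T \<inter> S = A}" for A
    have C: "C A \<in> sets (WSF G)" for A using cylinder_event_sets[OF S(1), of G A] by (simp add: C_def)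
    have "(\<integral>T. h (T \<inter> S) \<partial>WSF G) = (\<integral>T. (\<Sum>A\<in>Pow S. h A * indicator (C A) T) \<partial>WSF G)"
      by (rule Bochner_Integration.integral_cong[OF refl], subst dec)
        (auto intro!: sum.cong simp: indicator_def C_def)
    also have "\<dots> = (\<Sum>A\<in>Pow S. \<integral>T. h A * indicator (C A) T \<partial>WSF G)"
      by (intro Bochner_Integration.integral_sum integrable_mult_right integrable_real_indicator C)
        (simp add: less_top[symmetric])
    also have "\<dots> = (\<Sum>A\<in>Pow S. h A * measure (WSF G) (C A))"
      using sets.sets_into_space[OF C] by (intro sum.cong refl) (simp add: Int_absorb2)
    finally show ?thesis by (simp add: C_def)
  qed
  ultimately show ?thesis by simp
qed

end

section \<open>Forests of the components\<close>

definition separated :: "('e \<Rightarrow> 'v set) \<Rightarrow> 'v rel \<Rightarrow> 'v set \<Rightarrow> 'e set \<Rightarrow> 'e set \<Rightarrow> bool" where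
  "separated en R X E F \<longleftrightarrow> (\<forall>e\<in>E. en e \<subseteq> X) \<and> (\<forall>e\<in>F. en e \<inter> X = {}) \<and>
     (\<forall>(x, y)\<in>R. x \<in> X \<longleftrightarrow> y \<in> X)"

lemma separated_sym: "separated en R X E F \<Longrightarrow> separated en R (- X) F E"
  by (auto simp: separated_def)

lemma separated_con:
  assumes sep: "separated en R X E F" and u: "u \<in> X" and v: "v \<in> X"
  shows "(u, v) \<in> con en R (E \<union> F) \<longleftrightarrow> (u, v) \<in> con en R E"
proof
  assume "(u, v) \<in> con en R (E \<union> F)"
  then have "(u \<in> X \<and> (u, u) \<in> con en R E) = (v \<in> X \<and> (u, v) \<in> con en R E)"
  proof (rule con_invariant[where h = "\<lambda>x. x \<in> X \<and> (u, x) \<in> con en R E"])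
    have *: "(u, y) \<in> con en R E" if "(x, y) \<in> con en R E" "(u, x) \<in> con en R E" for x y
      by (rule con_trans[OF that(2,1)])
    show "(x \<in> X \<and> (u, x) \<in> con en R E) = (y \<in> X \<and> (u, y) \<in> con en R E)" if "(x, y) \<in> R" for x y
      using sep that *[OF con_rel[of x y R en E, OF that]] *[OF con_sym[OF con_rel[of x y R en E, OF that]]]
      unfolding separated_def by blast
    show "(x \<in> X \<and> (u, x) \<in> con en R E) = (y \<in> X \<and> (u, y) \<in> con en R E)"
      if e: "e \<in> E \<union> F" "x \<in> en e" "y \<in> en e" for e x y
    proof (cases "e \<in> E")
      case True
      have "(x, y) \<in> con en R E" "(y, x) \<in> con en R E"
        using con_edge[of e E x en y R] con_edge[of e E y en x R] True e by auto
      then show ?thesis using * e True sep unfolding separated_def by blast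
    next
      case False
      then show ?thesis using e sep unfolding separated_def by blast
    qed
  qed
  then show "(u, v) \<in> con en R E" using u by simp
next
  assume "(u, v) \<in> con en R E"
  then show "(u, v) \<in> con en R (E \<union> F)" using con_mono[of R R E "E \<union> F" en] by blast
qed

lemma separated_subset:
  "separated en R X E F \<Longrightarrow> E' \<subseteq> E \<Longrightarrow> F' \<subseteq> F \<Longrightarrow> separated en R X E' F'"
  unfolding separated_def by blast

lemma bases_separated:
  assumes sep: "separated en R X E F" and "E \<inter> F = {}" and S: "S \<subseteq> E" and T: "T \<subseteq> F"
  shows "S \<union> T \<in> bases en R (E \<union> F) \<longleftrightarrow> S \<in> bases en R E \<and> T \<in> bases en R F"
proof -
  have 1: "en e \<times> en e \<subseteq> con en R (S' \<union> T') \<longleftrightarrow> en e \<times> en e \<subseteq> con en R S'"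
    if "e \<in> E" "S' \<subseteq> E" "T' \<subseteq> F" for e S' T'
    using separated_con[OF separated_subset[OF sep that(2,3)]] sep that(1)
    unfolding separated_def by blast
  have 2: "en e \<times> en e \<subseteq> con en R (S' \<union> T') \<longleftrightarrow> en e \<times> en e \<subseteq> con en R T'"
    if "e \<in> F" "S' \<subseteq> E" "T' \<subseteq> F" for e S' T'
  proof -
    have "en e \<subseteq> - X" using sep that(1) unfolding separated_def by blast
    then show ?thesis
      using separated_con[OF separated_sym[OF separated_subset[OF sep that(2,3)]]]
      unfolding Un_commute[of S' T'] by blast
  qed
  have d1: "S \<union> T - {f} = (S - {f}) \<union> T" if "f \<in> S" for f using that assms by auto
  have d2: "S \<union> T - {f} = S \<union> (T - {f})" if "f \<in> T" for f using that assms by auto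
  have a: "(\<forall>e\<in>E \<union> F. en e \<times> en e \<subseteq> con en R (S \<union> T)) \<longleftrightarrow>
      (\<forall>e\<in>E. en e \<times> en e \<subseteq> con en R S) \<and> (\<forall>e\<in>F. en e \<times> en e \<subseteq> con en R T)"
    by (simp add: ball_Un 1[OF _ S T] 2[OF _ S T])
  have b1: "(\<not> en f \<times> en f \<subseteq> con en R (S \<union> T - {f})) = (\<not> en f \<times> en f \<subseteq> con en R (S - {f}))"
    if "f \<in> S" for f
    unfolding d1[OF that] by (subst 1) (use that S T in auto)
  have b2: "(\<not> en f \<times> en f \<subseteq> con en R (S \<union> T - {f})) = (\<not> en f \<times> en f \<subseteq> con en R (T - {f}))"
    if "f \<in> T" for f
    unfolding d2[OF that] by (subst 2) (use that S T in auto)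
  have b: "(\<forall>f\<in>S \<union> T. \<not> en f \<times> en f \<subseteq> con en R (S \<union> T - {f})) \<longleftrightarrow>
      (\<forall>f\<in>S. \<not> en f \<times> en f \<subseteq> con en R (S - {f})) \<and> (\<forall>f\<in>T. \<not> en f \<times> en f \<subseteq> con en R (T - {f}))"
    using b1 b2 by (simp add: ball_Un)
  have sub: "S \<union> T \<subseteq> E \<union> F" using S T by blast
  show ?thesis
    unfolding bases_def mem_Collect_eq a b by (simp only: S T sub simp_thms conj_ac)
qed

text \<open>A basis of the union is a free choice of one basis on each side, so the uniform law is a
  product law.\<close>

lemma uavg_separated:
  assumes sep: "separated en R X E F" and "E \<inter> F = {}" and "S \<subseteq> E" and "S' \<subseteq> F"
  shows "uavg (bases en R (E \<union> F)) (\<lambda>T. of_bool (S \<union> S' \<subseteq> T)) =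
    uavg (bases en R E) (\<lambda>T. of_bool (S \<subseteq> T)) * uavg (bases en R F) (\<lambda>T. of_bool (S' \<subseteq> T))"
proof -
  have bij: "bij_betw (\<lambda>(A, B). A \<union> B) (bases en R E \<times> bases en R F) (bases en R (E \<union> F))"
  proof (rule bij_betwI[where g = "\<lambda>T. (T \<inter> E, T \<inter> F)"])
    show "(\<lambda>(A, B). A \<union> B) \<in> bases en R E \<times> bases en R F \<rightarrow> bases en R (E \<union> F)"
    proof
      fix p assume "p \<in> bases en R E \<times> bases en R F"
      then obtain A B where p: "p = (A, B)" and AB: "A \<in> bases en R E" "B \<in> bases en R F" by auto
      have "A \<union> B \<in> bases en R (E \<union> F)"
        using bases_separated[OF sep assms(2) bases_subset[OF AB(1)] bases_subset[OF AB(2)]] AB by simp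
      then show "(case p of (A, B) \<Rightarrow> A \<union> B) \<in> bases en R (E \<union> F)" by (simp add: p)
    qed
    show "(\<lambda>T. (T \<inter> E, T \<inter> F)) \<in> bases en R (E \<union> F) \<rightarrow> bases en R E \<times> bases en R F"
    proof
      fix T assume T: "T \<in> bases en R (E \<union> F)"
      have "T \<inter> E \<union> T \<inter> F = T" using bases_subset[OF T] by blast
      then show "(T \<inter> E, T \<inter> F) \<in> bases en R E \<times> bases en R F"
        using bases_separated[OF sep assms(2), of "T \<inter> E" "T \<inter> F"] T by auto
    qed
    show "((case p of (A, B) \<Rightarrow> A \<union> B) \<inter> E, (case p of (A, B) \<Rightarrow> A \<union> B) \<inter> F) = p"
      if "p \<in> bases en R E \<times> bases en R F" for p
    proof -
      obtain A B where p: "p = (A, B)" by (cases p)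
      have "A \<subseteq> E" "B \<subseteq> F" using that p bases_subset[of A en R E] bases_subset[of B en R F] by auto
      then show ?thesis using assms(2) p by auto
    qed
    show "(case (T \<inter> E, T \<inter> F) of (A, B) \<Rightarrow> A \<union> B) = T" if "T \<in> bases en R (E \<union> F)" for T
      using bases_subset[OF that] by auto
  qed
  have "sum (\<lambda>T. of_bool (S \<union> S' \<subseteq> T) :: real) (bases en R (E \<union> F)) =
      (\<Sum>(A, B)\<in>bases en R E \<times> bases en R F. of_bool (S \<union> S' \<subseteq> A \<union> B))"
    using sum.reindex_bij_betw[OF bij, of "\<lambda>T. of_bool (S \<union> S' \<subseteq> T) :: real"]
    by (simp add: case_prod_unfold)
  also have "\<dots> = (\<Sum>(A, B)\<in>bases en R E \<times> bases en R F. of_bool (S \<subseteq> A) * of_bool (S' \<subseteq> B))"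
  proof (rule sum.cong[OF refl])
    fix p assume "p \<in> bases en R E \<times> bases en R F"
    then obtain A B where p: "p = (A, B)" and AB: "A \<in> bases en R E" "B \<in> bases en R F" by auto
    note p = p bases_subset[OF AB(1)] bases_subset[OF AB(2)]
    have "S \<union> S' \<subseteq> A \<union> B \<longleftrightarrow> S \<subseteq> A \<and> S' \<subseteq> B" using assms p by blast
    then show "(case p of (A, B) \<Rightarrow> of_bool (S \<union> S' \<subseteq> A \<union> B)) =
        ((case p of (A, B) \<Rightarrow> of_bool (S \<subseteq> A) * of_bool (S' \<subseteq> B)) :: real)" by (simp add: p)
  qed
  also have "\<dots> = (\<Sum>A\<in>bases en R E. of_bool (S \<subseteq> A)) * (\<Sum>B\<in>bases en R F. of_bool (S' \<subseteq> B))"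
    by (simp add: sum_product sum.cartesian_product)
  finally have "sum (\<lambda>T. of_bool (S \<union> S' \<subseteq> T) :: real) (bases en R (E \<union> F)) =
    (\<Sum>A\<in>bases en R E. of_bool (S \<subseteq> A)) * (\<Sum>B\<in>bases en R F. of_bool (S' \<subseteq> B))" .
  moreover have "card (bases en R (E \<union> F)) = card (bases en R E) * card (bases en R F)"
    using bij_betw_same_card[OF bij] by (simp add: card_cartesian_product)
  ultimately show ?thesis by (simp add: uavg_def)
qed

lemma uavg_one: "finite B \<Longrightarrow> B \<noteq> {} \<Longrightarrow> uavg B (\<lambda>_. 1) = 1"
  by (simp add: uavg_def)

lemma uavg_direct_sum:
  assumes "finite J" and fin: "\<And>C. C \<in> J \<Longrightarrow> finite (E C)"
    and dis: "\<And>C D. C \<in> J \<Longrightarrow> D \<in> J \<Longrightarrow> C \<noteq> D \<Longrightarrow> C \<inter> D = {}"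
    and E: "\<And>C e. C \<in> J \<Longrightarrow> e \<in> E C \<Longrightarrow> en e \<subseteq> C \<and> en e \<noteq> {}"
    and R: "\<And>C x y. C \<in> J \<Longrightarrow> (x, y) \<in> R \<Longrightarrow> x \<in> C \<longleftrightarrow> y \<in> C"
    and S: "S \<subseteq> (\<Union>C\<in>J. E C)"
  shows "uavg (bases en R (\<Union>C\<in>J. E C)) (\<lambda>T. of_bool (S \<subseteq> T)) =
    (\<Prod>C\<in>J. uavg (bases en R (E C)) (\<lambda>T. of_bool (S \<inter> E C \<subseteq> T)))"
  using assms
proof (induction J arbitrary: S rule: finite_induct)
  case empty
  have "bases en R {} = {{}}" by (auto simp: bases_def)
  then show ?case using empty by (simp add: uavg_def)
next
  case (insert C J)
  let ?F = "\<Union>D\<in>J. E D"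
  have CJ: "C \<inter> D = {}" if "D \<in> J" for D
    using insert.prems(2)[of C D] insert.hyps(2) that by blast
  have sep: "separated en R C (E C) ?F"
    unfolding separated_def
  proof (intro conjI ballI)
    show "en e \<subseteq> C" if "e \<in> E C" for e using insert.prems(3)[of C e] that by simp
    show "en e \<inter> C = {}" if "e \<in> ?F" for e
    proof -
      from that obtain D where D: "D \<in> J" "e \<in> E D" by blast
      then show ?thesis using insert.prems(3)[of D e] CJ[of D] by auto
    qed
    show "case p of (x, y) \<Rightarrow> (x \<in> C) = (y \<in> C)" if "p \<in> R" for p
      using insert.prems(4)[of C] that by (cases p) simp
  qed
  have dis: "E C \<inter> ?F = {}"
  proof -
    have False if "e \<in> E C" "D \<in> J" "e \<in> E D" for e D
      using insert.prems(3)[of C e] insert.prems(3)[of D e] CJ[of D] that by auto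
    then show ?thesis by blast
  qed
  have S: "S = (S \<inter> E C) \<union> (S \<inter> ?F)" using insert.prems(5) by auto
  have "uavg (bases en R (\<Union>D\<in>insert C J. E D)) (\<lambda>T. of_bool (S \<subseteq> T)) =
      uavg (bases en R (E C \<union> ?F)) (\<lambda>T. of_bool ((S \<inter> E C) \<union> (S \<inter> ?F) \<subseteq> T))"
    using S by simp
  also have "\<dots> = uavg (bases en R (E C)) (\<lambda>T. of_bool (S \<inter> E C \<subseteq> T)) *
      uavg (bases en R ?F) (\<lambda>T. of_bool (S \<inter> ?F \<subseteq> T))"
    by (rule uavg_separated[OF sep dis]) auto
  also have "uavg (bases en R ?F) (\<lambda>T. of_bool (S \<inter> ?F \<subseteq> T)) =
      (\<Prod>D\<in>J. uavg (bases en R (E D)) (\<lambda>T. of_bool (S \<inter> ?F \<inter> E D \<subseteq> T)))"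
  proof (rule insert.IH)
    show "C \<inter> D = {}" if "C \<in> J" "D \<in> J" "C \<noteq> D" for C D using insert.prems(2) that by auto
    show "en e \<subseteq> C \<and> en e \<noteq> {}" if "C \<in> J" "e \<in> E C" for C e using insert.prems(3) that by auto
    show "x \<in> C \<longleftrightarrow> y \<in> C" if "C \<in> J" "(x, y) \<in> R" for C x y using insert.prems(4) that by auto
    show "finite (E C)" if "C \<in> J" for C using insert.prems(1) that by auto
  qed auto
  also have "\<dots> = (\<Prod>D\<in>J. uavg (bases en R (E D)) (\<lambda>T. of_bool (S \<inter> E D \<subseteq> T)))"
  proof (rule prod.cong[OF refl])
    fix D assume "D \<in> J"
    then have "S \<inter> ?F \<inter> E D = S \<inter> E D" by auto
    then show "uavg (bases en R (E D)) (\<lambda>T. of_bool (S \<inter> ?F \<inter> E D \<subseteq> T)) =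
      uavg (bases en R (E D)) (\<lambda>T. of_bool (S \<inter> E D \<subseteq> T))" by simp
  qed
  finally show ?case using insert.hyps by simp
qed

text \<open>\<open>wire W \<inter> con en {} T\<close> is already an equivalence on the complement
  of \<open>W\<close>, so chains of identifications produce no new pairs.\<close>

lemma con_wire_inter_empty:
  "(u, v) \<in> con en (wire W \<inter> con en {} T) {} \<longleftrightarrow> u = v \<or> (u, v) \<in> wire W \<inter> con en {} T"
proof
  \<comment> \<open>\<open>h\<close> sends a vertex to its intended class, which turns equality of
    classes into an invariant of paths.\<close>
  define h where "h x = (if x \<in> W then {x} else {y. y \<notin> W \<and> (x, y) \<in> con en {} T})" for x
  assume "(u, v) \<in> con en (wire W \<inter> con en {} T) {}"
  then have "h u = h v"
  proof (rule con_invariant)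
    fix x y assume xy: "(x, y) \<in> wire W \<inter> con en {} T"
    then have "(x, z) \<in> con en {} T \<longleftrightarrow> (y, z) \<in> con en {} T" for z
      using con_trans[of y x en "{}" T z] con_trans[of x y en "{}" T z] con_sym[of x y en "{}" T] by auto
    then show "h x = h y" using xy by (auto simp: h_def wire_def)
  qed simp
  moreover have "u \<in> h u" "v \<in> h v" by (auto simp: h_def)
  ultimately show "u = v \<or> (u, v) \<in> wire W \<inter> con en {} T"
    by (auto simp: h_def wire_def split: if_splits)
next
  assume "u = v \<or> (u, v) \<in> wire W \<inter> con en {} T"
  then show "(u, v) \<in> con en (wire W \<inter> con en {} T) {}"
    using con_rel[of u v "wire W \<inter> con en {} T" en "{}"] by auto
qed

text \<open>The uniform spanning forest of \<open>T\<close> in which the complement of \<open>W\<close> is wired within each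
  component of \<open>T\<close>.\<close>

definition forest_avg :: "('e \<Rightarrow> 'v set) \<Rightarrow> 'v set \<Rightarrow> 'e set \<Rightarrow> ('e set \<Rightarrow> real) \<Rightarrow> real" where
  "forest_avg en W T h = uavg (bases en (wire W \<inter> con en {} T) (touching en W T)) h"

section \<open>Components of a spanning subgraph\<close>

context locally_finite_graph
begin

abbreviation "comps T \<equiv> components (spanning_subgraph G T)"
abbreviation "comp_graph T C \<equiv> induced_subgraph (spanning_subgraph G T) C"

lemma con_verts:
  assumes "T \<subseteq> edges G" "(u, v) \<in> con en {} T" "u \<in> verts G"
  shows "v \<in> verts G"
proof -
  have "(u \<in> verts G) = (v \<in> verts G)" using assms(2)
    by (rule con_invariant) (use assms(1) edge_ends in auto)
  then show ?thesis using assms by simp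
qed

lemma comps_eq:
  assumes "T \<subseteq> edges G"
  shows "comps T = (\<lambda>u. {v. (u, v) \<in> con en {} T}) ` verts G"
proof -
  let ?H = "spanning_subgraph G T"
  have H: "edges ?H = T" "ends ?H = en" "verts ?H = verts G" by (simp_all add: spanning_subgraph_def)
  have two: "two_ended (ends ?H) (edges ?H)" unfolding H by (rule two_ended_subset[OF two_ended assms])
  have "{v \<in> verts G. (u, v) \<in> con en {} T} = {v. (u, v) \<in> con en {} T}" if "u \<in> verts G" for u
    using con_verts[OF assms] that by blast
  then show ?thesis unfolding components_def adj_rtrancl[OF two] H by simp
qed

lemma comps_mem_iff:
  assumes "T \<subseteq> edges G" "C \<in> comps T" "u \<in> C"
  shows "v \<in> C \<longleftrightarrow> (u, v) \<in> con en {} T"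
proof -
  obtain w where C: "C = {v. (w, v) \<in> con en {} T}" using assms comps_eq by auto
  have wu: "(w, u) \<in> con en {} T" using assms(3) C by simp
  show ?thesis
  proof
    assume "v \<in> C"
    then have "(w, v) \<in> con en {} T" using C by simp
    with con_sym[OF wu] show "(u, v) \<in> con en {} T" by (rule con_trans)
  next
    assume "(u, v) \<in> con en {} T"
    with wu have "(w, v) \<in> con en {} T" by (rule con_trans)
    then show "v \<in> C" using C by simp
  qed
qed

lemma comps_disjoint:
  assumes "T \<subseteq> edges G" "C \<in> comps T" "D \<in> comps T" "C \<noteq> D"
  shows "C \<inter> D = {}"
proof (rule ccontr)
  assume "C \<inter> D \<noteq> {}"
  then obtain u where "u \<in> C" "u \<in> D" by blast
  then have "C = D" using comps_mem_iff[OF assms(1,2)] comps_mem_iff[OF assms(1,3)] by blast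
  then show False using assms by simp
qed

lemma comps_subset: "T \<subseteq> edges G \<Longrightarrow> C \<in> comps T \<Longrightarrow> C \<subseteq> verts G"
  using comps_eq con_verts by auto

lemma comps_nonempty: "T \<subseteq> edges G \<Longrightarrow> C \<in> comps T \<Longrightarrow> C \<noteq> {}"
  using comps_eq by auto

lemma edge_comp:
  assumes T: "T \<subseteq> edges G" and e: "e \<in> T"
  shows "\<exists>C\<in>comps T. en e \<subseteq> C"
proof -
  obtain u v where uv: "en e = {u, v}" using two_ended e T unfolding two_ended_def by blast
  have "u \<in> verts G" using edge_ends e T uv by blast
  moreover have "(u, v) \<in> con en {} T" using con_edge[of e T u en v "{}"] e uv by simp
  ultimately show ?thesis unfolding comps_eq[OF T] uv by auto
qed

lemma edge_nonempty: "e \<in> edges G \<Longrightarrow> en e \<noteq> {}"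
  using two_ended unfolding two_ended_def by fastforce

lemma edge_meets_comp:
  assumes "T \<subseteq> edges G" "C \<in> comps T" "e \<in> T" "u \<in> en e" "u \<in> C"
  shows "en e \<subseteq> C"
proof
  fix v assume "v \<in> en e"
  then have "(u, v) \<in> con en {} T" using con_edge[of e T u en v "{}"] assms by simp
  then show "v \<in> C" using comps_mem_iff[OF assms(1,2,5)] by simp
qed

lemma comp_graph_simps:
  "verts (comp_graph T C) = C" "edges (comp_graph T C) = {e \<in> T. en e \<subseteq> C}" "ends (comp_graph T C) = en"
  by (simp_all add: induced_subgraph_def spanning_subgraph_def)

lemma locally_finite_graph_comp:
  assumes T: "T \<subseteq> edges G" and C: "C \<in> comps T"
  shows "locally_finite_graph (comp_graph T C)"
proof
  let ?E = "{e \<in> T. en e \<subseteq> C}"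
  show two: "two_ended (ends (comp_graph T C)) (edges (comp_graph T C))"
    unfolding comp_graph_simps by (rule two_ended_subset[OF two_ended]) (use T in auto)
  have "(u, v) \<in> con en {} ?E" if uv: "u \<in> C" "v \<in> C" for u v
  proof -
    have "(u, v) \<in> con en {} T" using comps_mem_iff[OF T C uv(1)] uv(2) by simp
    then have "(u \<in> C \<and> (u, u) \<in> con en {} ?E) = (v \<in> C \<and> (u, v) \<in> con en {} ?E)"
    proof (rule con_invariant[where h = "\<lambda>x. x \<in> C \<and> (u, x) \<in> con en {} ?E"])
      have *: "y \<in> C \<and> (u, y) \<in> con en {} ?E"
        if e: "e \<in> T" "x \<in> en e" "y \<in> en e" and x: "x \<in> C \<and> (u, x) \<in> con en {} ?E" for e x y
      proof -
        have "en e \<subseteq> C" using edge_meets_comp[OF T C e(1,2)] x by simp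
        then have "(x, y) \<in> con en {} ?E" using con_edge[of e ?E x en y "{}"] e by simp
        then show ?thesis using con_trans[of u x en "{}" ?E y] x \<open>en e \<subseteq> C\<close> e by blast
      qed
      show "(x \<in> C \<and> (u, x) \<in> con en {} ?E) = (y \<in> C \<and> (u, y) \<in> con en {} ?E)"
        if "e \<in> T" "x \<in> en e" "y \<in> en e" for e x y
        using *[OF that] *[OF that(1,3,2)] by blast
    qed simp
    then show ?thesis using uv by simp
  qed
  then show "connected_graph (comp_graph T C)"
    unfolding connected_graph_def adj_rtrancl[OF two]
    using comps_nonempty[OF T C] by (simp add: comp_graph_simps)
  show "ends (comp_graph T C) e \<subseteq> verts (comp_graph T C)" if "e \<in> edges (comp_graph T C)" for e
    using that by (simp add: comp_graph_simps)
  show "finite {e \<in> edges (comp_graph T C). v \<in> ends (comp_graph T C) e}" for v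
    by (rule finite_subset[OF _ locally_finite[of v]]) (use T in \<open>auto simp: comp_graph_simps\<close>)
qed

end

section \<open>The union of independent forests of the components\<close>

context locally_finite_graph
begin

text \<open>Blockwise wiring makes the components independent, and inside a component it is the
  ordinary wiring off \<open>W \<inter> C\<close>. Factors without edges of \<open>S\<close> equal
  1; dropping them leaves an index set that does not depend on \<open>W\<close>, so the limit can be
  taken factor by factor.\<close>

lemma forest_avg_eq_prod:
  assumes T: "T \<subseteq> edges G" and W: "finite W" "W \<subseteq> verts G" and S: "S \<subseteq> touching en W T"
  shows "forest_avg en W T (\<lambda>F. of_bool (S \<subseteq> F)) =
    (\<Prod>C\<in>{C \<in> comps T. \<exists>e\<in>S. en e \<subseteq> C}.
      locally_finite_graph.ust (comp_graph T C) (W \<inter> C) (\<lambda>F. of_bool ({e \<in> S. en e \<subseteq> C} \<subseteq> F)))"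
proof -
  let ?R = "wire W \<inter> con en {} T"
  \<comment> \<open>A finite \<open>W\<close> meets finitely many components, and only these carry
    touching edges.\<close>
  define J where "J = {C \<in> comps T. C \<inter> W \<noteq> {}}"
  define E where "E C = {e \<in> touching en W T. en e \<subseteq> C}" for C
  have fin_t: "finite (touching en W T)"
    by (rule finite_subset[OF _ finite_touching[OF W(1)]]) (use T in \<open>auto simp: touching_def\<close>)
  have "finite J"
  proof (rule finite_subset)
    show "J \<subseteq> (\<lambda>u. {v. (u, v) \<in> con en {} T}) ` W"
    proof
      fix C assume "C \<in> J"
      then obtain u where u: "C \<in> comps T" "u \<in> C" "u \<in> W" by (auto simp: J_def)
      then have "C = {v. (u, v) \<in> con en {} T}" using comps_mem_iff[OF T u(1,2)] by blast
      then show "C \<in> (\<lambda>u. {v. (u, v) \<in> con en {} T}) ` W" using u by blast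
    qed
  qed (use W in simp)
  have U: "touching en W T = (\<Union>C\<in>J. E C)"
  proof
    show "touching en W T \<subseteq> (\<Union>C\<in>J. E C)"
    proof
      fix e assume e: "e \<in> touching en W T"
      then obtain C where C: "C \<in> comps T" "en e \<subseteq> C" using edge_comp[OF T] by (auto simp: touching_def)
      then have "C \<in> J" using e by (auto simp: J_def touching_def)
      then show "e \<in> (\<Union>C\<in>J. E C)" using e C by (auto simp: E_def)
    qed
  qed (auto simp: E_def)
  have "forest_avg en W T (\<lambda>F. of_bool (S \<subseteq> F)) =
      (\<Prod>C\<in>J. uavg (bases en ?R (E C)) (\<lambda>F. of_bool (S \<inter> E C \<subseteq> F)))"
    unfolding forest_avg_def U
  proof (rule uavg_direct_sum[OF \<open>finite J\<close>])
    show "finite (E C)" for C using fin_t by (simp add: E_def)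
    show "C \<inter> D = {}" if "C \<in> J" "D \<in> J" "C \<noteq> D" for C D
      using comps_disjoint[OF T] that by (simp add: J_def)
    show "en e \<subseteq> C \<and> en e \<noteq> {}" if "C \<in> J" "e \<in> E C" for C e
      using that by (auto simp: E_def touching_def)
    show "(x \<in> C) = (y \<in> C)" if "C \<in> J" "(x, y) \<in> ?R" for C x y
      using comps_mem_iff[OF T, of C x y] comps_mem_iff[OF T, of C y x] con_sym[of x y en "{}" T] that
      by (auto simp: J_def)
    show "S \<subseteq> (\<Union>C\<in>J. E C)" using S U by simp
  qed
  also have "\<dots> = (\<Prod>C\<in>J. locally_finite_graph.ust (comp_graph T C) (W \<inter> C) (\<lambda>F. of_bool ({e \<in> S. en e \<subseteq> C} \<subseteq> F)))"
  proof (rule prod.cong[OF refl])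
    fix C assume "C \<in> J"
    then have C: "C \<in> comps T" by (simp add: J_def)
    interpret GC: locally_finite_graph "comp_graph T C" by (rule locally_finite_graph_comp[OF T C])
    have t: "touching en (W \<inter> C) {e \<in> T. en e \<subseteq> C} = E C" by (auto simp: touching_def E_def)
    have "bases en ?R (E C) = bases en (wire (W \<inter> C)) (E C)"
    proof (rule bases_restrict)
      show "en e \<subseteq> C" if "e \<in> E C" for e using that by (simp add: E_def)
      have "(u, v) \<in> con en ?R {} \<longleftrightarrow> (u, v) \<in> con en (wire (W \<inter> C)) {}" if "u \<in> C" "v \<in> C" for u v
        unfolding con_wire_inter_empty con_wire_empty
        using comps_mem_iff[OF T C that(1)] that by (auto simp: wire_def)
      then show "con en ?R {} \<inter> C \<times> C = con en (wire (W \<inter> C)) {} \<inter> C \<times> C" by auto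
    qed
    moreover have "S \<inter> E C = {e \<in> S. en e \<subseteq> C}" using S by (auto simp: E_def)
    ultimately show "uavg (bases en ?R (E C)) (\<lambda>F. of_bool (S \<inter> E C \<subseteq> F)) =
        GC.ust (W \<inter> C) (\<lambda>F. of_bool ({e \<in> S. en e \<subseteq> C} \<subseteq> F))"
      unfolding GC.ust_def comp_graph_simps t by simp
  qed
  also have "\<dots> = (\<Prod>C\<in>{C \<in> comps T. \<exists>e\<in>S. en e \<subseteq> C}.
      locally_finite_graph.ust (comp_graph T C) (W \<inter> C) (\<lambda>F. of_bool ({e \<in> S. en e \<subseteq> C} \<subseteq> F)))"
  proof (rule prod.mono_neutral_right[OF \<open>finite J\<close>])
    show "{C \<in> comps T. \<exists>e\<in>S. en e \<subseteq> C} \<subseteq> J" using S by (fastforce simp: J_def touching_def)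
    show "\<forall>C\<in>J - {C \<in> comps T. \<exists>e\<in>S. en e \<subseteq> C}.
        locally_finite_graph.ust (comp_graph T C) (W \<inter> C) (\<lambda>F. of_bool ({e \<in> S. en e \<subseteq> C} \<subseteq> F)) = 1"
    proof
      fix C assume C: "C \<in> J - {C \<in> comps T. \<exists>e\<in>S. en e \<subseteq> C}"
      then interpret GC: locally_finite_graph "comp_graph T C"
        by (intro locally_finite_graph_comp[OF T]) (simp add: J_def)
      have "{e \<in> S. en e \<subseteq> C} = {}" using C by (auto simp: J_def)
      then have one: "(\<lambda>F. of_bool ({e \<in> S. en e \<subseteq> C} \<subseteq> F) :: real) = (\<lambda>_. 1)"
        by (simp only: empty_subsetI of_bool_eq)
      show "GC.ust (W \<inter> C) (\<lambda>F. of_bool ({e \<in> S. en e \<subseteq> C} \<subseteq> F)) = 1"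
        unfolding GC.ust_def one using W
        by (intro uavg_one GC.bases_finite_touching GC.bases_nonempty_touching) auto
    qed
  qed
  finally show ?thesis .
qed

text \<open>A product of probability spaces needs one at every index, hence the dummy value off \<open>comps T\<close>.\<close>

definition comp_measure :: "'e set \<Rightarrow> 'v set \<Rightarrow> 'e set measure" where
  "comp_measure T C = (if C \<in> comps T then WSF (comp_graph T C) else return (count_space UNIV) {})"

lemma WSF_components_eq:
  "WSF_components G (spanning_subgraph G T) =
    distr (\<Pi>\<^sub>M C\<in>comps T. comp_measure T C) (subgraph_space G) (\<lambda>F. \<Union>C\<in>comps T. F C)"
proof -
  have "(\<Pi>\<^sub>M C\<in>comps T. WSF (comp_graph T C)) = (\<Pi>\<^sub>M C\<in>comps T. comp_measure T C)"
    by (rule PiM_cong) (auto simp: comp_measure_def)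
  then show ?thesis by (simp add: WSF_components_def)
qed

lemma space_comp_measure:
  "T \<subseteq> edges G \<Longrightarrow> C \<in> comps T \<Longrightarrow> space (comp_measure T C) = {F. F \<subseteq> {e \<in> T. en e \<subseteq> C}}"
  using locally_finite_graph.space_WSF[OF locally_finite_graph_comp] by (auto simp: comp_measure_def comp_graph_simps)

lemma product_prob_space_comp_measure:
  assumes "T \<subseteq> edges G"
  shows "product_prob_space (comp_measure T)"
proof -
  have p: "prob_space (comp_measure T C)" for C
    using locally_finite_graph.prob_space_WSF[OF locally_finite_graph_comp[OF assms]]
    by (auto simp: comp_measure_def intro: prob_space_return)
  show ?thesis
    unfolding product_prob_space_def product_prob_space_axioms_def product_sigma_finite_def
    using p by (auto intro: prob_space_imp_sigma_finite)
qed

text \<open>Components are disjoint and an edge has at least one endpoint, so no factor other than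
  that of its own component can contribute \<open>e\<close>.\<close>

lemma comp_union_mem:
  assumes T: "T \<subseteq> edges G" and F: "F \<in> space (\<Pi>\<^sub>M C\<in>comps T. comp_measure T C)"
    and C: "C \<in> comps T" "e \<in> T" "en e \<subseteq> C"
  shows "e \<in> (\<Union>C\<in>comps T. F C) \<longleftrightarrow> e \<in> F C"
proof
  assume "e \<in> (\<Union>C\<in>comps T. F C)"
  then obtain D where D: "D \<in> comps T" "e \<in> F D" by blast
  have "F D \<in> space (comp_measure T D)" using F D(1) by (auto simp: space_PiM)
  then have "en e \<subseteq> D" using D space_comp_measure[OF T D(1)] by auto
  moreover have "en e \<noteq> {}" using edge_nonempty T C by blast
  ultimately have "C = D" using comps_disjoint[OF T C(1) D(1)] C(3) by blast
  then show "e \<in> F C" using D by simp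
qed (use C in blast)

lemma comp_union_measurable:
  assumes T: "T \<subseteq> edges G"
  shows "(\<lambda>F. \<Union>C\<in>comps T. F C) \<in> measurable (\<Pi>\<^sub>M C\<in>comps T. comp_measure T C) (subgraph_space G)"
proof (rule measurable_subgraph_spaceI)
  let ?P = "\<Pi>\<^sub>M C\<in>comps T. comp_measure T C"
  have sub: "F C \<subseteq> T" if "F \<in> space ?P" "C \<in> comps T" for F C
  proof -
    have "F C \<in> space (comp_measure T C)" using that by (auto simp: space_PiM)
    then show ?thesis using space_comp_measure[OF T that(2)] by auto
  qed
  show "(\<Union>C\<in>comps T. F C) \<subseteq> edges G" if "F \<in> space ?P" for F using sub[OF that] T by blast
  fix e assume "e \<in> edges G"
  show "{F \<in> space ?P. e \<in> (\<Union>C\<in>comps T. F C)} \<in> sets ?P"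
  proof (cases "e \<in> T")
    case False
    then have "{F \<in> space ?P. e \<in> (\<Union>C\<in>comps T. F C)} = {}" using sub by blast
    then show ?thesis by (simp only: sets.empty_sets)
  next
    case True
    then obtain C where C: "C \<in> comps T" "en e \<subseteq> C" using edge_comp[OF T] by blast
    have "{F \<in> space ?P. e \<in> (\<Union>C\<in>comps T. F C)} = {F \<in> space ?P. e \<in> F C}"
      using comp_union_mem[OF T _ C(1) True C(2)] by blast
    moreover have "{x \<in> space (comp_measure T C). e \<in> x} \<in> sets (comp_measure T C)"
      using edge_event_sets[of "comp_graph T C" e] C(1)
        locally_finite_graph.space_WSF[OF locally_finite_graph_comp[OF T C(1)]]
        locally_finite_graph.sets_WSF[OF locally_finite_graph_comp[OF T C(1)]]
      by (simp add: comp_measure_def Pow_def)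
    ultimately show ?thesis using sets_Collect_single'[OF C(1)] by simp
  qed
qed

lemma prob_space_WSF_components:
  assumes T: "T \<subseteq> edges G"
  shows "prob_space (WSF_components G (spanning_subgraph G T))"
proof -
  interpret product_prob_space "comp_measure T" "comps T" by (rule product_prob_space_comp_measure[OF T])
  show ?thesis unfolding WSF_components_eq by (rule prob_space_distr[OF comp_union_measurable[OF T]])
qed

lemma sets_WSF_components [simp]: "sets (WSF_components G H) = sets (subgraph_space G)"
  by (simp add: WSF_components_def)

text \<open>The inclusion of \<open>S\<close> constrains only the finitely many factors whose
  component contains an edge of \<open>S\<close>, so it is a finite-dimensional event of the product
  measure.\<close>

lemma measure_WSF_components_prod:
  assumes T: "T \<subseteq> edges G" and S: "finite S" "S \<subseteq> T"
  defines "J \<equiv> {C \<in> comps T. \<exists>e\<in>S. en e \<subseteq> C}"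
  shows "measure (WSF_components G (spanning_subgraph G T)) {F \<in> Pow (edges G). S \<subseteq> F} =
      (\<Prod>C\<in>J. measure (WSF (comp_graph T C)) {F \<in> Pow (edges (comp_graph T C)). {e \<in> S. en e \<subseteq> C} \<subseteq> F})"
    and "finite J"
proof -
  interpret product_prob_space "comp_measure T" "comps T" by (rule product_prob_space_comp_measure[OF T])
  have "\<exists>c. \<forall>e\<in>S. c e \<in> comps T \<and> en e \<subseteq> c e" using edge_comp[OF T] S by (intro bchoice) blast
  then obtain c where c: "\<And>e. e \<in> S \<Longrightarrow> c e \<in> comps T \<and> en e \<subseteq> c e" by blast
  have "J \<subseteq> c ` S"
  proof
    fix C assume "C \<in> J"
    then obtain e where e: "C \<in> comps T" "e \<in> S" "en e \<subseteq> C" by (auto simp: J_def)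
    have "en e \<noteq> {}" using edge_nonempty T S e by blast
    then have "C = c e" using comps_disjoint[OF T e(1), of "c e"] c[OF e(2)] e(3) by blast
    then show "C \<in> c ` S" using e by blast
  qed
  then show finJ: "finite J" using S(1) finite_subset by blast
  let ?P = "\<Pi>\<^sub>M C\<in>comps T. comp_measure T C"
  define X where "X C = {F \<in> Pow (edges (comp_graph T C)). {e \<in> S. en e \<subseteq> C} \<subseteq> F}" for C
  have JT: "J \<subseteq> comps T" by (auto simp: J_def)
  have cm: "comp_measure T C = WSF (comp_graph T C)" if "C \<in> J" for C
    using that JT by (auto simp: comp_measure_def)
  have X: "X C \<in> sets (comp_measure T C)" if "C \<in> J" for C
    using superset_event_sets[of "{e \<in> S. en e \<subseteq> C}" "comp_graph T C"] S(1) cm[OF that] that JT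
      locally_finite_graph.sets_WSF[OF locally_finite_graph_comp[OF T], of C]
    by (auto simp: X_def)
  have "measure (WSF_components G (spanning_subgraph G T)) {F \<in> Pow (edges G). S \<subseteq> F} =
      measure ?P ((\<lambda>F. \<Union>C\<in>comps T. F C) -` {F \<in> Pow (edges G). S \<subseteq> F} \<inter> space ?P)"
    unfolding WSF_components_eq
    using superset_event_sets[OF S(1)] by (intro measure_distr[OF comp_union_measurable[OF T]])
  also have "(\<lambda>F. \<Union>C\<in>comps T. F C) -` {F \<in> Pow (edges G). S \<subseteq> F} \<inter> space ?P =
      prod_emb (comps T) (comp_measure T) J (\<Pi>\<^sub>E C\<in>J. X C)" (is "?A = ?B")
  proof (rule set_eqI)
    fix F
    have "F \<in> ?A \<longleftrightarrow> F \<in> space ?P \<and> S \<subseteq> (\<Union>C\<in>comps T. F C)"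
      using measurable_space[OF comp_union_measurable[OF T], of F] by auto
    also have "\<dots> \<longleftrightarrow> F \<in> space ?P \<and> (\<forall>C\<in>J. {e \<in> S. en e \<subseteq> C} \<subseteq> F C)"
    proof (rule conj_cong[OF refl])
      assume F: "F \<in> space ?P"
      have *: "e \<in> (\<Union>C\<in>comps T. F C) \<longleftrightarrow> e \<in> F C" if "C \<in> J" "e \<in> S" "en e \<subseteq> C" for e C
        by (rule comp_union_mem[OF T F]) (use that JT S in auto)
      have **: "c e \<in> J" if "e \<in> S" for e using c[OF that] that by (auto simp: J_def)
      show "S \<subseteq> (\<Union>C\<in>comps T. F C) \<longleftrightarrow> (\<forall>C\<in>J. {e \<in> S. en e \<subseteq> C} \<subseteq> F C)"
      proof
        assume "S \<subseteq> (\<Union>C\<in>comps T. F C)"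
        then show "\<forall>C\<in>J. {e \<in> S. en e \<subseteq> C} \<subseteq> F C" using * by blast
      next
        assume A: "\<forall>C\<in>J. {e \<in> S. en e \<subseteq> C} \<subseteq> F C"
        show "S \<subseteq> (\<Union>C\<in>comps T. F C)"
        proof
          fix e assume e: "e \<in> S"
          then have "e \<in> F (c e)" using A ** c by blast
          then show "e \<in> (\<Union>C\<in>comps T. F C)" using c[OF e] by blast
        qed
      qed
    qed
    also have "\<dots> \<longleftrightarrow> F \<in> ?B"
    proof -
      have "F C \<in> X C \<longleftrightarrow> {e \<in> S. en e \<subseteq> C} \<subseteq> F C" if "F \<in> space ?P" "C \<in> J" for C
      proof -
        have "F C \<in> space (comp_measure T C)" using that JT by (auto simp: space_PiM)
        then show ?thesis using space_comp_measure[OF T, of C] that JT by (auto simp: X_def comp_graph_simps)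
      qed
      moreover have "F \<in> ?B \<longleftrightarrow> F \<in> space ?P \<and> (\<forall>C\<in>J. F C \<in> X C)"
        unfolding prod_emb_iff using JT by (auto simp: space_PiM PiE_iff extensional_def)
      ultimately show ?thesis by blast
    qed
    finally show "F \<in> ?A \<longleftrightarrow> F \<in> ?B" .
  qed
  also have "measure ?P \<dots> = (\<Prod>C\<in>J. measure (comp_measure T C) (X C))"
    by (rule measure_PiM_emb[OF JT finJ X])
  also have "\<dots> = (\<Prod>C\<in>J. measure (WSF (comp_graph T C)) (X C))"
    by (intro prod.cong refl) (simp add: cm)
  finally show "measure (WSF_components G (spanning_subgraph G T)) {F \<in> Pow (edges G). S \<subseteq> F} =
      (\<Prod>C\<in>J. measure (WSF (comp_graph T C)) {F \<in> Pow (edges (comp_graph T C)). {e \<in> S. en e \<subseteq> C} \<subseteq> F})"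
    by (simp add: X_def)
qed

text \<open>The traces of the exhausting sets exhaust every component, so each factor of the finite
  product converges. The law of the resampled forest given \<open>T\<close> is thus a limit of
  finite averages for every \<open>T\<close>, not only for almost every one.\<close>

lemma forest_avg_tendsto:
  assumes ex: "exhausts W (verts G)" and T: "T \<subseteq> edges G" and S: "finite S" "S \<subseteq> edges G"
  shows "(\<lambda>n. forest_avg en (W n) T (\<lambda>F. of_bool (S \<subseteq> F))) \<longlonglongrightarrow>
    measure (WSF_components G (spanning_subgraph G T)) {F \<in> Pow (edges G). S \<subseteq> F}"
proof (cases "S \<subseteq> T")
  case False
  then obtain e where e: "e \<in> S" "e \<notin> T" by blast
  have "forest_avg en (W n) T (\<lambda>F. of_bool (S \<subseteq> F)) = 0" for n
  proof -
    have "\<not> S \<subseteq> F" if "F \<in> bases en (wire (W n) \<inter> con en {} T) (touching en (W n) T)" for F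
      using bases_subset[OF that] e by (auto simp: touching_def)
    then show ?thesis unfolding forest_avg_def uavg_def by simp
  qed
  moreover have "measure (WSF_components G (spanning_subgraph G T)) {F \<in> Pow (edges G). S \<subseteq> F} = 0"
  proof -
    let ?P = "\<Pi>\<^sub>M C\<in>comps T. comp_measure T C"
    have "F C \<subseteq> T" if "F \<in> space ?P" "C \<in> comps T" for F C
    proof -
      have "F C \<in> space (comp_measure T C)" using that by (auto simp: space_PiM)
      then show ?thesis using space_comp_measure[OF T that(2)] by auto
    qed
    then have "(\<lambda>F. \<Union>C\<in>comps T. F C) -` {F \<in> Pow (edges G). S \<subseteq> F} \<inter> space ?P = {}"
      using e by blast
    then show ?thesis
      unfolding WSF_components_eq
      using measure_distr[OF comp_union_measurable[OF T] superset_event_sets[OF S(1)]] by simp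
  qed
  ultimately show ?thesis by simp
next
  case True
  define J where "J = {C \<in> comps T. \<exists>e\<in>S. en e \<subseteq> C}"
  define SC where "SC C = {e \<in> S. en e \<subseteq> C}" for C
  have "(\<lambda>n. \<Prod>C\<in>J. locally_finite_graph.ust (comp_graph T C) (W n \<inter> C) (\<lambda>F. of_bool (SC C \<subseteq> F))) \<longlonglongrightarrow>
     (\<Prod>C\<in>J. measure (WSF (comp_graph T C)) {F \<in> Pow (edges (comp_graph T C)). SC C \<subseteq> F})"
  proof (rule tendsto_prod)
    fix C assume "C \<in> J"
    then have C: "C \<in> comps T" by (simp add: J_def)
    interpret GC: locally_finite_graph "comp_graph T C" by (rule locally_finite_graph_comp[OF T C])
    interpret P: prob_space "WSF (comp_graph T C)" by (rule GC.prob_space_WSF)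
    have exC: "exhausts (\<lambda>n. W n \<inter> C) (verts (comp_graph T C))"
      unfolding exhausts_def comp_graph_simps
    proof (intro conjI allI impI)
      fix K assume K: "finite K" "K \<subseteq> C"
      then have "\<forall>\<^sub>F n in sequentially. K \<subseteq> W n"
        using ex comps_subset[OF T C] unfolding exhausts_def by blast
      then show "\<forall>\<^sub>F n in sequentially. K \<subseteq> W n \<inter> C"
        by (rule eventually_mono) (use K in auto)
    qed (use ex in \<open>auto simp: exhausts_def\<close>)
    have SC: "finite (SC C)" "SC C \<subseteq> edges (comp_graph T C)"
      using S True by (auto simp: SC_def comp_graph_simps)
    have "(\<lambda>n. GC.ust (W n \<inter> C) (\<lambda>F. of_bool (SC C \<subseteq> F \<inter> SC C))) \<longlonglongrightarrow>
        (\<integral>F. of_bool (SC C \<subseteq> F \<inter> SC C) \<partial>WSF (comp_graph T C))"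
      using GC.integral_WSF_local[OF exC SC, of "\<lambda>A. of_bool (SC C \<subseteq> A)"] .
    also have "(\<integral>F. of_bool (SC C \<subseteq> F \<inter> SC C) \<partial>WSF (comp_graph T C)) =
        (\<integral>F. indicator {F \<in> Pow (edges (comp_graph T C)). SC C \<subseteq> F} F \<partial>WSF (comp_graph T C))"
      by (rule Bochner_Integration.integral_cong) (auto simp: indicator_def)
    also have "\<dots> = measure (WSF (comp_graph T C)) {F \<in> Pow (edges (comp_graph T C)). SC C \<subseteq> F}"
    proof -
      have "{F \<in> Pow (edges (comp_graph T C)). SC C \<subseteq> F} \<inter> space (WSF (comp_graph T C)) =
        {F \<in> Pow (edges (comp_graph T C)). SC C \<subseteq> F}" by auto
      then show ?thesis by (simp only: Bochner_Integration.integral_indicator)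
    qed
    finally show "(\<lambda>n. GC.ust (W n \<inter> C) (\<lambda>F. of_bool (SC C \<subseteq> F))) \<longlonglongrightarrow>
        measure (WSF (comp_graph T C)) {F \<in> Pow (edges (comp_graph T C)). SC C \<subseteq> F}" by simp
  qed
  also have "(\<Prod>C\<in>J. measure (WSF (comp_graph T C)) {F \<in> Pow (edges (comp_graph T C)). SC C \<subseteq> F}) =
      measure (WSF_components G (spanning_subgraph G T)) {F \<in> Pow (edges G). S \<subseteq> F}"
    using measure_WSF_components_prod(1)[OF T S(1) True] by (simp add: J_def SC_def)
  finally have lim: "(\<lambda>n. \<Prod>C\<in>J. locally_finite_graph.ust (comp_graph T C) (W n \<inter> C) (\<lambda>F. of_bool (SC C \<subseteq> F)))
     \<longlonglongrightarrow> measure (WSF_components G (spanning_subgraph G T)) {F \<in> Pow (edges G). S \<subseteq> F}" .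
  have "finite (\<Union>e\<in>S. en e)" "(\<Union>e\<in>S. en e) \<subseteq> verts G"
    using S finite_ends edge_ends by blast+
  then have "\<forall>\<^sub>F n in sequentially. (\<Union>e\<in>S. en e) \<subseteq> W n" using ex unfolding exhausts_def by blast
  then have "\<forall>\<^sub>F n in sequentially. (\<Prod>C\<in>J. locally_finite_graph.ust (comp_graph T C) (W n \<inter> C) (\<lambda>F. of_bool (SC C \<subseteq> F)))
      = forest_avg en (W n) T (\<lambda>F. of_bool (S \<subseteq> F))"
  proof eventually_elim
    case (elim n)
    have "S \<subseteq> touching en (W n) T"
    proof
      fix e assume e: "e \<in> S"
      then have "en e \<noteq> {}" using edge_nonempty S by blast
      then show "e \<in> touching en (W n) T" using elim e True unfolding touching_def by blast
    qed
    then show ?case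
      unfolding J_def SC_def using ex by (intro forest_avg_eq_prod[OF T, symmetric]) (auto simp: exhausts_def)
  qed
  with lim show ?thesis by (rule Lim_transform_eventually)
qed

end

section \<open>Resampling and domination\<close>

text \<open>For \<open>E = edges G\<close> this is the edge set of the induced-component graph;
  finite \<open>E\<close> gives the approximations seen inside a window.\<close>

definition con_closure :: "('e \<Rightarrow> 'v set) \<Rightarrow> 'e set \<Rightarrow> 'e set \<Rightarrow> 'e set" where
  "con_closure en E T = {e \<in> E. en e \<times> en e \<subseteq> con en {} T}"

lemma con_con_closure: "T \<subseteq> E \<Longrightarrow> con en {} (con_closure en E T) = con en {} T"
proof
  show "con en {} (con_closure en E T) \<subseteq> con en {} T"
    by (rule con_subsetI) (auto simp: con_closure_def)
  assume "T \<subseteq> E"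
  then have "T \<subseteq> con_closure en E T" using con_edges[of _ T en "{}"] by (auto simp: con_closure_def)
  then show "con en {} T \<subseteq> con en {} (con_closure en E T)" by (intro con_mono) auto
qed

lemma con_finite_witness:
  assumes "(u, v) \<in> con en {} T"
  shows "\<exists>S\<subseteq>T. finite S \<and> (u, v) \<in> con en {} S"
  using assms unfolding con_def[of en "{}" T]
proof (induction rule: rtrancl_induct)
  case base
  show ?case by (rule exI[of _ "{}"]) simp
next
  case (step y z)
  obtain S where S: "S \<subseteq> T" "finite S" "(u, y) \<in> con en {} S" using step.IH by blast
  obtain e where e: "e \<in> T" "y \<in> en e" "z \<in> en e" using step.hyps(2) by auto
  have "(u, y) \<in> con en {} (insert e S)" using S(3) con_mono[of "{}" "{}" S "insert e S" en] by blast
  moreover have "(y, z) \<in> con en {} (insert e S)" using con_edge[of e "insert e S" y en z "{}"] e by simp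
  ultimately have "(u, z) \<in> con en {} (insert e S)" by (rule con_trans)
  then show ?case using S e by (intro exI[of _ "insert e S"]) auto
qed

text \<open>Given the edges outside \<open>F\<close> and the partition into the components of \<open>T \<inter> F\<close>, a uniform
  basis \<open>T\<close> restricted to \<open>F\<close> is a uniform spanning forest of that partition.\<close>

lemma uavg_bases_resample:
  assumes fin: "finite E" and two: "two_ended en E" and F: "F \<subseteq> E"
    and h: "\<And>T. h (T \<inter> F) = h T"
  shows "uavg (bases en R E) h =
    uavg (bases en R E) (\<lambda>T. uavg (bases en {} (con_closure en F (T \<inter> F))) h)"
proof -
  let ?B = "bases en R E"
  define cl where "cl T = con_closure en F (T \<inter> F)" for T
  \<comment> \<open>By \<open>con_cl\<close> the closure determines the partition induced by
    \<open>T \<inter> F\<close>, so it serves as a code for it.\<close>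
  define key where "key T = (T - F, cl T)" for T
  have clF: "cl T \<subseteq> F" for T by (auto simp: cl_def con_closure_def)
  have con_cl: "con en {} (cl T) = con en {} (T \<inter> F)" for T
    unfolding cl_def by (rule con_con_closure) simp
  have finF: "finite F" using F fin by (rule finite_subset)
  have fin_cl: "finite (cl T)" for T using clF finF by (rule finite_subset)
  have two_cl: "two_ended en (cl T)" for T
    using two_ended_subset[OF two] clF F by (meson order_trans)
  have inner: "T \<inter> F \<in> bases en {} (cl T)" if T: "T \<in> ?B" for T
  proof -
    have "T \<inter> F \<subseteq> cl T" using con_edges[of _ "T \<inter> F" en "{}"] by (auto simp: cl_def con_closure_def)
    moreover have "en e \<times> en e \<subseteq> con en {} (T \<inter> F)" if "e \<in> cl T" for e
      using that by (auto simp: cl_def con_closure_def)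
    moreover have "\<not> en f \<times> en f \<subseteq> con en {} (T \<inter> F - {f})" if "f \<in> T \<inter> F" for f
    proof -
      have "con en {} (T \<inter> F - {f}) \<subseteq> con en R (T - {f})" by (rule con_mono) auto
      moreover have "\<not> en f \<times> en f \<subseteq> con en R (T - {f})" using T that by (simp add: bases_def)
      ultimately show ?thesis by blast
    qed
    ultimately show ?thesis by (simp add: bases_def)
  qed
  have fiber: "{T \<in> ?B. key T = key T0} = (\<lambda>T'. (T0 - F) \<union> T') ` bases en {} (cl T0)" if T0: "T0 \<in> ?B" for T0
  proof
    show "{T \<in> ?B. key T = key T0} \<subseteq> (\<lambda>T'. (T0 - F) \<union> T') ` bases en {} (cl T0)"
    proof
      fix T assume "T \<in> {T \<in> ?B. key T = key T0}"
      then have T: "T \<in> ?B" "T - F = T0 - F" "cl T = cl T0" by (auto simp: key_def)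
      have "T = (T0 - F) \<union> (T \<inter> F)" using T(2) by blast
      moreover have "T \<inter> F \<in> bases en {} (cl T0)" using inner[OF T(1)] T(3) by simp
      ultimately show "T \<in> (\<lambda>T'. (T0 - F) \<union> T') ` bases en {} (cl T0)" by (rule image_eqI)
    qed
    show "(\<lambda>T'. (T0 - F) \<union> T') ` bases en {} (cl T0) \<subseteq> {T \<in> ?B. key T = key T0}"
    proof
      fix T assume "T \<in> (\<lambda>T'. (T0 - F) \<union> T') ` bases en {} (cl T0)"
      then obtain T' where T': "T' \<in> bases en {} (cl T0)" and T: "T = (T0 - F) \<union> T'" by blast
      have T'F: "T' \<subseteq> F" using bases_subset[OF T'] clF by blast
      have con': "con en {} T' = con en {} (T0 \<inter> F)" using bases_con_eq[OF T'] con_cl by simp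
      have T0E: "T0 \<subseteq> E" using T0 by (rule bases_subset)
      have "con en R T0 \<subseteq> con en R T"
      proof (rule con_subsetI[OF con_rels])
        fix e assume e: "e \<in> T0"
        show "en e \<times> en e \<subseteq> con en R T"
        proof (cases "e \<in> F")
          case True
          then have "en e \<times> en e \<subseteq> con en {} T'" unfolding con' using e by (intro con_edges) simp
          also have "\<dots> \<subseteq> con en R T" by (rule con_mono) (auto simp: T)
          finally show ?thesis .
        next
          case False
          then show ?thesis using e by (intro con_edges) (simp add: T)
        qed
      qed
      then have span: "en e \<times> en e \<subseteq> con en R T" if "e \<in> E" for e
        using T0 that unfolding bases_def by blast
      \<comment> \<open>Counting replaces a check of the bridge condition: a spanning set with as
        many edges as a basis is a basis.\<close>
      have "card T' = card (T0 \<inter> F)"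
        by (rule bases_card_eq[OF fin_cl two_cl T' inner[OF T0]])
      moreover have "finite T0" using T0E fin by (rule finite_subset)
      moreover have "finite T'" using T'F finF by (rule finite_subset)
      moreover have "(T0 - F) \<inter> T' = {}" "(T0 - F) \<inter> (T0 \<inter> F) = {}" using T'F by auto
      ultimately have "card T = card ((T0 - F) \<union> (T0 \<inter> F))"
        unfolding T by (simp add: card_Un_disjoint)
      moreover have "(T0 - F) \<union> (T0 \<inter> F) = T0" by blast
      ultimately have "card T = card T0" by simp
      then have "card T'' = card T" if "T'' \<in> ?B" for T''
        using bases_card_eq[OF fin two that T0] by simp
      moreover have "T \<subseteq> E" using T0E T'F F by (auto simp: T)
      moreover have "finite T" using \<open>T \<subseteq> E\<close> fin by (rule finite_subset)
      ultimately have "T \<in> ?B" using span by (intro spanning_card_imp_bases)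
      moreover have "T - F = T0 - F" "T \<inter> F = T'" using T'F by (auto simp: T)
      moreover have "cl T = cl T0" unfolding cl_def con_closure_def \<open>T \<inter> F = T'\<close> con' ..
      ultimately show "T \<in> {T \<in> ?B. key T = key T0}" by (simp add: key_def)
    qed
  qed
  have fin_B: "finite ?B" using fin by (rule finite_bases)
  have "sum h {T \<in> ?B. key T = \<kappa>} = sum (\<lambda>T. uavg (bases en {} (cl T)) h) {T \<in> ?B. key T = \<kappa>}"
    if \<kappa>: "\<kappa> \<in> key ` ?B" for \<kappa>
  proof -
    obtain T0 where T0: "T0 \<in> ?B" "\<kappa> = key T0" using \<kappa> by blast
    let ?C = "bases en {} (cl T0)"
    have CF: "T' \<subseteq> F" if "T' \<in> ?C" for T' using bases_subset[OF that] clF by blast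
    have inj: "inj_on (\<lambda>T'. (T0 - F) \<union> T') ?C"
    proof (rule inj_onI)
      fix A B assume "A \<in> ?C" "B \<in> ?C" and eq: "(T0 - F) \<union> A = (T0 - F) \<union> B"
      then have "A \<subseteq> F" "B \<subseteq> F" using CF by auto
      then show "A = B" using eq by blast
    qed
    have "sum h {T \<in> ?B. key T = \<kappa>} = (\<Sum>T'\<in>?C. h ((T0 - F) \<union> T'))"
      unfolding T0(2) fiber[OF T0(1)] by (simp add: sum.reindex[OF inj])
    also have "\<dots> = sum h ?C"
    proof (rule sum.cong[OF refl])
      fix T' assume "T' \<in> ?C"
      then have "((T0 - F) \<union> T') \<inter> F = T' \<inter> F" by blast
      then show "h ((T0 - F) \<union> T') = h T'" using h by metis
    qed
    also have "\<dots> = card ?C * uavg ?C h"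
      using bases_nonempty[OF fin_cl, of en "{}" T0] finite_bases[OF fin_cl, of en "{}" T0]
      by (simp add: uavg_def)
    also have "\<dots> = (\<Sum>T\<in>{T \<in> ?B. key T = \<kappa>}. uavg ?C h)"
      unfolding T0(2) fiber[OF T0(1)] by (simp add: card_image[OF inj])
    also have "\<dots> = sum (\<lambda>T. uavg (bases en {} (cl T)) h) {T \<in> ?B. key T = \<kappa>}"
      by (rule sum.cong) (auto simp: T0(2) key_def)
    finally show ?thesis .
  qed
  then have "(\<Sum>\<kappa>\<in>key ` ?B. sum h {T \<in> ?B. key T = \<kappa>}) =
      (\<Sum>\<kappa>\<in>key ` ?B. sum (\<lambda>T. uavg (bases en {} (cl T)) h) {T \<in> ?B. key T = \<kappa>})"
    by (rule sum.cong[OF refl])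
  then have "sum h ?B = sum (\<lambda>T. uavg (bases en {} (cl T)) h) ?B"
    by (simp only: sum.image_gen[OF fin_B, symmetric])
  then show ?thesis by (simp add: uavg_def cl_def)
qed

text \<open>The wiring glues only vertices of a common block, which \<open>C\<close> connects, so
  monotonicity under identification applies.\<close>

lemma forest_avg_le_uavg:
  assumes fin: "finite C" and two: "two_ended en C" and h: "mono h"
  shows "forest_avg en W C h \<le> uavg (bases en {} C) h"
proof -
  let ?R = "wire W \<inter> con en {} C"
  have "bases en ?R C = bases en ?R (touching en W C)"
  proof (rule bases_remove_loops[OF touching_subset])
    fix e assume e: "e \<in> C - touching en W C"
    then have "en e \<times> en e \<subseteq> wire W" by (auto simp: touching_def wire_def)
    moreover have "en e \<times> en e \<subseteq> con en {} C" using e con_edges[of e C en "{}"] by simp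
    ultimately show "en e \<times> en e \<subseteq> con en ?R {}" using con_rels[of ?R en "{}"] by blast
  qed
  then have "forest_avg en W C h = uavg (bases en ?R C) h" by (simp add: forest_avg_def)
  also have "\<dots> \<le> uavg (bases en {} C) h"
    by (rule uavg_bases_mono[OF fin two]) (use h in \<open>auto dest: monoD\<close>)
  finally show ?thesis .
qed

lemma uavg_mono: "(\<And>T. T \<in> B \<Longrightarrow> f T \<le> g T) \<Longrightarrow> uavg B f \<le> uavg B g"
  by (simp add: uavg_def divide_right_mono sum_mono)

lemma uavg_forest_avg_le:
  assumes fin: "finite E" and two: "two_ended en E" and F: "F \<subseteq> E"
    and h: "\<And>T. h (T \<inter> F) = h T" and "mono h"
  shows "uavg (bases en R E) (\<lambda>T. forest_avg en W (con_closure en F (T \<inter> F)) h) \<le> uavg (bases en R E) h"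
proof -
  have "uavg (bases en R E) (\<lambda>T. forest_avg en W (con_closure en F (T \<inter> F)) h) \<le>
      uavg (bases en R E) (\<lambda>T. uavg (bases en {} (con_closure en F (T \<inter> F))) h)"
  proof (intro uavg_mono forest_avg_le_uavg)
    fix T
    have "con_closure en F (T \<inter> F) \<subseteq> F" by (auto simp: con_closure_def)
    then show "finite (con_closure en F (T \<inter> F))" "two_ended en (con_closure en F (T \<inter> F))"
      using F fin two_ended_subset[OF two] by (auto intro: finite_subset)
  qed (rule \<open>mono h\<close>)
  also have "\<dots> = uavg (bases en R E) h" using uavg_bases_resample[where h = h and F = F, OF fin two F h, of R] by simp
  finally show ?thesis .
qed

text \<open>Wiring acts only through pairs of endpoints, so the average depends on \<open>T\<close>
  through its touching edges and its connectivity on \<open>X\<close>. For finite \<open>X\<close>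
  this is finite data, which gives both measurability and the limit of partitions.\<close>

lemma forest_avg_restrict:
  assumes X: "\<And>e. e \<in> touching en W T \<Longrightarrow> en e \<subseteq> X"
  shows "forest_avg en W T h =
    uavg (bases en (wire W \<inter> (con en {} T \<inter> X \<times> X)) (touching en W T)) h"
proof -
  let ?R = "wire W \<inter> con en {} T" and ?R' = "wire W \<inter> (con en {} T \<inter> X \<times> X)"
  have "bases en ?R (touching en W T) = bases en ?R' (touching en W T)"
  proof (rule bases_restrict[OF X])
    have "con en ?R' {} \<subseteq> con en ?R {}" by (rule con_mono) auto
    moreover have "(u, v) \<in> con en ?R' {}" if "(u, v) \<in> con en ?R {}" "u \<in> X" "v \<in> X" for u v
    proof -
      have "u = v \<or> (u, v) \<in> ?R'" using that unfolding con_wire_inter_empty by blast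
      then show ?thesis using con_rel[of u v ?R' en "{}"] by auto
    qed
    ultimately show "con en ?R {} \<inter> X \<times> X = con en ?R' {} \<inter> X \<times> X" by blast
  qed
  then show ?thesis by (simp add: forest_avg_def)
qed

section \<open>Measurability of the resampling kernel\<close>

context locally_finite_graph
begin

lemma countable_edges: "countable (edges G)"
proof -
  obtain o' where o': "o' \<in> verts G" using connected by (auto simp: connected_graph_def)
  have "edges G \<subseteq> (\<Union>n. touching en (graph_ball o' n) (edges G))"
  proof
    fix e assume e: "e \<in> edges G"
    then obtain u where u: "u \<in> en e" using edge_nonempty by blast
    then have "{u} \<subseteq> verts G" using e edge_ends by blast
    then have "\<forall>\<^sub>F n in sequentially. {u} \<subseteq> graph_ball o' n"
      using graph_ball_exhausts[OF o'] unfolding exhausts_def by blast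
    then obtain n where "\<forall>m\<ge>n. {u} \<subseteq> graph_ball o' m" unfolding eventually_sequentially ..
    then have "u \<in> graph_ball o' n" by simp
    then show "e \<in> (\<Union>n. touching en (graph_ball o' n) (edges G))" using e u by (auto simp: touching_def)
  qed
  moreover have "countable (\<Union>n. touching en (graph_ball o' n) (edges G))"
    by (rule countable_UN) (simp_all add: countable_finite finite_touching finite_graph_ball)
  ultimately show ?thesis by (rule countable_subset)
qed

text \<open>A connection is witnessed by a finite set of edges, and there are countably many such
  sets.\<close>

lemma con_event_sets: "{T \<in> Pow (edges G). (u, v) \<in> con en {} T} \<in> sets (subgraph_space G)"
proof -
  let ?I = "{S. finite S \<and> S \<subseteq> edges G \<and> (u, v) \<in> con en {} S}"
  have "{T \<in> Pow (edges G). (u, v) \<in> con en {} T} = (\<Union>S\<in>?I. {T \<in> Pow (edges G). S \<subseteq> T})"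
  proof (intro equalityI subsetI)
    fix T assume "T \<in> {T \<in> Pow (edges G). (u, v) \<in> con en {} T}"
    then have T: "T \<subseteq> edges G" "(u, v) \<in> con en {} T" by auto
    obtain S where "S \<subseteq> T" "finite S" "(u, v) \<in> con en {} S" using con_finite_witness[OF T(2)] by blast
    then show "T \<in> (\<Union>S\<in>?I. {T \<in> Pow (edges G). S \<subseteq> T})" using T by blast
  next
    fix T assume "T \<in> (\<Union>S\<in>?I. {T \<in> Pow (edges G). S \<subseteq> T})"
    then obtain S where S: "(u, v) \<in> con en {} S" "T \<subseteq> edges G" "S \<subseteq> T" by blast
    have "con en {} S \<subseteq> con en {} T" using S by (intro con_mono) auto
    then show "T \<in> {T \<in> Pow (edges G). (u, v) \<in> con en {} T}" using S by blast
  qed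
  moreover have "countable {S. S \<subseteq> edges G \<and> finite S}"
    using countable_Collect_finite_subset[OF countable_edges] by (simp add: conj_commute)
  then have "countable ?I" by (rule countable_subset[rotated]) auto
  ultimately show ?thesis
    using superset_event_sets by (auto intro!: sets.countable_UN')
qed

lemma forest_avg_measurable:
  assumes W: "finite W"
  shows "(\<lambda>T. forest_avg en W T h) \<in> borel_measurable (subgraph_space G)"
proof -
  let ?M = "subgraph_space G" and ?E = "touching en W (edges G)"
  define X where "X = (\<Union>e\<in>?E. en e)"
  have finE: "finite ?E" using W by (rule finite_touching)
  have finX: "finite X" unfolding X_def using finE finite_ends touching_subset[of en W "edges G"] by blast
  let ?A = "Pow ?E \<times> Pow (X \<times> X)"
  define \<Phi> where "\<Phi> T = (T \<inter> ?E, con en {} T \<inter> X \<times> X)" for T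
  have "\<Phi> \<in> measurable ?M (count_space ?A)"
    unfolding measurable_count_space_eq2[OF finite_cartesian_product[OF finite_Pow_iff[THEN iffD2, OF finE]
        finite_Pow_iff[THEN iffD2, OF finite_cartesian_product[OF finX finX]]]]
  proof (intro conjI ballI)
    show "\<Phi> \<in> space ?M \<rightarrow> ?A" by (auto simp: \<Phi>_def)
    fix p assume "p \<in> ?A"
    then obtain a b where p: "p = (a, b)" "b \<subseteq> X \<times> X" by auto
    have "{T \<in> space ?M. \<forall>q\<in>X \<times> X. q \<in> con en {} T \<longleftrightarrow> q \<in> b} \<in> sets ?M"
    proof (rule sets.sets_Collect_finite_All)
      fix q assume "q \<in> X \<times> X"
      obtain u v where q: "q = (u, v)" by (cases q)
      have m: "{T \<in> space ?M. q \<in> con en {} T} \<in> sets ?M"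
        using con_event_sets[of u v] by (simp add: q Pow_def)
      show "{T \<in> space ?M. (q \<in> con en {} T) = (q \<in> b)} \<in> sets ?M"
        using m sets.sets_Collect_neg[OF m] by (cases "q \<in> b") auto
    qed (use finX in simp)
    moreover have "{T \<in> Pow (edges G). T \<inter> ?E = a} \<in> sets ?M" by (rule cylinder_event_sets[OF finE])
    moreover have "con en {} T \<inter> X \<times> X = b \<longleftrightarrow> (\<forall>q\<in>X \<times> X. q \<in> con en {} T \<longleftrightarrow> q \<in> b)" for T
      using p(2) by blast
    then have "\<Phi> -` {p} \<inter> space ?M = {T \<in> Pow (edges G). T \<inter> ?E = a} \<inter>
        {T \<in> space ?M. \<forall>q\<in>X \<times> X. q \<in> con en {} T \<longleftrightarrow> q \<in> b}"
      unfolding \<Phi>_def p(1) by auto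
    ultimately show "\<Phi> -` {p} \<inter> space ?M \<in> sets ?M" by (simp only: sets.Int)
  qed
  then have m: "(\<lambda>T. (\<lambda>(a, b). uavg (bases en (wire W \<inter> b) a) h) (\<Phi> T)) \<in> borel_measurable ?M"
    by (rule measurable_compose) simp
  have eq: "forest_avg en W T h = (\<lambda>(a, b). uavg (bases en (wire W \<inter> b) a) h) (\<Phi> T)"
    if "T \<in> space ?M" for T
  proof -
    have t: "T \<inter> ?E = touching en W T" using that by (auto simp: touching_def)
    have "en e \<subseteq> X" if "e \<in> touching en W T" for e using that t by (auto simp: X_def)
    from forest_avg_restrict[of en W T X h, OF this] show ?thesis by (simp add: \<Phi>_def t)
  qed
  show ?thesis by (rule measurable_cong[THEN iffD2, OF eq m])
qed

text \<open>On a generator closed under intersections the kernel is a pointwise limit of finite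
  averages, each a function of finite data.\<close>

lemma WSF_components_measurable:
  "(\<lambda>T. WSF_components G (spanning_subgraph G T)) \<in>
    measurable (subgraph_space G) (prob_algebra (subgraph_space G))"
proof (rule measurable_prob_algebra_generated[OF sets_subgraph_space_superset Int_stable_superset_events
      superset_events_Pow])
  obtain o' where o': "o' \<in> verts G" using connected by (auto simp: connected_graph_def)
  note ex = graph_ball_exhausts[OF o']
  show "prob_space (WSF_components G (spanning_subgraph G T))" if "T \<in> space (subgraph_space G)" for T
    using that by (intro prob_space_WSF_components) simp
  fix A assume "A \<in> superset_events G"
  then obtain S where S: "finite S" "S \<subseteq> edges G" and A: "A = {T \<in> Pow (edges G). S \<subseteq> T}"
    by (auto simp: superset_events_def)
  have "(\<lambda>T. measure (WSF_components G (spanning_subgraph G T)) A) \<in> borel_measurable (subgraph_space G)"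
  proof (rule borel_measurable_LIMSEQ_real)
    show "(\<lambda>n. forest_avg en (graph_ball o' n) T (\<lambda>F. of_bool (S \<subseteq> F)))
      \<longlonglongrightarrow> measure (WSF_components G (spanning_subgraph G T)) A" if "T \<in> space (subgraph_space G)" for T
      unfolding A using that by (intro forest_avg_tendsto ex S) simp
  qed (intro forest_avg_measurable finite_graph_ball)
  then have m: "(\<lambda>T. ennreal (measure (WSF_components G (spanning_subgraph G T)) A)) \<in> borel_measurable (subgraph_space G)"
    by simp
  have eq: "emeasure (WSF_components G (spanning_subgraph G T)) A =
      ennreal (measure (WSF_components G (spanning_subgraph G T)) A)" if "T \<in> space (subgraph_space G)" for T
  proof -
    interpret prob_space "WSF_components G (spanning_subgraph G T)"
      using that by (intro prob_space_WSF_components) simp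
    show ?thesis by (rule emeasure_eq_measure)
  qed
  show "(\<lambda>T. emeasure (WSF_components G (spanning_subgraph G T)) A) \<in> borel_measurable (subgraph_space G)"
    by (rule measurable_cong[THEN iffD2, OF eq m])
qed simp

end

lemma uavg_abs_le:
  assumes "finite B" "B \<noteq> {}" "\<And>T. \<bar>h T\<bar> \<le> c"
  shows "\<bar>uavg B h\<bar> \<le> c"
  using uavg_le[OF assms(1,2), of h c] uavg_ge[OF assms(1,2), of "- c" h] assms(3)
  by (auto simp: abs_le_iff minus_le_iff)

section \<open>The resampled law as a limit of blockwise wired averages\<close>

context locally_finite_graph
begin

definition closure_map :: "'e set \<Rightarrow> 'e set" where
  "closure_map F = edges (component_closure G (spanning_subgraph G F))"

lemma closure_map_eq:
  assumes F: "F \<subseteq> edges G"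
  shows "closure_map F = con_closure en (edges G) F"
proof -
  have "(\<exists>C\<in>comps F. en e \<subseteq> C) \<longleftrightarrow> en e \<times> en e \<subseteq> con en {} F" if e: "e \<in> edges G" for e
  proof
    assume "\<exists>C\<in>comps F. en e \<subseteq> C"
    then obtain C where C: "C \<in> comps F" "en e \<subseteq> C" by blast
    show "en e \<times> en e \<subseteq> con en {} F"
    proof clarify
      fix x y assume "x \<in> en e" "y \<in> en e"
      then have "x \<in> C" "y \<in> C" using C by auto
      then show "(x, y) \<in> con en {} F" using comps_mem_iff[OF F C(1), of x y] by simp
    qed
  next
    assume A: "en e \<times> en e \<subseteq> con en {} F"
    obtain u where u: "u \<in> en e" using edge_nonempty[OF e] by blast
    then have "u \<in> verts G" using edge_ends[OF e] by blast
    then have "{v. (u, v) \<in> con en {} F} \<in> comps F" unfolding comps_eq[OF F] by blast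
    moreover have "en e \<subseteq> {v. (u, v) \<in> con en {} F}" using A u by blast
    ultimately show "\<exists>C\<in>comps F. en e \<subseteq> C" by blast
  qed
  then show ?thesis
    unfolding closure_map_def component_closure_def con_closure_def by auto
qed

lemma closure_map_subset: "F \<subseteq> edges G \<Longrightarrow> closure_map F \<subseteq> edges G"
  by (simp add: closure_map_eq con_closure_def)

lemma con_closure_map: "F \<subseteq> edges G \<Longrightarrow> con en {} (closure_map F) = con en {} F"
  by (simp add: closure_map_eq con_con_closure)

lemma closure_map_measurable: "closure_map \<in> measurable (subgraph_space G) (subgraph_space G)"
proof (rule measurable_subgraph_spaceI)
  let ?M = "subgraph_space G"
  show "closure_map F \<subseteq> edges G" if "F \<in> space ?M" for F
    using that closure_map_subset by simp
  fix e assume e: "e \<in> edges G"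
  have "{F \<in> space ?M. \<forall>q\<in>en e \<times> en e. q \<in> con en {} F} \<in> sets ?M"
  proof (rule sets.sets_Collect_finite_All)
    show "{F \<in> space ?M. q \<in> con en {} F} \<in> sets ?M" for q
      using con_event_sets[of "fst q" "snd q"] by (simp add: Pow_def)
  qed (use finite_ends[OF e] in simp)
  moreover have "{F \<in> space ?M. e \<in> closure_map F} = {F \<in> space ?M. \<forall>q\<in>en e \<times> en e. q \<in> con en {} F}"
    using e by (auto simp: closure_map_eq con_closure_def)
  ultimately show "{F \<in> space ?M. e \<in> closure_map F} \<in> sets ?M" by simp
qed

definition resampled :: "'e set measure" where
  "resampled = WSF_random G (distr (WSF G) (subgraph_space G) closure_map)"

lemma closure_map_measurable_WSF [measurable]: "closure_map \<in> measurable (WSF G) (subgraph_space G)"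
  using closure_map_measurable by (simp cong: measurable_cong_sets)

lemma kernel_measurable:
  "(\<lambda>T. WSF_components G (spanning_subgraph G T)) \<in>
    measurable (distr (WSF G) (subgraph_space G) closure_map) (subprob_algebra (subgraph_space G))"
  using measurable_prob_algebraD[OF WSF_components_measurable] by (simp cong: measurable_cong_sets)

lemma sets_resampled [simp]: "sets resampled = sets (subgraph_space G)"
  unfolding resampled_def WSF_random_def
  by (rule sets_bind[where N = "subgraph_space G"]) auto

lemma prob_space_resampled: "prob_space resampled"
proof -
  interpret D: prob_space "distr (WSF G) (subgraph_space G) closure_map"
    by (rule prob_space.prob_space_distr[OF prob_space_WSF closure_map_measurable_WSF])
  show ?thesis
    unfolding resampled_def WSF_random_def
  proof (rule D.prob_space_bind[OF _ kernel_measurable])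
    show "AE T in distr (WSF G) (subgraph_space G) closure_map.
        prob_space (WSF_components G (spanning_subgraph G T))"
      by (rule AE_I2) (simp add: prob_space_WSF_components)
  qed
qed

lemma measurable_forest_avg_closure [measurable]:
  "finite W \<Longrightarrow> (\<lambda>F. forest_avg en W (closure_map F) h) \<in> borel_measurable (WSF G)"
  using measurable_compose[OF closure_map_measurable_WSF forest_avg_measurable] .

lemma finite_touching_sub: "finite W \<Longrightarrow> T \<subseteq> edges G \<Longrightarrow> finite (touching en W T)"
  by (rule finite_subset[OF _ finite_touching[of W]]) (auto simp: touching_def)

lemma forest_avg_abs_le:
  assumes "finite W" "T \<subseteq> edges G" "\<And>T. \<bar>h T\<bar> \<le> c"
  shows "\<bar>forest_avg en W T h\<bar> \<le> c"
  unfolding forest_avg_def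
  using finite_touching_sub[OF assms(1,2)] assms(3)
  by (intro uavg_abs_le finite_bases bases_nonempty)

lemma integrable_forest_avg:
  assumes "finite W" "\<And>T. \<bar>h T\<bar> \<le> c"
  shows "integrable (WSF G) (\<lambda>F. forest_avg en W (closure_map F) h)"
proof -
  interpret prob_space "WSF G" by (rule prob_space_WSF)
  show ?thesis
  proof (rule integrable_const_bound)
    show "AE F in WSF G. norm (forest_avg en W (closure_map F) h) \<le> c"
      by (rule AE_I2) (use assms closure_map_subset in \<open>auto intro!: forest_avg_abs_le\<close>)
  qed (use assms in measurable)
qed

text \<open>Dominated convergence over the forest \<open>F\<close>: for fixed \<open>F\<close> the
  averages converge to the conditional probability, and averages of indicators are bounded by
  1.\<close>

lemma resampled_superset_tendsto:
  assumes ex: "exhausts W (verts G)" and S: "finite S" "S \<subseteq> edges G"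
  shows "(\<lambda>n. \<integral>F. forest_avg en (W n) (closure_map F) (\<lambda>T. of_bool (S \<subseteq> T)) \<partial>WSF G) \<longlonglongrightarrow>
    measure resampled {T \<in> Pow (edges G). S \<subseteq> T}"
proof -
  let ?A = "{T \<in> Pow (edges G). S \<subseteq> T}"
  let ?K = "\<lambda>T. WSF_components G (spanning_subgraph G T)"
  let ?D = "distr (WSF G) (subgraph_space G) closure_map"
  interpret WSF: prob_space "WSF G" by (rule prob_space_WSF)
  interpret N: prob_space resampled by (rule prob_space_resampled)
  have A: "?A \<in> sets (subgraph_space G)" by (rule superset_event_sets[OF S(1)])
  have finW: "finite (W n)" for n using ex by (simp add: exhausts_def)
  have lim: "(\<lambda>n. forest_avg en (W n) (closure_map F) (\<lambda>T. of_bool (S \<subseteq> T))) \<longlonglongrightarrow>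
      measure (?K (closure_map F)) ?A" if "F \<in> space (WSF G)" for F
    using that by (intro forest_avg_tendsto ex S closure_map_subset) simp
  have meas: "(\<lambda>F. measure (?K (closure_map F)) ?A) \<in> borel_measurable (WSF G)"
    by (rule borel_measurable_LIMSEQ_real[OF lim]) (simp_all add: finW measurable_forest_avg_closure)
  have K: "emeasure (?K T) ?A = ennreal (measure (?K T) ?A)" if "T \<subseteq> edges G" for T
  proof -
    interpret prob_space "?K T" by (rule prob_space_WSF_components[OF that])
    show ?thesis by (rule emeasure_eq_measure)
  qed
  have K1: "measure (?K T) ?A \<le> 1" if "T \<subseteq> edges G" for T
    using prob_space.prob_le_1[OF prob_space_WSF_components[OF that]] .
  have "emeasure resampled ?A = (\<integral>\<^sup>+T. emeasure (?K T) ?A \<partial>?D)"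
    unfolding resampled_def WSF_random_def
    by (rule emeasure_bind[OF _ kernel_measurable A]) auto
  also have "\<dots> = (\<integral>\<^sup>+F. emeasure (?K (closure_map F)) ?A \<partial>WSF G)"
    by (rule nn_integral_distr[OF closure_map_measurable_WSF])
      (use measurable_emeasure_kernel[OF kernel_measurable A] in \<open>simp cong: measurable_cong_sets\<close>)
  also have "\<dots> = (\<integral>\<^sup>+F. ennreal (measure (?K (closure_map F)) ?A) \<partial>WSF G)"
    by (rule nn_integral_cong) (use K[OF closure_map_subset] in simp)
  also have "\<dots> = ennreal (\<integral>F. measure (?K (closure_map F)) ?A \<partial>WSF G)"
  proof (rule nn_integral_eq_integral)
    show "integrable (WSF G) (\<lambda>F. measure (?K (closure_map F)) ?A)"
      by (rule WSF.integrable_const_bound[where B = 1, OF _ meas])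
        (rule AE_I2, use K1[OF closure_map_subset] in simp)
  qed simp
  finally have eq: "measure resampled ?A = (\<integral>F. measure (?K (closure_map F)) ?A \<partial>WSF G)"
    by (simp add: N.emeasure_eq_measure)
  show ?thesis
    unfolding eq
  proof (rule integral_dominated_convergence[where w = "\<lambda>_. 1"])
    show "AE F in WSF G. (\<lambda>n. forest_avg en (W n) (closure_map F) (\<lambda>T. of_bool (S \<subseteq> T))) \<longlonglongrightarrow>
        measure (?K (closure_map F)) ?A" by (rule AE_I2) (rule lim)
    show "AE F in WSF G. norm (forest_avg en (W n) (closure_map F) (\<lambda>T. of_bool (S \<subseteq> T))) \<le> 1" for n
      by (rule AE_I2) (use finW closure_map_subset in \<open>auto intro!: forest_avg_abs_le\<close>)
  qed (use meas finW in \<open>auto intro: measurable_forest_avg_closure\<close>)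
qed

section \<open>Domination by the wired spanning forest\<close>

lemma edges_eventually_touching:
  assumes ex: "exhausts B (verts G)" and S: "finite S" "S \<subseteq> edges G"
  shows "\<forall>\<^sub>F k in sequentially. S \<subseteq> touching en (B k) (edges G)"
proof -
  have "finite (\<Union>e\<in>S. en e)" "(\<Union>e\<in>S. en e) \<subseteq> verts G" using S finite_ends edge_ends by blast+
  then have "\<forall>\<^sub>F n in sequentially. (\<Union>e\<in>S. en e) \<subseteq> B n" using ex unfolding exhausts_def by blast
  then show ?thesis
  proof eventually_elim
    case (elim k)
    show ?case
    proof
      fix e assume e: "e \<in> S"
      then have "en e \<noteq> {}" using edge_nonempty S by blast
      then show "e \<in> touching en (B k) (edges G)" using elim e S unfolding touching_def by blast
    qed
  qed
qed

text \<open>Two vertices joined in \<open>F\<close> are joined by a finite path, hence inside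
  \<open>E k\<close> for large \<open>k\<close>. Only the finitely many pairs in
  \<open>X \<times> X\<close> matter to the average, so it becomes constant rather than merely
  convergent.\<close>

lemma forest_avg_local_eventually:
  assumes ex: "exhausts B (verts G)" and F: "F \<subseteq> edges G" and W: "finite W"
  defines "E \<equiv> \<lambda>k. touching en (B k) (edges G)"
  shows "\<forall>\<^sub>F k in sequentially.
    forest_avg en W (con_closure en (E k) (F \<inter> E k)) h = forest_avg en W (closure_map F) h"
proof -
  let ?EW = "touching en W (edges G)"
  define X where "X = (\<Union>e\<in>?EW. en e)"
  have finEW: "finite ?EW" using W by (rule finite_touching)
  have finX: "finite X" unfolding X_def using finEW finite_ends touching_subset[of en W "edges G"] by blast
  have "\<forall>\<^sub>F k in sequentially. q \<in> con en {} (F \<inter> E k) \<longleftrightarrow> q \<in> con en {} F" for q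
  proof (cases "q \<in> con en {} F")
    case True
    obtain u v where q: "q = (u, v)" by (cases q)
    obtain S where S: "S \<subseteq> F" "finite S" "(u, v) \<in> con en {} S"
      using con_finite_witness[of u v en F] True q by blast
    have "\<forall>\<^sub>F k in sequentially. S \<subseteq> E k"
      unfolding E_def using S F by (intro edges_eventually_touching ex) auto
    then show ?thesis
    proof eventually_elim
      case (elim k)
      have "con en {} S \<subseteq> con en {} (F \<inter> E k)" using elim S by (intro con_mono) auto
      then show ?case using S True q by blast
    qed
  next
    case False
    have "con en {} (F \<inter> E k) \<subseteq> con en {} F" for k by (rule con_mono) auto
    then show ?thesis using False by (intro always_eventually) blast
  qed
  then have "\<forall>\<^sub>F k in sequentially. \<forall>q\<in>X \<times> X. q \<in> con en {} (F \<inter> E k) \<longleftrightarrow> q \<in> con en {} F"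
    using finX by (intro eventually_ball_finite) auto
  moreover have "\<forall>\<^sub>F k in sequentially. ?EW \<subseteq> E k"
    unfolding E_def by (intro edges_eventually_touching ex finEW touching_subset)
  ultimately show ?thesis
  proof eventually_elim
    case (elim k)
    let ?Fk = "F \<inter> E k" and ?Ck = "con_closure en (E k) (F \<inter> E k)"
    have enX: "en e \<subseteq> X" if "e \<in> ?EW" for e using that by (auto simp: X_def)
    have Ek: "E k \<subseteq> edges G" by (simp add: E_def touching_subset)
    have cons: "con en {} ?Ck = con en {} ?Fk" "con en {} (closure_map F) = con en {} F"
      using F by (simp_all add: con_con_closure con_closure_map)
    have sq: "en e \<times> en e \<subseteq> con en {} ?Fk \<longleftrightarrow> en e \<times> en e \<subseteq> con en {} F" if "e \<in> ?EW" for e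
      using elim(1) enX[OF that] by blast
    have t: "touching en W ?Ck = touching en W (closure_map F)"
    proof (rule set_eqI)
      fix e
      have "e \<in> touching en W ?Ck \<longleftrightarrow> e \<in> ?EW \<and> e \<in> E k \<and> en e \<times> en e \<subseteq> con en {} ?Fk"
        using Ek by (auto simp: touching_def con_closure_def)
      also have "\<dots> \<longleftrightarrow> e \<in> ?EW \<and> en e \<times> en e \<subseteq> con en {} F"
        using elim(2) sq[of e] by blast
      also have "\<dots> \<longleftrightarrow> e \<in> touching en W (closure_map F)"
        unfolding closure_map_eq[OF F] by (auto simp: touching_def con_closure_def)
      finally show "e \<in> touching en W ?Ck \<longleftrightarrow> e \<in> touching en W (closure_map F)" .
    qed
    have tX: "en e \<subseteq> X" if "e \<in> touching en W (closure_map F)" for e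
      using that closure_map_subset[OF F] by (intro enX) (auto simp: touching_def)
    have "con en {} ?Fk \<inter> X \<times> X = con en {} F \<inter> X \<times> X" using elim(1) by blast
    then show ?case
      using forest_avg_restrict[of en W ?Ck X h] forest_avg_restrict[of en W "closure_map F" X h] tX
      unfolding t cons by simp
  qed
qed

lemma borel_measurable_local:
  assumes "finite S" "S \<subseteq> edges G"
  shows "(\<lambda>F. g (F \<inter> S) :: real) \<in> borel_measurable (WSF G)"
proof -
  have "(\<lambda>F. F \<inter> S) \<in> measurable (WSF G) (count_space (Pow S))"
    unfolding measurable_count_space_eq2[OF finite_Pow_iff[THEN iffD2, OF assms(1)]]
  proof (intro conjI ballI)
    fix a assume "a \<in> Pow S"
    have "(\<lambda>F. F \<inter> S) -` {a} \<inter> space (WSF G) = {T \<in> Pow (edges G). T \<inter> S = a}" by auto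
    then show "(\<lambda>F. F \<inter> S) -` {a} \<inter> space (WSF G) \<in> sets (WSF G)"
      using cylinder_event_sets[OF assms(1)] by simp
  qed simp
  then show ?thesis by (rule measurable_compose) simp
qed

text \<open>For a fixed window \<open>E k\<close> both sides depend on finitely many edges, so the
  inequality for uniform spanning trees on \<open>B n\<close> passes to the limit in
  \<open>n\<close>. Letting \<open>k\<close> grow then replaces the partition seen in the window by
  that of the whole forest, with \<open>W\<close> unchanged.\<close>

lemma resampled_domination:
  assumes W: "finite W" and S: "finite S" "S \<subseteq> edges G"
    and h: "mono h" "\<And>T. h (T \<inter> S) = h T" "\<And>T. \<bar>h T\<bar> \<le> c"
  shows "(\<integral>F. forest_avg en W (closure_map F) h \<partial>WSF G) \<le> (\<integral>F. h F \<partial>WSF G)"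
proof -
  interpret prob_space "WSF G" by (rule prob_space_WSF)
  obtain o' where o': "o' \<in> verts G" using connected by (auto simp: connected_graph_def)
  define B where "B = graph_ball o'"
  have ex: "exhausts B (verts G)" unfolding B_def by (rule graph_ball_exhausts[OF o'])
  have finB: "finite (B k)" for k using ex by (simp add: exhausts_def)
  define E where "E k = touching en (B k) (edges G)" for k
  have finE: "finite (E k)" and E_sub: "E k \<subseteq> edges G" for k
    unfolding E_def by (simp_all add: finite_touching finB touching_subset)
  define g where "g k A = forest_avg en W (con_closure en (E k) A) h" for k A
  have cl_sub: "con_closure en (E k) A \<subseteq> edges G" for k A
    using E_sub by (auto simp: con_closure_def)
  have step: "(\<integral>F. g k (F \<inter> E k) \<partial>WSF G) \<le> (\<integral>F. h F \<partial>WSF G)" if "S \<subseteq> E k" for k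
  proof -
    have hE: "h (T \<inter> E k) = h T" for T
    proof -
      have "T \<inter> E k \<inter> S = T \<inter> S" using that by auto
      then show ?thesis using h(2)[of "T \<inter> E k"] h(2)[of T] by simp
    qed
    have "(\<lambda>n. ust (B n) (\<lambda>T. g k (T \<inter> E k))) \<longlonglongrightarrow> (\<integral>F. g k (F \<inter> E k) \<partial>WSF G)"
      by (rule integral_WSF_local[OF ex finE E_sub])
    moreover have "(\<lambda>n. ust (B n) (\<lambda>T. h (T \<inter> E k))) \<longlonglongrightarrow> (\<integral>F. h (F \<inter> E k) \<partial>WSF G)"
      by (rule integral_WSF_local[OF ex finE E_sub])
    \<comment> \<open>Resampling inside the window requires it to consist of edges of the finite
      tree's graph, which holds once \<open>n\<close> is large.\<close>
    moreover have "\<forall>\<^sub>F n in sequentially. ust (B n) (\<lambda>T. g k (T \<inter> E k)) \<le> ust (B n) (\<lambda>T. h (T \<inter> E k))"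
      using edges_eventually_touching[OF ex finE[of k] E_sub[of k]]
    proof eventually_elim
      case (elim n)
      have "uavg (bases en (wire (B n)) (touching en (B n) (edges G)))
          (\<lambda>T. forest_avg en W (con_closure en (E k) (T \<inter> E k)) h)
        \<le> uavg (bases en (wire (B n)) (touching en (B n) (edges G))) h"
      proof (rule uavg_forest_avg_le)
        show "finite (touching en (B n) (edges G))" by (intro finite_touching finB)
        show "two_ended en (touching en (B n) (edges G))"
          by (rule two_ended_subset[OF two_ended touching_subset])
      qed (use elim hE h(1) in auto)
      then show ?case by (simp add: ust_def g_def hE)
    qed
    ultimately have "(\<integral>F. g k (F \<inter> E k) \<partial>WSF G) \<le> (\<integral>F. h (F \<inter> E k) \<partial>WSF G)"
      by (intro tendsto_le[OF sequentially_bot])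
    then show ?thesis by (simp add: hE)
  qed
  have "(\<lambda>k. \<integral>F. g k (F \<inter> E k) \<partial>WSF G) \<longlonglongrightarrow> (\<integral>F. forest_avg en W (closure_map F) h \<partial>WSF G)"
  proof (rule integral_dominated_convergence[where w = "\<lambda>_. c"])
    show "(\<lambda>F. g k (F \<inter> E k)) \<in> borel_measurable (WSF G)" for k
      by (rule borel_measurable_local[OF finE E_sub])
    show "AE F in WSF G. (\<lambda>k. g k (F \<inter> E k)) \<longlonglongrightarrow> forest_avg en W (closure_map F) h"
    proof (rule AE_I2)
      fix F assume "F \<in> space (WSF G)"
      then have "F \<subseteq> edges G" by simp
      from forest_avg_local_eventually[OF ex this W]
      show "(\<lambda>k. g k (F \<inter> E k)) \<longlonglongrightarrow> forest_avg en W (closure_map F) h"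
        unfolding g_def E_def by (rule tendsto_eventually)
    qed
    show "AE F in WSF G. norm (g k (F \<inter> E k)) \<le> c" for k
      unfolding g_def real_norm_def by (rule AE_I2, rule forest_avg_abs_le[OF W cl_sub h(3)])
  qed (simp_all add: measurable_forest_avg_closure W)
  moreover have "\<forall>\<^sub>F k in sequentially. (\<integral>F. g k (F \<inter> E k) \<partial>WSF G) \<le> (\<integral>F. h F \<partial>WSF G)"
    using edges_eventually_touching[OF ex S] by eventually_elim (rule step, simp add: E_def)
  ultimately show ?thesis by (intro tendsto_upperbound) auto
qed

lemma integral_of_bool_superset:
  assumes "finite S"
  shows "(\<integral>F. of_bool (S \<subseteq> F) \<partial>WSF G) = measure (WSF G) {T \<in> Pow (edges G). S \<subseteq> T}"
proof -
  let ?A = "{T \<in> Pow (edges G). S \<subseteq> T}"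
  have "(\<integral>F. of_bool (S \<subseteq> F) \<partial>WSF G) = (\<integral>F. indicator ?A F \<partial>WSF G :: real)"
    by (rule Bochner_Integration.integral_cong) (auto simp: indicator_def)
  moreover have "?A \<inter> space (WSF G) = ?A" by auto
  ultimately show ?thesis by (simp only: Bochner_Integration.integral_indicator)
qed

lemma resampled_superset_le:
  assumes S: "finite S" "S \<subseteq> edges G"
  shows "measure resampled {T \<in> Pow (edges G). S \<subseteq> T} \<le> measure (WSF G) {T \<in> Pow (edges G). S \<subseteq> T}"
proof -
  obtain o' where o': "o' \<in> verts G" using connected by (auto simp: connected_graph_def)
  note ex = graph_ball_exhausts[OF o']
  have "(\<integral>F. forest_avg en (graph_ball o' n) (closure_map F) (\<lambda>T. of_bool (S \<subseteq> T)) \<partial>WSF G) \<le>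
      measure (WSF G) {T \<in> Pow (edges G). S \<subseteq> T}" for n
    unfolding integral_of_bool_superset[OF S(1), symmetric]
    by (rule resampled_domination[OF finite_graph_ball S, where c = 1]) (auto intro!: mono_of_bool)
  then show ?thesis
    by (intro tendsto_upperbound[OF resampled_superset_tendsto[OF ex S]]) auto
qed

text \<open>The increasing functions \<open>of_bool (S \<subseteq> T)\<close> and \<open>card (S \<inter> T) - of_bool (S \<subseteq> T)\<close> have
  an additive sum, so equality of the one-edge marginals forces equality of the laws.\<close>

lemma resampled_eq_WSF:
  assumes marg: "\<And>e. e \<in> edges G \<Longrightarrow>
    measure (WSF G) {T \<in> Pow (edges G). {e} \<subseteq> T} \<le> measure resampled {T \<in> Pow (edges G). {e} \<subseteq> T}"
  shows "resampled = WSF G"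
proof (rule subgraph_measure_eqI[OF prob_space_resampled prob_space_WSF])
  interpret prob_space "WSF G" by (rule prob_space_WSF)
  obtain o' where o': "o' \<in> verts G" using connected by (auto simp: connected_graph_def)
  note ex = graph_ball_exhausts[OF o']
  fix S assume S: "finite S" "S \<subseteq> edges G"
  show "measure resampled {T \<in> Pow (edges G). S \<subseteq> T} = measure (WSF G) {T \<in> Pow (edges G). S \<subseteq> T}"
  proof (cases "S = {}")
    case True
    have "{T \<in> Pow (edges G). {} \<subseteq> T} = space resampled" "{T \<in> Pow (edges G). {} \<subseteq> T} = space (WSF G)"
      using sets_eq_imp_space_eq[OF sets_resampled] by auto
    then show ?thesis
      using prob_space.prob_space[OF prob_space_resampled] prob_space unfolding True by simp
  next
    case False
    define h where "h T = (\<Sum>e\<in>S. of_bool ({e} \<subseteq> T)) - (of_bool (S \<subseteq> T) :: real)" for T :: "'e set"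
    have h_mono: "mono h"
    proof (rule monoI)
      fix X Y :: "'e set" assume "X \<subseteq> Y"
      show "h X \<le> h Y"
      proof (cases "S \<subseteq> Y \<and> \<not> S \<subseteq> X")
        case True
        \<comment> \<open>The loss of 1 when all of \<open>S\<close> becomes present is paid for by
          an edge \<open>a\<close> that enters at the same time.\<close>
        then obtain a where a: "a \<in> S" "a \<notin> X" "a \<in> Y" by blast
        have "(\<Sum>e\<in>S. of_bool ({e} \<subseteq> X) :: real) + 1 \<le> (\<Sum>e\<in>S. of_bool ({e} \<subseteq> Y))"
        proof -
          have "(\<Sum>e\<in>S - {a}. of_bool ({e} \<subseteq> X) :: real) \<le> (\<Sum>e\<in>S - {a}. of_bool ({e} \<subseteq> Y))"
            using \<open>X \<subseteq> Y\<close> by (intro sum_mono) auto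
          then show ?thesis unfolding sum.remove[OF S(1) a(1)] using a by simp
        qed
        then show ?thesis using True by (simp add: h_def)
      next
        case False
        have "(\<Sum>e\<in>S. of_bool ({e} \<subseteq> X) :: real) \<le> (\<Sum>e\<in>S. of_bool ({e} \<subseteq> Y))"
          using \<open>X \<subseteq> Y\<close> by (intro sum_mono) auto
        moreover have "S \<subseteq> X \<longleftrightarrow> S \<subseteq> Y" using False \<open>X \<subseteq> Y\<close> by blast
        ultimately show ?thesis unfolding h_def by simp
      qed
    qed
    have h_local: "h (T \<inter> S) = h T" for T by (auto simp: h_def intro!: sum.cong)
    have h_bound: "\<bar>h T\<bar> \<le> card S + 1" for T
    proof -
      have "(\<Sum>e\<in>S. of_bool ({e} \<subseteq> T) :: real) \<le> (\<Sum>e\<in>S. 1)" by (intro sum_mono) auto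
      moreover have "0 \<le> (\<Sum>e\<in>S. of_bool ({e} \<subseteq> T) :: real)" by (intro sum_nonneg) auto
      ultimately show ?thesis by (auto simp: h_def abs_le_iff of_bool_def)
    qed
    define p q where "p A = measure resampled {T \<in> Pow (edges G). A \<subseteq> T}"
      and "q A = measure (WSF G) {T \<in> Pow (edges G). A \<subseteq> T}" for A
    \<comment> \<open>Linearity is used on the averages before the limit, so no integral against
      \<open>resampled\<close> has to be evaluated.\<close>
    define I where "I n A = (\<integral>F. forest_avg en (graph_ball o' n) (closure_map F) (\<lambda>T. of_bool (A \<subseteq> T)) \<partial>WSF G)" for n A
    have int: "integrable (WSF G) (\<lambda>F. forest_avg en (graph_ball o' n) (closure_map F) (\<lambda>T. of_bool (A \<subseteq> T)))" for n A
      by (rule integrable_forest_avg[OF finite_graph_ball, where c = 1]) auto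
    have "(\<integral>F. forest_avg en (graph_ball o' n) (closure_map F) h \<partial>WSF G) = (\<Sum>e\<in>S. I n {e}) - I n S" for n
    proof -
      have "(\<lambda>F. forest_avg en (graph_ball o' n) (closure_map F) h) =
          (\<lambda>F. (\<Sum>e\<in>S. forest_avg en (graph_ball o' n) (closure_map F) (\<lambda>T. of_bool ({e} \<subseteq> T))) -
            forest_avg en (graph_ball o' n) (closure_map F) (\<lambda>T. of_bool (S \<subseteq> T)))"
        unfolding forest_avg_def h_def uavg_diff uavg_sum ..
      moreover have "integrable (WSF G) (\<lambda>F. \<Sum>e\<in>S. forest_avg en (graph_ball o' n) (closure_map F)
          (\<lambda>T. of_bool ({e} \<subseteq> T)))"
        by (rule Bochner_Integration.integrable_sum) (rule int)
      moreover have "(\<integral>F. (\<Sum>e\<in>S. forest_avg en (graph_ball o' n) (closure_map F)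
          (\<lambda>T. of_bool ({e} \<subseteq> T))) \<partial>WSF G) = (\<Sum>e\<in>S. I n {e})"
        unfolding I_def by (rule Bochner_Integration.integral_sum) (rule int)
      ultimately show ?thesis
        unfolding I_def[of n S] by (simp only: Bochner_Integration.integral_diff int)
    qed
    moreover have "(\<integral>F. h F \<partial>WSF G) = (\<Sum>e\<in>S. q {e}) - q S"
    proof -
      have i: "integrable (WSF G) (\<lambda>F. of_bool (A \<subseteq> F) :: real)" if "A \<subseteq> S" for A
      proof (rule integrable_const_bound[where B = 1])
        have "(\<lambda>F. of_bool (A \<subseteq> F) :: real) = (\<lambda>F. of_bool (A \<subseteq> F \<inter> S))" using that by auto
        then show "(\<lambda>F. of_bool (A \<subseteq> F) :: real) \<in> borel_measurable (WSF G)"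
          using borel_measurable_local[OF S, of "\<lambda>B. of_bool (A \<subseteq> B)"] by simp
      qed auto
      have "(\<integral>F. h F \<partial>WSF G) = (\<Sum>e\<in>S. \<integral>F. of_bool ({e} \<subseteq> F) \<partial>WSF G) - (\<integral>F. of_bool (S \<subseteq> F) \<partial>WSF G)"
      proof -
        have e: "integrable (WSF G) (\<lambda>F. of_bool ({e} \<subseteq> F) :: real)" if "e \<in> S" for e
          using that by (intro i) simp
        have "(\<integral>F. h F \<partial>WSF G) =
            (\<integral>F. (\<Sum>e\<in>S. of_bool ({e} \<subseteq> F)) \<partial>WSF G) - (\<integral>F. of_bool (S \<subseteq> F) \<partial>WSF G)"
          unfolding h_def
          by (intro Bochner_Integration.integral_diff Bochner_Integration.integrable_sum e i order_refl)
        then show ?thesis using Bochner_Integration.integral_sum[OF e] by simp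
      qed
      moreover have "(\<Sum>e\<in>S. \<integral>F. of_bool ({e} \<subseteq> F) \<partial>WSF G) = (\<Sum>e\<in>S. q {e})"
        unfolding q_def by (intro sum.cong refl integral_of_bool_superset) simp
      moreover have "(\<integral>F. of_bool (S \<subseteq> F) \<partial>WSF G) = q S"
        unfolding q_def by (rule integral_of_bool_superset[OF S(1)])
      ultimately show ?thesis by (simp only:)
    qed
    ultimately have le: "(\<Sum>e\<in>S. I n {e}) - I n S \<le> (\<Sum>e\<in>S. q {e}) - q S" for n
      using resampled_domination[OF finite_graph_ball S h_mono h_local h_bound, of o' n] by simp
    have "(\<lambda>n. (\<Sum>e\<in>S. I n {e}) - I n S) \<longlonglongrightarrow> (\<Sum>e\<in>S. p {e}) - p S"
      unfolding I_def p_def using S by (intro tendsto_diff tendsto_sum resampled_superset_tendsto ex) auto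
    then have "(\<Sum>e\<in>S. p {e}) - p S \<le> (\<Sum>e\<in>S. q {e}) - q S"
      using le by (intro tendsto_upperbound) auto
    moreover have "(\<Sum>e\<in>S. q {e}) \<le> (\<Sum>e\<in>S. p {e})"
      using marg S unfolding p_def q_def by (intro sum_mono) blast
    ultimately have "q S \<le> p S" by simp
    moreover have "p S \<le> q S" unfolding p_def q_def by (rule resampled_superset_le[OF S])
    ultimately show ?thesis unfolding p_def q_def by simp
  qed
qed (simp_all)

end

section \<open>Expected numbers of edges\<close>

text \<open>Every edge of an independent set joins two different classes. Contracting
  \<open>f\<close>, that is, adding its ends to \<open>R\<close>, keeps the remaining edges
  independent and lowers the number of classes; \<open>R\<close> is generalised for this
  reason.\<close>

lemma independent_card_le:
  assumes "finite A" "finite V" "two_ended en A" "\<And>f. f \<in> A \<Longrightarrow> en f \<subseteq> V"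
    and "\<And>f. f \<in> A \<Longrightarrow> \<not> en f \<times> en f \<subseteq> con en R (A - {f})"
  shows "card A \<le> card ((\<lambda>v. con en R {} `` {v}) ` V)"
  using assms(1,3-)
proof (induction A arbitrary: R rule: finite_induct)
  case (insert f A)
  obtain a b where ab: "en f = {a, b}" using insert.prems(1) unfolding two_ended_def by blast
  define R' where "R' = insert (a, b) R"
  let ?Q = "(\<lambda>v. con en R {} `` {v}) ` V" and ?g = "\<lambda>X. con en R' {} `` X"
  have IH: "card A \<le> card ((\<lambda>v. con en R' {} `` {v}) ` V)"
  proof (rule insert.IH)
    show "two_ended en A" using insert.prems(1) by (rule two_ended_subset) auto
    show "en g \<subseteq> V" if "g \<in> A" for g using insert.prems(2) that by simp
    fix g assume g: "g \<in> A"
    have "con en R' (A - {g}) \<subseteq> con en R (insert f A - {g})"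
    proof (rule con_subsetI)
      have "f \<in> insert f A - {g}" using g insert.hyps by auto
      then have "(a, b) \<in> con en R (insert f A - {g})"
        using con_edge[of f "insert f A - {g}" a en b R] ab by simp
      then show "R' \<subseteq> con en R (insert f A - {g})"
        using con_rels[of R en "insert f A - {g}"] by (simp add: R'_def)
      show "en e \<times> en e \<subseteq> con en R (insert f A - {g})" if "e \<in> A - {g}" for e
        using that by (intro con_edges) auto
    qed
    then show "\<not> en g \<times> en g \<subseteq> con en R' (A - {g})" using insert.prems(3)[of g] g by blast
  qed
  have RR': "con en R {} \<subseteq> con en R' {}" unfolding R'_def by (rule con_mono) auto
  have g_class: "?g (con en R {} `` {v}) = con en R' {} `` {v}" for v
  proof
    show "?g (con en R {} `` {v}) \<subseteq> con en R' {} `` {v}"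
    proof clarify
      fix x y assume "(v, x) \<in> con en R {}" "(x, y) \<in> con en R' {}"
      then have "(v, x) \<in> con en R' {}" using RR' by blast
      then show "(v, y) \<in> con en R' {}" using \<open>(x, y) \<in> con en R' {}\<close> by (rule con_trans)
    qed
    show "con en R' {} `` {v} \<subseteq> ?g (con en R {} `` {v})" using con_refl[of v en R "{}"] by blast
  qed
  then have img: "(\<lambda>v. con en R' {} `` {v}) ` V = ?g ` ?Q" by (simp add: image_image)
  have "insert f A - {f} = A" using insert.hyps by auto
  then have "(a, b) \<notin> con en R A"
    using insert.prems(3)[of f] ends_con_iff[of en f a b R A, OF ab] by simp
  then have nab: "(a, b) \<notin> con en R {}" using con_mono[of R R "{}" A en] by blast
  have "con en R {} `` {a} \<noteq> con en R {} `` {b}" using nab con_refl[of b en R "{}"] by blast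
  moreover have "?g (con en R {} `` {a}) = ?g (con en R {} `` {b})"
  proof -
    have r: "(a, b) \<in> con en R' {}" unfolding R'_def by (rule con_rel) simp
    have "con en R' {} `` {a} = con en R' {} `` {b}"
    proof (intro equalityI subsetI)
      fix z assume "z \<in> con en R' {} `` {a}"
      then have "(a, z) \<in> con en R' {}" by simp
      with con_sym[OF r] have "(b, z) \<in> con en R' {}" by (rule con_trans)
      then show "z \<in> con en R' {} `` {b}" by simp
    next
      fix z assume "z \<in> con en R' {} `` {b}"
      then have "(b, z) \<in> con en R' {}" by simp
      with r have "(a, z) \<in> con en R' {}" by (rule con_trans)
      then show "z \<in> con en R' {} `` {a}" by simp
    qed
    then show ?thesis by (simp add: g_class)
  qed
  moreover have "a \<in> V" "b \<in> V" using insert.prems(2)[of f] ab by auto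
  ultimately have "\<not> inj_on ?g ?Q" unfolding inj_on_def by blast
  moreover have finQ: "finite ?Q" using assms(2) by simp
  ultimately have "card (?g ` ?Q) \<noteq> card ?Q" using inj_on_iff_eq_card by blast
  then have "card (?g ` ?Q) < card ?Q" using card_image_le[OF finQ, of ?g] by simp
  then show ?case using IH insert.hyps unfolding img by simp
qed simp

text \<open>A vertex \<open>u\<close> of \<open>W\<close> is peeled off together with an edge that
  leads from it out of \<open>W\<close>. Afterwards both ends of that edge count as outside, so a
  connection that used it may stop there.\<close>

lemma spanning_card_ge:
  assumes "finite W" "finite F" "two_ended en F" "R \<subseteq> wire W"
    and "\<And>v. v \<in> W \<Longrightarrow> \<exists>z. z \<notin> W \<and> (v, z) \<in> con en R F"
  shows "card W \<le> card F"
  using assms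
proof (induction "card W" arbitrary: W F)
  case (Suc n)
  then obtain v where v: "v \<in> W" by (metis card.empty equals0I nat.distinct(1))
  have "\<exists>e\<in>F. \<exists>u\<in>en e. \<exists>w\<in>en e. u \<in> W \<and> w \<notin> W"
  proof (rule ccontr)
    assume n: "\<not> ?thesis"
    obtain z where z: "z \<notin> W" "(v, z) \<in> con en R F" using Suc.prems(5)[OF v] by blast
    have "(v \<in> W) = (z \<in> W)" using z(2)
    proof (rule con_invariant)
      show "(x \<in> W) = (y \<in> W)" if "(x, y) \<in> R" for x y
        using that Suc.prems(4) by (auto simp: wire_def)
      show "(x \<in> W) = (y \<in> W)" if "e \<in> F" "x \<in> en e" "y \<in> en e" for e x y
        using n that by blast
    qed
    then show False using v z by simp
  qed
  then obtain e u w where e: "e \<in> F" "u \<in> en e" "w \<in> en e" "u \<in> W" "w \<notin> W" by blast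
  have uw: "en e = {u, w}"
  proof -
    obtain a b where "en e = {a, b}" using Suc.prems(3) e(1) unfolding two_ended_def by blast
    then show ?thesis using e by auto
  qed
  let ?W = "W - {u}" and ?F = "F - {e}"
  have cW: "card W = Suc (card ?W)" using card.remove[OF Suc.prems(1) e(4)] .
  have "card ?W \<le> card ?F"
  proof (rule Suc.hyps(1))
    show "n = card ?W" using Suc.hyps(2) cW by simp
    show "two_ended en ?F" using Suc.prems(3) by (rule two_ended_subset) auto
    show "R \<subseteq> wire ?W" using Suc.prems(4) by (auto simp: wire_def)
    fix v assume v: "v \<in> ?W"
    then obtain z where z: "z \<notin> W" "(v, z) \<in> con en R F" using Suc.prems(5) by blast
    have "insert e ?F = F" using e by auto
    then have "(v, z) \<in> con en R ?F \<or> (v, u) \<in> con en R ?F \<or> (v, w) \<in> con en R ?F"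
      using z(2) con_insert[of en e u w v z R ?F, OF uw] by auto
    then show "\<exists>z. z \<notin> ?W \<and> (v, z) \<in> con en R ?F" using z(1) e(5) by blast
  qed (use Suc.prems in auto)
  then show ?case using cW card.remove[OF Suc.prems(2) e(1)] by simp
qed simp

text \<open>An edge that misses \<open>W\<close> joins two exterior vertices of one block, and the
  blockwise wiring identifies these.\<close>

lemma con_forest_touching:
  "con en {} T \<subseteq> con en (wire W \<inter> con en {} T) (touching en W T)"
proof (rule con_subsetI)
  let ?R = "wire W \<inter> con en {} T"
  show "en e \<times> en e \<subseteq> con en ?R (touching en W T)" if e: "e \<in> T" for e
  proof (cases "e \<in> touching en W T")
    case True
    then show ?thesis by (rule con_edges)
  next
    case False
    then have "en e \<times> en e \<subseteq> ?R"
      using e con_edges[of e T en "{}"] by (auto simp: touching_def wire_def)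
    then show ?thesis using con_rels[of ?R en "touching en W T"] by blast
  qed
qed simp

text \<open>Blockwise analogue of \<open>ust_mono\<close>: enlarging \<open>W\<close> undoes wiring
  inside the blocks. It makes every finite average of an increasing event a lower bound for its
  limit.\<close>

lemma forest_avg_mono:
  assumes fin: "finite (touching en W' T)" and two: "two_ended en T" and W: "W \<subseteq> W'" and h: "mono h"
  shows "forest_avg en W T h \<le> forest_avg en W' T h"
proof -
  let ?R = "wire W \<inter> con en {} T" and ?R' = "wire W' \<inter> con en {} T"
  have "bases en ?R (touching en W' T) = bases en ?R (touching en W T)"
  proof (rule bases_remove_loops)
    show "touching en W T \<subseteq> touching en W' T" using W by (auto simp: touching_def)
    fix e assume e: "e \<in> touching en W' T - touching en W T"
    then have "en e \<times> en e \<subseteq> ?R"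
      using con_edges[of e T en "{}"] by (auto simp: touching_def wire_def)
    then show "en e \<times> en e \<subseteq> con en ?R {}" using con_rels[of ?R en "{}"] by blast
  qed
  moreover have "uavg (bases en ?R (touching en W' T)) h \<le> uavg (bases en ?R' (touching en W' T)) h"
  proof (rule uavg_bases_mono[OF fin two_ended_subset[OF two touching_subset]])
    show "?R' \<subseteq> ?R" using W by (auto simp: wire_def)
    show "?R \<subseteq> con en ?R' (touching en W' T)" using con_forest_touching[of en T W'] by blast
  qed (use h in \<open>auto dest: monoD\<close>)
  ultimately show ?thesis by (simp add: forest_avg_def)
qed

lemma sum_of_bool_mem:
  assumes "finite E"
  shows "(\<Sum>e\<in>E. of_bool ({e} \<subseteq> T) :: real) = card (E \<inter> T)"
  using assms by (simp add: of_bool_def sum.If_cases Int_def)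

section \<open>Escape from finite sets and expected counts\<close>

context locally_finite_graph
begin

text \<open>A wired tree on a ball containing a finite nonempty \<open>C\<close> must use an edge
  leaving \<open>C\<close>, as the vertex set is infinite; this concerns finitely many edges and so
  passes to the limit. A component contained in \<open>W\<close> would be one of the finitely many
  sets \<open>C\<close> excluded in this way.\<close>

lemma AE_WSF_escapes:
  assumes inf: "infinite (verts G)" and W: "finite W" "W \<subseteq> verts G"
  shows "AE F in WSF G. \<forall>v\<in>W. \<exists>z. z \<notin> W \<and> (v, z) \<in> con en {} F"
proof -
  interpret prob_space "WSF G" by (rule prob_space_WSF)
  obtain o' where o': "o' \<in> verts G" using connected by (auto simp: connected_graph_def)
  note ex = graph_ball_exhausts[OF o']
  define bd where "bd C = {e \<in> touching en C (edges G). \<not> en e \<subseteq> C}" for C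
  have AE1: "AE F in WSF G. F \<inter> bd C \<noteq> {}" if C: "C \<in> Pow W - {{}}" for C
  proof -
    have C': "finite C" "C \<subseteq> verts G" "C \<noteq> {}" using C W finite_subset by auto
    have fin: "finite (bd C)" "bd C \<subseteq> edges G"
      by (rule finite_subset[OF _ finite_touching[OF C'(1)]]) (auto simp: bd_def touching_def)
    obtain z where z: "z \<in> verts G" "z \<notin> C" using inf C'(1) by (metis finite_subset subsetI)
    obtain c where c: "c \<in> C" using C' by blast
    have "\<forall>\<^sub>F n in sequentially. C \<subseteq> graph_ball o' n" using ex C' unfolding exhausts_def by blast
    then have "\<forall>\<^sub>F n in sequentially. ust (graph_ball o' n) (\<lambda>T. of_bool (T \<inter> bd C = {})) = 0"
    proof eventually_elim
      case (elim n)
      let ?W = "graph_ball o' n"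
      have "T \<inter> bd C \<noteq> {}" if T: "T \<in> bases en (wire ?W) (touching en ?W (edges G))" for T
      proof
        assume e: "T \<inter> bd C = {}"
        have TG: "T \<subseteq> edges G" using bases_subset[OF T] touching_subset[of en ?W "edges G"] by (rule order_trans)
        have "(c, z) \<in> con en (wire ?W) T"
          unfolding bases_con_eq[OF T] by (rule touching_wire_con) (use c C' z in auto)
        then have "(c \<in> C) = (z \<in> C)"
        proof (rule con_invariant)
          show "(x \<in> C) = (y \<in> C)" if "(x, y) \<in> wire ?W" for x y
            using that elim by (auto simp: wire_def)
          show "(x \<in> C) = (y \<in> C)" if f: "f \<in> T" "x \<in> en f" "y \<in> en f" for f x y
          proof -
            have "f \<notin> bd C" "f \<in> edges G" using f e TG by auto
            then have "en f \<subseteq> C \<or> en f \<inter> C = {}" by (auto simp: bd_def touching_def)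
            then show ?thesis using f by blast
          qed
        qed
        then show False using c z by simp
      qed
      then show ?case by (simp add: ust_def uavg_def)
    qed
    then have "(\<lambda>n. ust (graph_ball o' n) (\<lambda>T. of_bool (T \<inter> bd C = {}))) \<longlonglongrightarrow> 0"
      by (rule tendsto_eventually)
    moreover have "(\<lambda>n. ust (graph_ball o' n) (\<lambda>T. of_bool (T \<inter> bd C = {}))) \<longlonglongrightarrow>
        measure (WSF G) {T \<in> Pow (edges G). T \<inter> bd C = {}}"
      by (rule measure_WSF_cylinder[OF ex fin]) simp
    ultimately have "measure (WSF G) {T \<in> Pow (edges G). T \<inter> bd C = {}} = 0"
      using LIMSEQ_unique by blast
    then have "{T \<in> Pow (edges G). T \<inter> bd C = {}} \<in> null_sets (WSF G)"
      using cylinder_event_sets[OF fin(1)] by (intro null_setsI) (simp_all add: emeasure_eq_measure)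
    then show ?thesis by (rule AE_I') auto
  qed
  have "AE F in WSF G. \<forall>C\<in>Pow W - {{}}. F \<inter> bd C \<noteq> {}"
    using W(1) AE1 by (intro AE_finite_allI) auto
  then show ?thesis
  proof (rule AE_mp, intro AE_I2 impI ballI)
    fix F v assume F: "F \<in> space (WSF G)" and bd: "\<forall>C\<in>Pow W - {{}}. F \<inter> bd C \<noteq> {}" and v: "v \<in> W"
    show "\<exists>z. z \<notin> W \<and> (v, z) \<in> con en {} F"
    proof (rule ccontr)
      assume n: "\<not> ?thesis"
      define C where "C = {x. (v, x) \<in> con en {} F}"
      have "C \<in> Pow W - {{}}" using n con_refl[of v en "{}" F] by (auto simp: C_def)
      then obtain f where f: "f \<in> F" "f \<in> bd C" using bd by blast
      then obtain x y where xy: "x \<in> en f" "x \<in> C" "y \<in> en f" "y \<notin> C"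
        by (auto simp: bd_def touching_def)
      have "(x, y) \<in> con en {} F" using con_edge[of f F x en y "{}"] f xy by simp
      moreover have "(v, x) \<in> con en {} F" using xy by (simp add: C_def)
      ultimately have "(v, y) \<in> con en {} F" by (rule con_trans[rotated])
      then show False using xy by (simp add: C_def)
    qed
  qed
qed

definition edge_prob :: "'e \<Rightarrow> real" where
  "edge_prob e = measure (WSF G) {T \<in> Pow (edges G). {e} \<subseteq> T}"

definition resampled_edge_prob :: "'e \<Rightarrow> real" where
  "resampled_edge_prob e = measure resampled {T \<in> Pow (edges G). {e} \<subseteq> T}"

text \<open>A forest whose edges lie inside \<open>V\<close> has at most \<open>card V\<close> of
  them. The bound holds for every tree of every approximation, hence for the limit of
  expectations.\<close>

lemma sum_edge_prob_le:
  assumes V: "finite V" "\<And>e. e \<in> E \<Longrightarrow> en e \<subseteq> V" and E: "finite E" "E \<subseteq> edges G"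
  shows "(\<Sum>e\<in>E. edge_prob e) \<le> card V"
proof -
  obtain o' where o': "o' \<in> verts G" using connected by (auto simp: connected_graph_def)
  let ?B = "graph_ball o'"
  note ex = graph_ball_exhausts[OF o']
  have lim: "(\<lambda>n. ust (?B n) (\<lambda>T. of_bool ({e} \<subseteq> T))) \<longlonglongrightarrow> edge_prob e" if "e \<in> E" for e
  proof -
    have "(\<lambda>n. ust (?B n) (\<lambda>T. of_bool ({e} \<subseteq> T \<inter> {e}))) \<longlonglongrightarrow> (\<integral>T. of_bool ({e} \<subseteq> T \<inter> {e}) \<partial>WSF G)"
      using that E by (intro integral_WSF_local[OF ex, where h = "\<lambda>A. of_bool ({e} \<subseteq> A)"]) auto
    then show ?thesis
      unfolding edge_prob_def using integral_of_bool_superset[of "{e}"] by simp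
  qed
  have "(\<Sum>e\<in>E. ust (?B n) (\<lambda>T. of_bool ({e} \<subseteq> T))) \<le> card V" for n
  proof -
    have "(\<Sum>e\<in>E. ust (?B n) (\<lambda>T. of_bool ({e} \<subseteq> T))) = ust (?B n) (\<lambda>T. \<Sum>e\<in>E. of_bool ({e} \<subseteq> T))"
      unfolding ust_def uavg_sum ..
    also have "\<dots> \<le> card V"
      unfolding ust_def
    proof (rule uavg_le[OF bases_finite_touching bases_nonempty_touching])
      fix T assume T: "T \<in> bases en (wire (?B n)) (touching en (?B n) (edges G))"
      have "card (E \<inter> T) \<le> card ((\<lambda>v. con en {} {} `` {v}) ` V)"
      proof (rule independent_card_le)
        show "two_ended en (E \<inter> T)" by (rule two_ended_subset[OF two_ended]) (use E in auto)
        fix f assume f: "f \<in> E \<inter> T"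
        then have "\<not> en f \<times> en f \<subseteq> con en (wire (?B n)) (T - {f})" using T by (simp add: bases_def)
        moreover have "con en {} (E \<inter> T - {f}) \<subseteq> con en (wire (?B n)) (T - {f})"
          by (rule con_mono) auto
        ultimately show "\<not> en f \<times> en f \<subseteq> con en {} (E \<inter> T - {f})" by blast
      qed (use V E in auto)
      also have "\<dots> \<le> card V" using V(1) by (rule card_image_le)
      finally show "(\<Sum>e\<in>E. of_bool ({e} \<subseteq> T)) \<le> real (card V)"
        unfolding sum_of_bool_mem[OF E(1)] by simp
    qed (simp_all add: finite_graph_ball)
    finally show ?thesis .
  qed
  moreover have "(\<lambda>n. \<Sum>e\<in>E. ust (?B n) (\<lambda>T. of_bool ({e} \<subseteq> T))) \<longlonglongrightarrow> (\<Sum>e\<in>E. edge_prob e)"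
    by (intro tendsto_sum lim)
  ultimately show ?thesis by (intro tendsto_upperbound) auto
qed

text \<open>For almost every \<open>F\<close> each vertex of \<open>W\<close> is joined to the
  exterior within its block, so every blockwise wired forest has at least \<open>card W\<close>
  edges touching \<open>W\<close>. By \<open>forest_avg_mono\<close> the expectation only grows when
  the wiring recedes to infinity.\<close>

lemma sum_resampled_edge_prob_ge:
  assumes inf: "infinite (verts G)" and W: "finite W" "W \<subseteq> verts G"
  shows "card W \<le> (\<Sum>e\<in>touching en W (edges G). resampled_edge_prob e)"
proof -
  interpret prob_space "WSF G" by (rule prob_space_WSF)
  obtain o' where o': "o' \<in> verts G" using connected by (auto simp: connected_graph_def)
  let ?B = "graph_ball o'" and ?E = "touching en W (edges G)"
  note ex = graph_ball_exhausts[OF o']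
  have finE: "finite ?E" using W(1) by (rule finite_touching)
  define J where "J W e = (\<integral>F. forest_avg en W (closure_map F) (\<lambda>T. of_bool ({e} \<subseteq> T)) \<partial>WSF G)" for W e
  have int: "integrable (WSF G) (\<lambda>F. forest_avg en W (closure_map F) (\<lambda>T. of_bool (A \<subseteq> T)))"
    if "finite W" for W A
    by (rule integrable_forest_avg[OF that, where c = 1]) auto
  have "J W e \<le> resampled_edge_prob e" if "e \<in> ?E" for e
  proof -
    have "(\<lambda>n. J (?B n) e) \<longlonglongrightarrow> resampled_edge_prob e"
      unfolding J_def resampled_edge_prob_def
      using that touching_subset[of en W "edges G"] by (intro resampled_superset_tendsto[OF ex]) auto
    moreover have "\<forall>\<^sub>F n in sequentially. W \<subseteq> ?B n" using ex W unfolding exhausts_def by blast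
    then have "\<forall>\<^sub>F n in sequentially. J W e \<le> J (?B n) e"
    proof eventually_elim
      case (elim n)
      show ?case
        unfolding J_def
      proof (rule integral_mono[OF int[OF W(1)] int[OF finite_graph_ball]])
        fix F assume "F \<in> space (WSF G)"
        then have F: "closure_map F \<subseteq> edges G" using closure_map_subset by simp
        show "forest_avg en W (closure_map F) (\<lambda>T. of_bool ({e} \<subseteq> T)) \<le>
            forest_avg en (?B n) (closure_map F) (\<lambda>T. of_bool ({e} \<subseteq> T))"
          by (rule forest_avg_mono[OF finite_touching_sub[OF finite_graph_ball F]
                two_ended_subset[OF two_ended F] elim]) (auto intro!: mono_of_bool)
      qed
    qed
    ultimately show ?thesis by (intro tendsto_lowerbound) auto
  qed
  then have "(\<Sum>e\<in>?E. J W e) \<le> (\<Sum>e\<in>?E. resampled_edge_prob e)" by (rule sum_mono)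
  moreover have "real (card W) \<le> (\<Sum>e\<in>?E. J W e)"
  proof -
    have "real (card W) = (\<integral>F. real (card W) \<partial>WSF G)"
      using prob_space by simp
    also have "\<dots> \<le> (\<integral>F. (\<Sum>e\<in>?E. forest_avg en W (closure_map F) (\<lambda>T. of_bool ({e} \<subseteq> T))) \<partial>WSF G)"
    proof (rule integral_mono_AE)
      show "integrable (WSF G) (\<lambda>F. \<Sum>e\<in>?E. forest_avg en W (closure_map F) (\<lambda>T. of_bool ({e} \<subseteq> T)))"
        by (rule Bochner_Integration.integrable_sum) (rule int[OF W(1)])
      show "AE F in WSF G. real (card W) \<le>
          (\<Sum>e\<in>?E. forest_avg en W (closure_map F) (\<lambda>T. of_bool ({e} \<subseteq> T)))"
        using AE_WSF_escapes[OF inf W]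
      proof (rule AE_mp, intro AE_I2 impI)
        fix F assume "F \<in> space (WSF G)" and esc: "\<forall>v\<in>W. \<exists>z. z \<notin> W \<and> (v, z) \<in> con en {} F"
        then have F: "F \<subseteq> edges G" by simp
        let ?T = "closure_map F" and ?R = "wire W \<inter> con en {} (closure_map F)"
        have TG: "?T \<subseteq> edges G" using F by (rule closure_map_subset)
        have fin: "finite (touching en W ?T)" using W(1) TG by (rule finite_touching_sub)
        have "(\<Sum>e\<in>?E. forest_avg en W ?T (\<lambda>T. of_bool ({e} \<subseteq> T))) =
            uavg (bases en ?R (touching en W ?T)) (\<lambda>T. \<Sum>e\<in>?E. of_bool ({e} \<subseteq> T))"
          unfolding forest_avg_def uavg_sum ..
        moreover have "real (card W) \<le> \<dots>"
        proof (rule uavg_ge[OF finite_bases[OF fin] bases_nonempty[OF fin]])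
          fix T assume T: "T \<in> bases en ?R (touching en W ?T)"
          have TE: "T \<subseteq> ?E" using bases_subset[OF T] TG by (auto simp: touching_def)
          have "card W \<le> card T"
          proof (rule spanning_card_ge[OF W(1)])
            show "finite T" using TE finE by (rule finite_subset)
            show "two_ended en T"
              using TE touching_subset[of en W "edges G"] by (intro two_ended_subset[OF two_ended]) blast
            fix v assume "v \<in> W"
            then obtain z where z: "z \<notin> W" "(v, z) \<in> con en {} F" using esc by blast
            then have "(v, z) \<in> con en {} ?T" using con_closure_map[OF F] by simp
            then have "(v, z) \<in> con en ?R T"
              using con_forest_touching[of en ?T W] unfolding bases_con_eq[OF T] by blast
            then show "\<exists>z. z \<notin> W \<and> (v, z) \<in> con en ?R T" using z by blast
          qed auto
          moreover have "?E \<inter> T = T" using TE by blast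
          ultimately show "real (card W) \<le> (\<Sum>e\<in>?E. of_bool ({e} \<subseteq> T))"
            unfolding sum_of_bool_mem[OF finE] by simp
        qed
        ultimately show "real (card W) \<le> (\<Sum>e\<in>?E. forest_avg en W ?T (\<lambda>T. of_bool ({e} \<subseteq> T)))" by simp
      qed
    qed simp
    also have "\<dots> = (\<Sum>e\<in>?E. J W e)"
      unfolding J_def by (rule Bochner_Integration.integral_sum) (rule int[OF W(1)])
    finally show ?thesis .
  qed
  ultimately show ?thesis by linarith
qed

end

section \<open>Automorphisms\<close>

lemma con_map:
  assumes \<sigma>: "bij \<sigma>" and R: "\<And>u v. (\<sigma> u, \<sigma> v) \<in> R' \<longleftrightarrow> (u, v) \<in> R"
    and en: "\<And>e. e \<in> T \<Longrightarrow> en (\<rho> e) = \<sigma> ` en e"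
  shows "(\<sigma> u, \<sigma> v) \<in> con en R' (\<rho> ` T) \<longleftrightarrow> (u, v) \<in> con en R T"
proof
  have inv: "inv \<sigma> (\<sigma> x) = x" "\<sigma> (inv \<sigma> x) = x" for x
    using \<sigma> by (simp_all add: bij_is_inj bij_is_surj surj_f_inv_f)
  assume "(\<sigma> u, \<sigma> v) \<in> con en R' (\<rho> ` T)"
  then have "((u, inv \<sigma> (\<sigma> u)) \<in> con en R T) = ((u, inv \<sigma> (\<sigma> v)) \<in> con en R T)"
  proof (rule con_invariant[where h = "\<lambda>y. (u, inv \<sigma> y) \<in> con en R T"])
    have *: "((u, x) \<in> con en R T) = ((u, y) \<in> con en R T)" if "(x, y) \<in> con en R T" for x y
      using con_trans[OF _ that] con_trans[OF _ con_sym[OF that]] by blast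
    show "((u, inv \<sigma> x) \<in> con en R T) = ((u, inv \<sigma> y) \<in> con en R T)" if "(x, y) \<in> R'" for x y
    proof (rule *, rule con_rel)
      show "(inv \<sigma> x, inv \<sigma> y) \<in> R" using that R[of "inv \<sigma> x" "inv \<sigma> y"] by (simp add: inv)
    qed
    show "((u, inv \<sigma> x) \<in> con en R T) = ((u, inv \<sigma> y) \<in> con en R T)"
      if e: "e \<in> \<rho> ` T" "x \<in> en e" "y \<in> en e" for e x y
    proof -
      obtain f where f: "f \<in> T" "e = \<rho> f" using e by blast
      then obtain a b where "x = \<sigma> a" "a \<in> en f" "y = \<sigma> b" "b \<in> en f" using e en[OF f(1)] by auto
      then show ?thesis using con_edge[of f T a en b R] f by (intro *) (simp add: inv)
    qed
  qed
  then show "(u, v) \<in> con en R T" by (simp add: inv)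
next
  assume "(u, v) \<in> con en R T"
  then have "((\<sigma> u, \<sigma> u) \<in> con en R' (\<rho> ` T)) = ((\<sigma> u, \<sigma> v) \<in> con en R' (\<rho> ` T))"
  proof (rule con_invariant[where h = "\<lambda>y. (\<sigma> u, \<sigma> y) \<in> con en R' (\<rho> ` T)"])
    have *: "((\<sigma> u, x) \<in> con en R' (\<rho> ` T)) = ((\<sigma> u, y) \<in> con en R' (\<rho> ` T))"
      if "(x, y) \<in> con en R' (\<rho> ` T)" for x y
      using con_trans[OF _ that] con_trans[OF _ con_sym[OF that]] by blast
    show "((\<sigma> u, \<sigma> x) \<in> con en R' (\<rho> ` T)) = ((\<sigma> u, \<sigma> y) \<in> con en R' (\<rho> ` T))" if "(x, y) \<in> R" for x y
      using that by (intro * con_rel) (simp add: R)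
    show "((\<sigma> u, \<sigma> x) \<in> con en R' (\<rho> ` T)) = ((\<sigma> u, \<sigma> y) \<in> con en R' (\<rho> ` T))"
      if "e \<in> T" "x \<in> en e" "y \<in> en e" for e x y
      using that en[OF that(1)] con_edge[of "\<rho> e" "\<rho> ` T" "\<sigma> x" en "\<sigma> y" R'] by (intro *) auto
  qed
  then show "(\<sigma> u, \<sigma> v) \<in> con en R' (\<rho> ` T)" by simp
qed

lemma bases_map:
  assumes \<sigma>: "bij \<sigma>" and \<rho>: "inj \<rho>" and R: "\<And>u v. (\<sigma> u, \<sigma> v) \<in> R' \<longleftrightarrow> (u, v) \<in> R"
    and en: "\<And>e. e \<in> E \<Longrightarrow> en (\<rho> e) = \<sigma> ` en e"
  shows "bases en R' (\<rho> ` E) = (`) \<rho> ` bases en R E"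
proof -
  have sq: "en (\<rho> e) \<times> en (\<rho> e) \<subseteq> con en R' (\<rho> ` T) \<longleftrightarrow> en e \<times> en e \<subseteq> con en R T"
    if "e \<in> E" "T \<subseteq> E" for e T
  proof -
    have "en (\<rho> e) \<times> en (\<rho> e) \<subseteq> con en R' (\<rho> ` T) \<longleftrightarrow>
        (\<forall>x\<in>en e. \<forall>y\<in>en e. (\<sigma> x, \<sigma> y) \<in> con en R' (\<rho> ` T))"
      unfolding en[OF that(1)] by blast
    also have "\<dots> \<longleftrightarrow> (\<forall>x\<in>en e. \<forall>y\<in>en e. (x, y) \<in> con en R T)"
      using con_map[where \<rho> = \<rho> and T = T and en = en and R = R and R' = R', OF \<sigma> R] en that(2) by blast
    also have "\<dots> \<longleftrightarrow> en e \<times> en e \<subseteq> con en R T" by blast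
    finally show ?thesis .
  qed
  have d: "\<rho> ` T - {\<rho> f} = \<rho> ` (T - {f})" for T f using \<rho> by (auto simp: inj_def)
  have iff: "\<rho> ` T \<in> bases en R' (\<rho> ` E) \<longleftrightarrow> T \<in> bases en R E" if T: "T \<subseteq> E" for T
  proof -
    have "(\<forall>e\<in>\<rho> ` E. en e \<times> en e \<subseteq> con en R' (\<rho> ` T)) \<longleftrightarrow> (\<forall>e\<in>E. en e \<times> en e \<subseteq> con en R T)"
      using sq[OF _ T] by simp
    moreover have "(\<forall>f\<in>\<rho> ` T. \<not> en f \<times> en f \<subseteq> con en R' (\<rho> ` T - {f})) \<longleftrightarrow>
        (\<forall>f\<in>T. \<not> en f \<times> en f \<subseteq> con en R (T - {f}))"
    proof -
      have "en (\<rho> f) \<times> en (\<rho> f) \<subseteq> con en R' (\<rho> ` (T - {f})) \<longleftrightarrow> en f \<times> en f \<subseteq> con en R (T - {f})"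
        if "f \<in> T" for f
        by (rule sq) (use T that in auto)
      then show ?thesis by (simp add: d)
    qed
    moreover have "\<rho> ` T \<subseteq> \<rho> ` E" using T by blast
    ultimately show ?thesis using T unfolding bases_def mem_Collect_eq by simp
  qed
  show ?thesis
  proof (intro equalityI subsetI)
    fix T' assume T': "T' \<in> bases en R' (\<rho> ` E)"
    then obtain T where T: "T \<subseteq> E" "T' = \<rho> ` T" using bases_subset[OF T'] by (auto simp: subset_image_iff)
    then show "T' \<in> (`) \<rho> ` bases en R E" using iff T' by blast
  next
    fix T' assume "T' \<in> (`) \<rho> ` bases en R E"
    then obtain T where "T \<in> bases en R E" "T' = \<rho> ` T" by blast
    then show "T' \<in> bases en R' (\<rho> ` E)" using iff[OF bases_subset[of T en R E]] by simp
  qed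
qed

section \<open>Invariance of the two laws under automorphisms\<close>

lemma uavg_image: "inj_on f B \<Longrightarrow> uavg (f ` B) h = uavg B (\<lambda>x. h (f x))"
  by (simp add: uavg_def sum.reindex card_image)

text \<open>Bijectivity of \<sigma> refers to the whole vertex type because \<open>wire W\<close>
  ranges over all points outside \<open>W\<close>, whether or not they belong to the graph.\<close>

locale graph_automorphism = locally_finite_graph G for G :: "('v, 'e) mgraph" +
  fixes \<sigma> :: "'v \<Rightarrow> 'v" and \<rho> :: "'e \<Rightarrow> 'e"
  assumes bij_\<sigma>: "bij \<sigma>" and inj_\<rho>: "inj \<rho>"
    and en_\<rho>: "\<And>e. e \<in> edges G \<Longrightarrow> ends G (\<rho> e) = \<sigma> ` ends G e"
    and \<sigma>_verts: "\<sigma> ` verts G = verts G" and \<rho>_edges: "\<rho> ` edges G = edges G"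
begin

lemma inj_image_\<rho>: "inj_on ((`) \<rho>) A"
  using inj_\<rho> by (auto intro!: inj_onI simp: inj_image_eq_iff)

lemma touching_map: "T \<subseteq> edges G \<Longrightarrow> touching en (\<sigma> ` W) (\<rho> ` T) = \<rho> ` touching en W T"
  using en_\<rho> bij_is_inj[OF bij_\<sigma>] by (fastforce simp: touching_def inj_image_mem_iff)

lemma wire_map: "(\<sigma> u, \<sigma> v) \<in> wire (\<sigma> ` W) \<longleftrightarrow> (u, v) \<in> wire W"
  using bij_is_inj[OF bij_\<sigma>] by (simp add: wire_def inj_image_mem_iff)

lemma con_map_edges: "T \<subseteq> edges G \<Longrightarrow> (\<sigma> u, \<sigma> v) \<in> con en {} (\<rho> ` T) \<longleftrightarrow> (u, v) \<in> con en {} T"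
  by (rule con_map[OF bij_\<sigma>]) (use en_\<rho> in auto)

lemma ust_map: "ust (\<sigma> ` W) h = ust W (\<lambda>T. h (\<rho> ` T))"
proof -
  have "touching en (\<sigma> ` W) (edges G) = \<rho> ` touching en W (edges G)"
    using touching_map[OF order_refl, of W] by (simp add: \<rho>_edges)
  moreover have "bases en (wire (\<sigma> ` W)) (\<rho> ` touching en W (edges G)) =
      (`) \<rho> ` bases en (wire W) (touching en W (edges G))"
    by (rule bases_map[OF bij_\<sigma> inj_\<rho> wire_map]) (simp add: touching_def en_\<rho>)
  ultimately show ?thesis unfolding ust_def by (simp add: uavg_image[OF inj_image_\<rho>])
qed

lemma forest_avg_map:
  assumes T: "T \<subseteq> edges G"
  shows "forest_avg en (\<sigma> ` W) (\<rho> ` T) h = forest_avg en W T (\<lambda>T. h (\<rho> ` T))"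
proof -
  have "bases en (wire (\<sigma> ` W) \<inter> con en {} (\<rho> ` T)) (\<rho> ` touching en W T) =
      (`) \<rho> ` bases en (wire W \<inter> con en {} T) (touching en W T)"
    by (rule bases_map[OF bij_\<sigma> inj_\<rho>]) (use T in \<open>auto simp: wire_map con_map_edges touching_def en_\<rho>\<close>)
  then show ?thesis
    unfolding forest_avg_def touching_map[OF T] by (simp add: uavg_image[OF inj_image_\<rho>])
qed

lemma closure_map_map:
  assumes F: "F \<subseteq> edges G"
  shows "closure_map (\<rho> ` F) = \<rho> ` closure_map F"
proof -
  have F': "\<rho> ` F \<subseteq> edges G" using F \<rho>_edges by blast
  have "en (\<rho> e) \<times> en (\<rho> e) \<subseteq> con en {} (\<rho> ` F) \<longleftrightarrow> en e \<times> en e \<subseteq> con en {} F" if "e \<in> edges G" for e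
  proof -
    have "en (\<rho> e) \<times> en (\<rho> e) \<subseteq> con en {} (\<rho> ` F) \<longleftrightarrow>
        (\<forall>x\<in>en e. \<forall>y\<in>en e. (\<sigma> x, \<sigma> y) \<in> con en {} (\<rho> ` F))"
      unfolding en_\<rho>[OF that] by blast
    then show ?thesis unfolding con_map_edges[OF F] by blast
  qed
  then have "con_closure en (\<rho> ` edges G) (\<rho> ` F) = \<rho> ` con_closure en (edges G) F"
    unfolding con_closure_def by auto
  then show ?thesis unfolding closure_map_eq[OF F] closure_map_eq[OF F'] by (simp add: \<rho>_edges)
qed

lemma exhausts_map:
  assumes "exhausts W (verts G)"
  shows "exhausts (\<lambda>n. \<sigma> ` W n) (verts G)"
  unfolding exhausts_def
proof (intro conjI allI impI)
  show "finite (\<sigma> ` W n)" for n using assms by (simp add: exhausts_def)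
  show "\<sigma> ` W n \<subseteq> verts G" for n
    using assms image_mono[of "W n" "verts G" \<sigma>] by (simp add: exhausts_def \<sigma>_verts)
  fix K assume K: "finite K" "K \<subseteq> verts G"
  then obtain L where L: "L \<subseteq> verts G" "K = \<sigma> ` L" using \<sigma>_verts by (metis subset_image_iff)
  have "finite L" using K(1) L(2) bij_is_inj[OF bij_\<sigma>] by (metis finite_imageD inj_on_subset subset_UNIV)
  then have "\<forall>\<^sub>F n in sequentially. L \<subseteq> W n" using assms L unfolding exhausts_def by blast
  then show "\<forall>\<^sub>F n in sequentially. K \<subseteq> \<sigma> ` W n" by (rule eventually_mono) (use L in auto)
qed

text \<open>Images of exhausting sets exhaust again, and the limit does not depend on the
  sequence.\<close>

lemma measure_WSF_map:
  assumes S: "finite S" "S \<subseteq> edges G"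
  shows "measure (WSF G) {T \<in> Pow (edges G). \<rho> ` S \<subseteq> T} = measure (WSF G) {T \<in> Pow (edges G). S \<subseteq> T}"
proof -
  obtain o' where o': "o' \<in> verts G" using connected by (auto simp: connected_graph_def)
  note ex = graph_ball_exhausts[OF o']
  have lim: "(\<lambda>n. ust (W n) (\<lambda>T. of_bool (A \<subseteq> T))) \<longlonglongrightarrow> measure (WSF G) {T \<in> Pow (edges G). A \<subseteq> T}"
    if "exhausts W (verts G)" "finite A" "A \<subseteq> edges G" for W A
    using integral_WSF_local[OF that, of "\<lambda>B. of_bool (A \<subseteq> B)"] integral_of_bool_superset[OF that(2)] by simp
  have "(\<lambda>n. ust (\<sigma> ` graph_ball o' n) (\<lambda>T. of_bool (\<rho> ` S \<subseteq> T))) \<longlonglongrightarrow>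
      measure (WSF G) {T \<in> Pow (edges G). \<rho> ` S \<subseteq> T}"
    using S \<rho>_edges by (intro lim exhausts_map ex) auto
  moreover have "ust (\<sigma> ` graph_ball o' n) (\<lambda>T. of_bool (\<rho> ` S \<subseteq> T)) = ust (graph_ball o' n) (\<lambda>T. of_bool (S \<subseteq> T))" for n
    unfolding ust_map by (simp add: inj_image_subset_iff[OF inj_\<rho>])
  ultimately show ?thesis using LIMSEQ_unique[OF lim[OF ex S]] by simp
qed

lemma image_\<rho>_measurable: "(`) \<rho> \<in> measurable (WSF G) (subgraph_space G)"
proof (rule measurable_subgraph_spaceI)
  show "\<rho> ` F \<subseteq> edges G" if "F \<in> space (WSF G)" for F
    using that \<rho>_edges image_mono[of F "edges G" \<rho>] by simp
  fix e assume "e \<in> edges G"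
  then obtain f where f: "f \<in> edges G" "e = \<rho> f" using \<rho>_edges by blast
  have "{x \<in> space (WSF G). e \<in> \<rho> ` x} = {T \<in> Pow (edges G). f \<in> T}"
    using inj_\<rho> f by (auto simp: inj_image_mem_iff)
  then show "{x \<in> space (WSF G). e \<in> \<rho> ` x} \<in> sets (WSF G)" using edge_event_sets[of G f] by simp
qed

lemma distr_WSF_map: "distr (WSF G) (subgraph_space G) ((`) \<rho>) = WSF G"
proof (rule subgraph_measure_eqI[OF prob_space.prob_space_distr[OF prob_space_WSF image_\<rho>_measurable] prob_space_WSF])
  fix S assume S: "finite S" "S \<subseteq> edges G"
  then obtain A where A: "A \<subseteq> edges G" "S = \<rho> ` A" using \<rho>_edges by (metis subset_image_iff)
  have finA: "finite A" using S(1) A(2) inj_\<rho> by (metis finite_imageD inj_on_subset subset_UNIV)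
  have "measure (distr (WSF G) (subgraph_space G) ((`) \<rho>)) {T \<in> Pow (edges G). S \<subseteq> T} =
      measure (WSF G) ((`) \<rho> -` {T \<in> Pow (edges G). S \<subseteq> T} \<inter> space (WSF G))"
    by (rule measure_distr[OF image_\<rho>_measurable superset_event_sets[OF S(1)]])
  also have "(`) \<rho> -` {T \<in> Pow (edges G). S \<subseteq> T} \<inter> space (WSF G) = {T \<in> Pow (edges G). A \<subseteq> T}"
    using \<rho>_edges A by (auto simp: inj_image_subset_iff[OF inj_\<rho>])
  also have "measure (WSF G) \<dots> = measure (WSF G) {T \<in> Pow (edges G). S \<subseteq> T}"
    using measure_WSF_map[OF finA A(1)] A(2) by simp
  finally show "measure (distr (WSF G) (subgraph_space G) ((`) \<rho>)) {T \<in> Pow (edges G). S \<subseteq> T} =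
      measure (WSF G) {T \<in> Pow (edges G). S \<subseteq> T}" .
qed simp_all

lemma edge_prob_map: "e \<in> edges G \<Longrightarrow> edge_prob (\<rho> e) = edge_prob e"
  using measure_WSF_map[of "{e}"] by (simp add: edge_prob_def)

text \<open>Invariance of \<open>WSF G\<close> lets the forest be replaced by its image, and closure
  and blockwise wiring commute with the automorphism. What remains is a change of the exhausting
  sets.\<close>

lemma resampled_edge_prob_map:
  assumes e: "e \<in> edges G"
  shows "resampled_edge_prob (\<rho> e) = resampled_edge_prob e"
proof -
  obtain o' where o': "o' \<in> verts G" using connected by (auto simp: connected_graph_def)
  let ?B = "graph_ball o'"
  note ex = graph_ball_exhausts[OF o']
  have \<rho>e: "\<rho> e \<in> edges G" using e \<rho>_edges by blast
  let ?h = "\<lambda>e T. of_bool ({e} \<subseteq> T) :: real"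
  have "(\<integral>F. forest_avg en (\<sigma> ` ?B n) (closure_map F) (?h (\<rho> e)) \<partial>WSF G) =
      (\<integral>F. forest_avg en (?B n) (closure_map F) (?h e) \<partial>WSF G)" for n
  proof -
    have "(\<integral>F. forest_avg en (\<sigma> ` ?B n) (closure_map F) (?h (\<rho> e)) \<partial>WSF G) =
        (\<integral>F. forest_avg en (\<sigma> ` ?B n) (closure_map F) (?h (\<rho> e)) \<partial>distr (WSF G) (subgraph_space G) ((`) \<rho>))"
      by (simp only: distr_WSF_map)
    also have "\<dots> = (\<integral>F. forest_avg en (\<sigma> ` ?B n) (closure_map (\<rho> ` F)) (?h (\<rho> e)) \<partial>WSF G)"
      by (rule integral_distr[OF image_\<rho>_measurable])
        (rule measurable_compose[OF closure_map_measurable forest_avg_measurable], simp add: finite_graph_ball)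
    also have "\<dots> = (\<integral>F. forest_avg en (?B n) (closure_map F) (?h e) \<partial>WSF G)"
    proof (rule Bochner_Integration.integral_cong[OF refl])
      fix F assume "F \<in> space (WSF G)"
      then have F: "F \<subseteq> edges G" by simp
      show "forest_avg en (\<sigma> ` ?B n) (closure_map (\<rho> ` F)) (?h (\<rho> e)) = forest_avg en (?B n) (closure_map F) (?h e)"
        unfolding closure_map_map[OF F] forest_avg_map[OF closure_map_subset[OF F]]
        using inj_\<rho> by (simp add: inj_image_mem_iff)
    qed
    finally show ?thesis .
  qed
  then have "(\<lambda>n. \<integral>F. forest_avg en (?B n) (closure_map F) (?h e) \<partial>WSF G) \<longlonglongrightarrow> resampled_edge_prob (\<rho> e)"
    using resampled_superset_tendsto[OF exhausts_map[OF ex], of "{\<rho> e}"] \<rho>e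
    unfolding resampled_edge_prob_def by simp
  moreover have "(\<lambda>n. \<integral>F. forest_avg en (?B n) (closure_map F) (?h e) \<partial>WSF G) \<longlonglongrightarrow> resampled_edge_prob e"
    unfolding resampled_edge_prob_def using e by (intro resampled_superset_tendsto ex) auto
  ultimately show ?thesis using LIMSEQ_unique by blast
qed

end

section \<open>The integer lattice\<close>

lemma lattice_simps:
  "verts lattice_graph = UNIV" "ends lattice_graph = (\<lambda>e. e)"
  "e \<in> edges lattice_graph \<longleftrightarrow> (\<exists>x y. e = {x, y} \<and> (\<Sum>i\<in>UNIV. \<bar>x $ i - y $ i\<bar>) = 1)"
  by (auto simp: lattice_graph_def)

lemma finite_card_vec_box:
  fixes A :: "int set"
  assumes "finite A"
  shows "finite {x :: int ^ 'd::finite. \<forall>i. x $ i \<in> A}"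
    and "card {x :: int ^ 'd. \<forall>i. x $ i \<in> A} = card A ^ CARD('d)"
proof -
  have bij: "bij_betw (\<lambda>f. \<chi> i. f i) (UNIV \<rightarrow>\<^sub>E A) {x :: int ^ 'd. \<forall>i. x $ i \<in> A}"
    by (rule bij_betwI[where g = "\<lambda>x i. x $ i"]) auto
  have fin: "finite ((UNIV :: 'd set) \<rightarrow>\<^sub>E A)" using assms by (intro finite_PiE) auto
  then show "finite {x :: int ^ 'd. \<forall>i. x $ i \<in> A}" using bij_betw_finite[OF bij] by simp
  show "card {x :: int ^ 'd. \<forall>i. x $ i \<in> A} = card A ^ CARD('d)"
    using bij_betw_same_card[OF bij] by (simp add: card_PiE)
qed

lemma lattice_edge_coord:
  fixes x y :: "int ^ 'd::finite"
  assumes "(\<Sum>i\<in>UNIV. \<bar>x $ i - y $ i\<bar>) = 1"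
  shows "\<bar>x $ i - y $ i\<bar> \<le> 1"
  using member_le_sum[of i UNIV "\<lambda>i. \<bar>x $ i - y $ i\<bar>"] assms by simp

text \<open>Induction on the l1 distance: \<open>w\<close> moves one coordinate of \<open>u\<close>
  by one unit towards \<open>v\<close>.\<close>

lemma lattice_con:
  fixes u v :: "int ^ 'd::finite"
  shows "(u, v) \<in> con (\<lambda>e. e) {} (edges lattice_graph)"
proof (induction "nat (\<Sum>i\<in>UNIV. \<bar>u $ i - v $ i\<bar>)" arbitrary: u rule: less_induct)
  case less
  show ?case
  proof (cases "u = v")
    case False
    then obtain j where j: "u $ j \<noteq> v $ j" by (auto simp: vec_eq_iff)
    define w :: "int ^ 'd" where "w = (\<chi> i. if i = j then u $ i + sgn (v $ i - u $ i) else u $ i)"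
    have r: "(\<Sum>i\<in>UNIV. f i) = f j + (\<Sum>i\<in>UNIV - {j}. f i)" for f :: "'d \<Rightarrow> int"
      by (rule sum.remove) auto
    have "(\<Sum>i\<in>UNIV. \<bar>u $ i - w $ i\<bar>) = 1"
      unfolding r using j by (simp add: w_def sgn_if)
    then have "{u, w} \<in> edges lattice_graph" unfolding lattice_simps by blast
    then have "(u, w) \<in> con (\<lambda>e. e) {} (edges lattice_graph)" by (rule con_edge) auto
    moreover have "(w, v) \<in> con (\<lambda>e. e) {} (edges lattice_graph)"
    proof (rule less)
      have "\<bar>w $ j - v $ j\<bar> < \<bar>u $ j - v $ j\<bar>" using j by (auto simp: w_def sgn_if)
      moreover have "(\<Sum>i\<in>UNIV - {j}. \<bar>w $ i - v $ i\<bar>) = (\<Sum>i\<in>UNIV - {j}. \<bar>u $ i - v $ i\<bar>)"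
        by (intro sum.cong) (auto simp: w_def)
      moreover have "0 \<le> (\<Sum>i\<in>UNIV. \<bar>w $ i - v $ i\<bar>)" by (intro sum_nonneg) auto
      ultimately show "nat (\<Sum>i\<in>UNIV. \<bar>w $ i - v $ i\<bar>) < nat (\<Sum>i\<in>UNIV. \<bar>u $ i - v $ i\<bar>)"
        unfolding r by linarith
    qed
    ultimately show ?thesis by (rule con_trans)
  qed simp
qed

lemma locally_finite_graph_lattice: "locally_finite_graph (lattice_graph :: (int ^ 'd::finite, (int ^ 'd) set) mgraph)"
proof
  let ?G = "lattice_graph :: (int ^ 'd, (int ^ 'd) set) mgraph"
  have "\<exists>u v. ends ?G e = {u, v}" if "e \<in> edges ?G" for e
    using that unfolding lattice_simps by blast
  then show two: "two_ended (ends ?G) (edges ?G)" unfolding two_ended_def by blast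
  show "connected_graph ?G"
    unfolding connected_graph_def adj_rtrancl[OF two] by (simp add: lattice_simps(1,2) lattice_con)
  show "finite {e \<in> edges ?G. v \<in> ends ?G e}" for v
  proof (rule finite_subset)
    define A where "A = (\<Union>i\<in>UNIV. {v $ i - 1..v $ i + 1})"
    show "{e \<in> edges ?G. v \<in> ends ?G e} \<subseteq> (\<lambda>y. {v, y}) ` {y. \<forall>i. y $ i \<in> A}"
    proof
      fix e assume "e \<in> {e \<in> edges ?G. v \<in> ends ?G e}"
      then obtain x y where e: "e = {x, y}" "(\<Sum>i\<in>UNIV. \<bar>x $ i - y $ i\<bar>) = 1" "v = x \<or> v = y"
        by (auto simp: lattice_simps)
      then obtain z where z: "e = {v, z}" "(\<Sum>i\<in>UNIV. \<bar>v $ i - z $ i\<bar>) = 1"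
        by (auto simp: abs_minus_commute insert_commute)
      have "z $ i \<in> A" for i
        using lattice_edge_coord[OF z(2), of i] by (auto simp: A_def intro!: exI[of _ i])
      then show "e \<in> (\<lambda>y. {v, y}) ` {y. \<forall>i. y $ i \<in> A}" using z by blast
    qed
    show "finite ((\<lambda>y. {v, y}) ` {y. \<forall>i. y $ i \<in> A})"
      by (intro finite_imageI finite_card_vec_box(1)) (simp add: A_def)
  qed
qed (simp add: lattice_simps)

lemma lattice_translation:
  fixes c :: "int ^ 'd::finite"
  shows "graph_automorphism lattice_graph (\<lambda>v. v + c) ((`) (\<lambda>v. v + c))"
proof -
  let ?G = "lattice_graph :: (int ^ 'd, (int ^ 'd) set) mgraph"
  have edge: "(\<lambda>v. v + c) ` e \<in> edges ?G" if "e \<in> edges ?G" for e and c :: "int ^ 'd"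
  proof -
    from that obtain x y where e: "e = {x, y}" "(\<Sum>i\<in>UNIV. \<bar>x $ i - y $ i\<bar>) = 1"
      unfolding lattice_simps by blast
    have "(\<lambda>v. v + c) ` e = {x + c, y + c}" using e by auto
    moreover have "(\<Sum>i\<in>UNIV. \<bar>(x + c) $ i - (y + c) $ i\<bar>) = 1" using e(2) by simp
    ultimately show ?thesis unfolding lattice_simps by blast
  qed
  have bij: "bij (\<lambda>v. v + c)" by (rule bij_betwI[where g = "\<lambda>v. v - c"]) auto
  show ?thesis
  proof (intro graph_automorphism.intro locally_finite_graph_lattice graph_automorphism_axioms.intro)
    show "bij (\<lambda>v. v + c)" by (rule bij)
    show "inj ((`) (\<lambda>v. v + c))" using bij_is_inj[OF bij] by (auto simp: inj_def inj_image_eq_iff)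
    show "(\<lambda>v. v + c) ` verts ?G = verts ?G"
      using bij_is_surj[OF bij] by (simp add: lattice_simps)
    show "(`) (\<lambda>v. v + c) ` edges ?G = edges ?G"
    proof (intro equalityI subsetI)
      fix e assume e: "e \<in> edges ?G"
      have "e = (\<lambda>v. v + c) ` ((\<lambda>v. v + (- c)) ` e)" by (simp add: image_image)
      then show "e \<in> (`) (\<lambda>v. v + c) ` edges ?G" using edge[OF e, of "- c"] by blast
    qed (use edge in auto)
  qed (simp add: lattice_simps)
qed

section \<open>Boxes and their volumes\<close>

definition lattice_box :: "nat \<Rightarrow> (int ^ 'd::finite) set" where
  "lattice_box m = {x. \<forall>i. x $ i \<in> {- int m..int m}}"

lemma finite_lattice_box: "finite (lattice_box m)"
  unfolding lattice_box_def by (rule finite_card_vec_box) simp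

lemma card_lattice_box: "card (lattice_box m :: (int ^ 'd::finite) set) = (2 * m + 1) ^ CARD('d)"
proof -
  have "card {- int m..int m} = 2 * m + 1" by simp
  then show ?thesis unfolding lattice_box_def by (subst finite_card_vec_box(2)) simp_all
qed

text \<open>The box of radius \<open>?n\<close> would already have more than \<open>?n\<close>
  points.\<close>

lemma infinite_lattice: "infinite (UNIV :: (int ^ 'd::finite) set)"
proof
  assume fin: "finite (UNIV :: (int ^ 'd) set)"
  let ?n = "card (UNIV :: (int ^ 'd) set)"
  have "?n < (2 * ?n + 1) ^ 1" by simp
  also have "\<dots> \<le> (2 * ?n + 1) ^ CARD('d)" by (rule power_increasing) (auto simp: Suc_leI)
  also have "\<dots> \<le> ?n"
    using card_mono[OF fin subset_UNIV, of "lattice_box ?n"] by (simp only: card_lattice_box)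
  finally show False by simp
qed

lemma touching_lattice_box:
  assumes "e \<in> touching (\<lambda>e. e) (lattice_box m) (edges lattice_graph)"
  shows "e \<subseteq> lattice_box (Suc m)"
proof -
  obtain x y where e: "e = {x, y}" and s: "(\<Sum>i\<in>UNIV. \<bar>x $ i - y $ i\<bar>) = 1"
    and b: "x \<in> lattice_box m \<or> y \<in> lattice_box m"
    using assms by (auto simp: touching_def lattice_simps)
  have "x $ i \<in> {- int (Suc m)..int (Suc m)} \<and> y $ i \<in> {- int (Suc m)..int (Suc m)}" for i
  proof -
    have "x $ i \<in> {- int m..int m} \<or> y $ i \<in> {- int m..int m}" using b by (auto simp: lattice_box_def)
    then show ?thesis using lattice_edge_coord[OF s, of i] by auto
  qed
  then show ?thesis by (auto simp: e lattice_box_def)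
qed

theorem theorem1p4:
  fixes Zd :: "(int ^ 'd::finite, (int ^ 'd) set) mgraph"
  defines "Zd \<equiv> lattice_graph"
  shows "WSF_random Zd
           (distr (WSF Zd) (subgraph_space Zd)
              (\<lambda>F. edges (component_closure Zd (spanning_subgraph Zd F))))
         = WSF Zd"
proof -
  interpret locally_finite_graph Zd unfolding Zd_def by (rule locally_finite_graph_lattice)
  have en: "ends Zd = (\<lambda>e. e)" and vertsZ: "verts Zd = UNIV" by (simp_all add: Zd_def lattice_simps)
  define diff where "diff e = edge_prob e - resampled_edge_prob e" for e
  have diff_nonneg: "0 \<le> diff e" if "e \<in> edges Zd" for e
    using resampled_superset_le[of "{e}"] that by (simp add: diff_def edge_prob_def resampled_edge_prob_def)
  have diff_translate: "diff ((\<lambda>v. v + c) ` e) = diff e" if "e \<in> edges Zd" for e c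
  proof -
    interpret graph_automorphism Zd "\<lambda>v. v + c" "(`) (\<lambda>v. v + c)"
      unfolding Zd_def by (rule lattice_translation)
    show ?thesis unfolding diff_def using that by (simp add: edge_prob_map resampled_edge_prob_map)
  qed
  \<comment> \<open>\<open>2 * m + 1\<close> and \<open>2 * m + 3\<close> are the side lengths of a
    box and of the next one, which contains all edges touching the first; the right-hand side is the
    volume of the boundary layer.\<close>
  have bound: "real ((2 * m + 1) ^ CARD('d)) * diff e \<le> real ((2 * m + 3) ^ CARD('d)) - real ((2 * m + 1) ^ CARD('d))"
    if e: "e \<in> edges Zd" for e m
  proof -
    let ?W = "lattice_box m :: (int ^ 'd) set" and ?V = "lattice_box (Suc m) :: (int ^ 'd) set"
    let ?E = "touching (ends Zd) ?W (edges Zd)"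
    have finE: "finite ?E" by (rule finite_touching[OF finite_lattice_box])
    have E_sub: "?E \<subseteq> edges Zd" by (rule touching_subset)
    obtain a b where ab: "e = {a, b}" using e by (auto simp: Zd_def lattice_simps)
    \<comment> \<open>Translates of \<open>e\<close> with \<open>a\<close> moved to each point of
      the box: as many distinct edges touching the box as it has points, all with the same
      \<open>diff\<close>.\<close>
    define \<phi> where "\<phi> x = (\<lambda>v. v + (x - a)) ` e" for x
    have \<phi>_eq: "\<phi> x = {x, x + (b - a)}" for x by (auto simp: \<phi>_def ab algebra_simps)
    have inj: "inj \<phi>"
    proof (rule injI)
      fix x y assume "\<phi> x = \<phi> y"
      then have *: "x = y \<or> (x = y + (b - a) \<and> x + (b - a) = y)"
        unfolding \<phi>_eq by (auto simp: doubleton_eq_iff)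
      \<comment> \<open>Equality with swapped ends would make \<open>b - a\<close> its own negative,
        which is impossible coordinatewise unless it is 0.\<close>
      show "x = y"
      proof (rule ccontr)
        assume "x \<noteq> y"
        then have "x = y + (b - a)" "x + (b - a) = y" using * by auto
        then have "x $ i = y $ i" for i by (auto simp: vec_eq_iff dest!: spec[of _ i])
        then show False using \<open>x \<noteq> y\<close> by (simp add: vec_eq_iff)
      qed
    qed
    have \<phi>_edge: "\<phi> x \<in> edges Zd" for x
      using graph_automorphism.\<rho>_edges[OF lattice_translation, of "x - a"] e
      unfolding \<phi>_def Zd_def by blast
    have \<phi>_img: "\<phi> ` ?W \<subseteq> ?E" using \<phi>_edge by (auto simp: touching_def en \<phi>_eq)
    have "card ?W * diff e = (\<Sum>x\<in>?W. diff (\<phi> x))"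
      unfolding \<phi>_def by (simp add: diff_translate[OF e])
    also have "\<dots> = (\<Sum>f\<in>\<phi> ` ?W. diff f)"
      by (subst sum.reindex) (auto intro: inj_on_subset[OF inj])
    \<comment> \<open>Domination enters here: nonnegative differences allow the sum to be extended
      to all edges touching the box.\<close>
    also have "\<dots> \<le> (\<Sum>f\<in>?E. diff f)"
      using E_sub by (intro sum_mono2[OF finE \<phi>_img] diff_nonneg) auto
    also have "\<dots> = (\<Sum>f\<in>?E. edge_prob f) - (\<Sum>f\<in>?E. resampled_edge_prob f)"
      by (simp add: diff_def sum_subtractf)
    also have "\<dots> \<le> card ?V - real (card ?W)"
    proof (rule diff_mono)
      show "(\<Sum>f\<in>?E. edge_prob f) \<le> card ?V"
      proof (rule sum_edge_prob_le[OF finite_lattice_box _ finE E_sub])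
        show "ends Zd f \<subseteq> ?V" if "f \<in> ?E" for f
          using touching_lattice_box[of f m] that unfolding en by (simp add: Zd_def)
      qed
      show "real (card ?W) \<le> (\<Sum>f\<in>?E. resampled_edge_prob f)"
        by (rule sum_resampled_edge_prob_ge[OF _ finite_lattice_box]) (simp_all add: vertsZ infinite_lattice)
    qed
    finally show ?thesis by (simp add: card_lattice_box add.commute)
  qed
  have "diff e \<le> 0" if e: "e \<in> edges Zd" for e
  proof -
    have "diff e \<le> (1 + 2 * inverse (real (Suc m))) ^ CARD('d) - 1" for m
    proof -
      let ?p = "real (2 * m + 1)"
      have p: "0 < ?p" by simp
      have "?p ^ CARD('d) * diff e \<le> real (2 * m + 3) ^ CARD('d) - ?p ^ CARD('d)"
        using bound[OF e, of m] by simp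
      then have "diff e \<le> (real (2 * m + 3) ^ CARD('d) - ?p ^ CARD('d)) / ?p ^ CARD('d)"
        using p by (simp add: pos_le_divide_eq mult.commute)
      also have "\<dots> = (real (2 * m + 3) / ?p) ^ CARD('d) - 1"
        using p by (simp add: diff_divide_distrib power_divide)
      \<comment> \<open>The quotient is \<open>1 + 2 / (2 * m + 1)\<close>, weakened to a bound by a
        standard null sequence.\<close>
      also have "real (2 * m + 3) / ?p \<le> 1 + 2 * inverse (real (Suc m))"
        by (simp add: field_simps)
      then have "(real (2 * m + 3) / ?p) ^ CARD('d) - 1 \<le> (1 + 2 * inverse (real (Suc m))) ^ CARD('d) - 1"
        by (intro diff_right_mono power_mono) auto
      finally show ?thesis .
    qed
    moreover have "(\<lambda>m. (1 + 2 * inverse (real (Suc m))) ^ CARD('d) - 1) \<longlonglongrightarrow> (1 + 2 * 0) ^ CARD('d) - 1"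
      by (intro tendsto_intros LIMSEQ_inverse_real_of_nat)
    ultimately show ?thesis by (intro tendsto_lowerbound[where a = "diff e"]) auto
  qed
  then have "resampled = WSF Zd"
    by (intro resampled_eq_WSF) (simp add: diff_def edge_prob_def resampled_edge_prob_def)
  then show ?thesis unfolding resampled_def closure_map_def[abs_def] .
qed

end
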